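(* Let $\lambda,\mu\in P$, let $\Gamma=(\gamma_1,\dots,\gamma_m)$ be an alcove path from $A_\circ$ to $A_\lambda$ and let $\Xi=(\xi_1,\dots,\xi_p)$ be an alcove path from $A_\circ$ to $A_\mu$. Assume that both equalities $\mathbf{e}^\lambda\cdot[\mathcal{O}_{\mathbf{Q}_G(w)}]=\mathbf{F}_{\lambda,w}(\Gamma)$ and $\mathbf{e}^\mu\cdot[\mathcal{O}_{\mathbf{Q}_G(w)}]=\mathbf{F}_{\mu,w}(\Xi)$ hold in $\mathbb{K}\subset K_{H\times\mathbb{C}^*}(\mathbf{Q}_G^{\mathrm{rat}})$ for all $w\in W$. Then $\mathbf{e}^{\lambda+\mu}\cdot[\mathcal{O}_{\mathbf{Q}_G(w)}]=\mathbf{F}_{\lambda+\mu,w}(\Gamma*\Xi)$ in $\mathbb{K}\subset K_{H\times\mathbb{C}^*}(\mathbf{Q}_G^{\mathrm{rat}})$ for all $w\in W$, where $\Gamma*\Xi=(\gamma_1,\dots,\gamma_m,\xi_1,\dots,\xi_p)$ is the concatenation, an alcove path from $A_\circ$ to $A_{\lambda+\mu}$.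
   Context: **Root data.** $G$ is a simply-connected simple algebraic group over $\mathbb{C}$ of simply-laced type, not of type $E_8$, $B=HN$ a Borel subgroup with maximal torus $H$ and unipotent radical $N$, $\mathfrak{h}=\mathrm{Lie}(H)$, $\langle\cdot,\cdot\rangle:\mathfrak{h}^*\times\mathfrak{h}\to\mathbb{C}$ the pairing. $\Delta$ is the root system, $\Delta^+$ the positive roots, $\Delta^-=-\Delta^+$, $\alpha_i$ $(i\in I)$ the simple roots, $\alpha^\vee$ the coroot of $\alpha$, $\theta$ the highest root, $\rho=\frac12\sum_{\alpha\in\Delta^+}\alpha$, $Q=\sum\mathbb{Z}\alpha_i$, $Q^\vee=\sum\mathbb{Z}\alpha_i^\vee$, $P=\sum\mathbb{Z}\varpi_i$ the weight lattice ($\varpi_i$ fundamental weights), $P^+$ the dominant weights, $\mathfrak{h}^*_{\mathbb{R}}=\mathbb{R}\otimes P$. $\mathbb{Z}[P]$ is the group algebra with basis $\mathbf{e}^\lambda$. For $\alpha\in\Delta$: $\mathrm{sgn}(\alpha)=\pm1$ if $\alpha\in\Delta^{\pm}$, $|\alpha|=\mathrm{sgn}(\alpha)\alpha$, $s_\alpha\nu=\nu-\langle\nu,\alpha^\vee\rangle\alpha$. $W$ is the Weyl group, $\ell$ its length function, $<$ its Bruhat order, $w_\circ$ its longest element. $W_{\mathrm{af}}=W\ltimes\{t_\xi\mid\xi\in Q^\vee\}$ is the affine Weyl group. **Quantum Bruhat graph.** $\mathrm{QBG}(W)$ is the directed graph with vertex set $W$ and edges $x\xrightarrow{\alpha}y$,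 labeled by $\alpha\in\Delta^+$, whenever $y=xs_\alpha$ and either $\ell(y)=\ell(x)+1$ (Bruhat edge) or $\ell(y)=\ell(x)-2\langle\rho,\alpha^\vee\rangle+1$ (quantum edge). **Alcove paths.** For $\alpha\in\Delta$, $k\in\mathbb{Z}$: $H_{\alpha,k}=\{\nu\in\mathfrak{h}^*_{\mathbb{R}}\mid\langle\nu,\alpha^\vee\rangle=k\}$, and $\hat r_{\alpha,k}(\nu)=s_\alpha\nu+k\alpha$ is the affine reflection in it. Alcoves are the open regions cut out by all the $H_{\alpha,k}$; $A_\circ=\{\nu\mid 0<\langle\nu,\alpha^\vee\rangle<1\ \forall\alpha\in\Delta^+\}$. For adjacent (distinct, sharing a wall) alcoves, $A\xrightarrow{\alpha}B$ means the common wall is orthogonal to $\alpha\in\Delta$ and $\alpha$ points in the direction from $A$ to $B$. An alcove path from $A_\circ$ to $A_\lambda:=A_\circ+\lambda$ $(\lambda\in P)$ is a sequence of successively adjacent alcoves $A_\circ=A_0\xrightarrow{\gamma_1}A_1\xrightarrow{\gamma_2}\cdots\xrightarrow{\gamma_m}A_m=A_\lambda$, written $\Gamma=(\gamma_1,\dots,\gamma_m)$. $H_{\gamma_t,l_t}$ denotes the hyperplane between $A_{t-1}$ and $A_t$, and $l_t'=\langle\lambda,\gamma_t^\vee\rangle-l_t$. **Decorated quantum walks.** For $w\in W$, $\mathbf{QW}_{\lambda,w}(\Gamma)$ is the set of sequences $\mathbf{w}=(w_0,\dots,w_m)$ in $W$ with $w_0=w$, $w_t\in\{w_{t-1},s_{\gamma_t}w_{t-1}\}$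 for $1\le t\le m$, and such that whenever $w_t=s_{\gamma_t}w_{t-1}$, $w_{t-1}\to w_t$ is an edge of $\mathrm{QBG}(W)$. Set $\mathrm{end}(\mathbf{w})=w_m$, $T(\mathbf{w})=\{t\mid w_t=s_{\gamma_t}w_{t-1}\}$, $T^-(\mathbf{w})=\{t\mid w_{t-1}>w_t\}$, $S(\mathbf{w})=\{t\mid w_t=w_{t-1}\text{ and }-w_t^{-1}\gamma_t\text{ is a simple root}\}$. $\widetilde{\mathbf{QW}}_{\lambda,w}(\Gamma)$ is the set of pairs $(\mathbf{w},\mathbf{b})$ with $\mathbf{w}\in\mathbf{QW}_{\lambda,w}(\Gamma)$ and $\mathbf{b}:S(\mathbf{w})\to\{0,1\}$. For such a pair: - $(-1)^{(\mathbf{w},\mathbf{b})}=\prod_{t\in T(\mathbf{w}),\,w_{t-1}^{-1}\gamma_t\in\Delta^+}(-1)\cdot\prod_{t\in S(\mathbf{w})}(-1)^{\mathbf{b}(t)}$; - $\mathrm{qwt}_t(\mathbf{w},\mathbf{b})=\sum_{u\le t,\,u\in T^-(\mathbf{w})}|w_u^{-1}\gamma_u|-\sum_{u\le t,\,u\in S(\mathbf{w})}\mathbf{b}(u)w_u^{-1}\gamma_u\in Q$, $\mathrm{qwt}=\mathrm{qwt}_m$; $\mathrm{qwt}^\vee_t(\mathbf{w},\mathbf{b})=\sum_{u\le t,\,u\in T^-(\mathbf{w})}|w_u^{-1}\gamma_u|^\vee-\sum_{u\le t,\,u\in S(\mathbf{w})}\mathbf{b}(u)w_u^{-1}\gamma_u^\vee\in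 Q^\vee$, $\mathrm{qwt}^\vee=\mathrm{qwt}^\vee_m$; - $\hat r_0(\mathbf{w})=w^{-1}$, $\hat r_t(\mathbf{w})=\hat r_{t-1}(\mathbf{w})\hat r_{\gamma_t,l_t}$ if $t\in T(\mathbf{w})$ and $\hat r_t(\mathbf{w})=\hat r_{t-1}(\mathbf{w})$ otherwise; $\mathrm{wt}_t(\mathbf{w})=\hat r_t(\mathbf{w})\lambda-\hat r_{t-1}(\mathbf{w})\lambda$ for $1\le t\le m$; $\mathrm{wt}(\mathbf{w})=\hat r_m(\mathbf{w})\lambda\in P$; - $\deg(\mathbf{w},\mathbf{b})=\frac12\langle\mathrm{qwt}(\mathbf{w},\mathbf{b}),\mathrm{qwt}^\vee(\mathbf{w},\mathbf{b})\rangle+\sum_{t=1}^m\langle\mathrm{wt}_t(\mathbf{w}),\mathrm{qwt}_t^\vee(\mathbf{w},\mathbf{b})\rangle-\sum_{t\in T^-(\mathbf{w})}\mathrm{sgn}(\gamma_t)l_t'-\sum_{t\in S(\mathbf{w})}\mathbf{b}(t)l_t'$. For $\lambda\in P$, $w\in W$ and an alcove path $\Gamma$ from $A_\circ$ to $A_\lambda$, set $$\mathbf{F}_{\lambda,w}(\Gamma)=\sum_{(\mathbf{w},\mathbf{b})\in\widetilde{\mathbf{QW}}_{\lambda,w}(\Gamma)}(-1)^{(\mathbf{w},\mathbf{b})}q^{\deg(\mathbf{w},\mathbf{b})}\bigl[\mathcal{O}_{\mathbf{Q}_G(\mathrm{end}(\mathbf{w})t_{\mathrm{qwt}^\vee(\mathbf{w},\mathbf{b})})}(-w_\circ\mathrm{wt}(\mathbf{w})-w_\circ\mathrm{qwt}(\mathbf{w},\mathbf{b}))\bigr].$$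 **K-groups.** $\mathbf{Q}_G^{\mathrm{rat}}$ is the semi-infinite flag manifold, the reduced ind-scheme with $\mathbb{C}$-points $G(\mathbb{C}((z)))/(H(\mathbb{C})\cdot N(\mathbb{C}((z))))$; $\mathbb{C}^*$ acts by loop rotation, with character $q$. For $x\in W_{\mathrm{af}}$, $\mathbf{Q}_G(x)$ is the semi-infinite Schubert variety (closure of the Iwahori orbit indexed by $x$), $\mathcal{O}(\mu)$ $(\mu\in P)$ the equivariant line bundle, and $[\mathcal{O}_{\mathbf{Q}_G(x)}(\mu)]$ the class of $\mathcal{O}_{\mathbf{Q}_G(x)}\otimes\mathcal{O}(\mu)$, with the conventions of Kato–Naito–Sagaki (KNS, "Equivariant K-theory of semi-infinite flag manifolds and the Pieri–Chevalley formula"). $K_{\tilde{\mathbf I}}(\mathbf{Q}_G^{\mathrm{rat}})$ is the KNS equivariant $K$-group for $\tilde{\mathbf I}=\mathbf I\rtimes\mathbb{C}^*$, $\mathbf I\subset G(\mathbb{C}[[z]])$ the Iwahori subgroup; it is a $\mathbb{Z}[P]((q^{-1}))$-module. $K_{H\times\mathbb{C}^*}(\mathbf{Q}_G^{\mathrm{rat}})$ is its $\mathbb{Z}[q^{\pm1}][P]$-submodule of all convergent (in the KNS sense) infinite $\mathbb{Z}[q^{\pm1}][P]$-linear combinations of Schubert classes $[\mathcal{O}_{\mathbf{Q}_G(x)}]$, $x\in W_{\mathrm{af}}$, and $\mathbb{K}$ is the $\mathbb{Z}[q^{\pm1}]$-submodule of finite $\mathbb{Z}[q^{\pm1}]$-linear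 combinations of the classes $[\mathcal{O}_{\mathbf{Q}_G(x)}(\mu)]$, $x\in W_{\mathrm{af}}$, $\mu\in P$ (known to be stable under $\mathbb{Z}[P]$). Concretely, classes in the KNS construction are determined by their twisted Euler characteristics: a finite sum $\sum_jc_j[\mathcal{O}_{\mathbf{Q}_G(x_j)}(\mu_j)]$ with $c_j\in\mathbb{Z}[q^{\pm1}][P]$ is zero if and only if there is $\nu_0\in P^+$ with $\sum_jc_j\,\mathrm{gch}\,V^-_{x_j}(-w_\circ(\mu_j+\nu))=0$ for all $\nu\in\nu_0+P^+$. Here, for $\mu\in P^+$, $V(\mu)$ is Kashiwara's level-zero extremal weight module over the quantum affine algebra $U_v(\mathfrak{g}_{\mathrm{af}})$ of the untwisted affinization of $\mathrm{Lie}(G)$ (simple roots $\alpha_i$, $i\in I$, and $\alpha_0=-\theta+\delta$), generated by an extremal weight vector $v_\mu$ of weight $\mu$ with associated extremal vectors $v_x$ of weight $x\mu$, $x\in W_{\mathrm{af}}$ (where $t_\xi\mu=\mu-\langle\mu,\xi\rangle\delta$); $V_x^-(\mu)=U_v^-(\mathfrak{g}_{\mathrm{af}})v_x$ is the Demazure submodule, and $\mathrm{gch}$ is the graded character in which the weight $\beta+k\delta$ $(\beta\in P,k\in\mathbb{Z})$ contributes $\mathbf{e}^\beta q^k$. *)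

theory Defs
  imports
    "HOL-Analysis.Analysis"
    "HOL-Library.Poly_Mapping"
    "HOL-Library.FuncSet"
    "HOL-Computational_Algebra.Polynomial"
    "HOL-Computational_Algebra.Fraction_Field"
begin

text \<open>
  Conventions. The index set \<open>I\<close> is a finite type \<open>'i\<close>. The weight lattice \<open>P\<close> is \<open>int^'i\<close> in the basis
  of fundamental weights, the coroot lattice \<open>Q\<^sup>\<or>\<close> is \<open>int^'i\<close> in the basis of simple coroots, and
  \<open>\<hh>\<^sup>*\<^sub>\<real>\<close> is \<open>real^'i\<close> in the basis of fundamental weights.
  A Weyl group element is the linear map by which it acts on \<open>P\<close>. The pair \<open>(w, \<xi>)\<close> stands for the
  element \<open>w t\<^sub>\<xi>\<close> of the affine Weyl group, and the pair \<open>(\<beta>, k)\<close> for the level-zero affine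
  weight \<open>\<beta> + k\<delta>\<close>.
\<close>

type_synonym 'i weight = "int^'i"
type_synonym 'i coweight = "int^'i"
type_synonym 'i weyl = "int^'i \<Rightarrow> int^'i"
type_synonym 'i aff_weyl = "'i weyl \<times> 'i coweight"
type_synonym 'i aff_weight = "'i weight \<times> int"

definition pairing :: "int^'i \<Rightarrow> int^'i \<Rightarrow> int" where
  "pairing \<nu> \<xi> = (\<Sum>i\<in>UNIV. \<nu> $ i * \<xi> $ i)"

definition pairing_real :: "real^'i \<Rightarrow> int^'i \<Rightarrow> real" where
  "pairing_real \<nu> \<xi> = (\<Sum>i\<in>UNIV. \<nu> $ i * of_int (\<xi> $ i))"

definition real_weight :: "int^'i \<Rightarrow> real^'i" where
  "real_weight \<nu> = (\<chi> i. of_int (\<nu> $ i))"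

definition dominant :: "(int^'i) set" where
  "dominant = {\<nu>. \<forall>i. 0 \<le> \<nu> $ i}"


subsection \<open>Free associative algebras over \<open>\<rat>(v)\<close>\<close>

text \<open>Words under concatenation, so that finitely supported functions on words, with the
  convolution product of \<open>Poly_Mapping\<close>, form the free associative algebra.\<close>

datatype 'g word = Word (letters: "'g list")

instantiation word :: (type) monoid_add
begin

definition zero_word :: "'a word" where "zero_word = Word []"

definition plus_word :: "'a word \<Rightarrow> 'a word \<Rightarrow> 'a word" where
  "plus_word u w = Word (letters u @ letters w)"

instance
  by standard (auto simp: zero_word_def plus_word_def)

end

type_synonym ratfun = "rat poly fract"

definition qv :: ratfun where "qv = Fract [:0, 1:] 1"

definition qint :: "nat \<Rightarrow> ratfun" where
  "qint n = (qv powi int n - qv powi (- int n)) / (qv - inverse qv)"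

definition qfact :: "nat \<Rightarrow> ratfun" where
  "qfact n = (\<Prod>k\<in>{1..n}. qint k)"

text \<open>The affine index set is \<open>'i option\<close>, with \<open>None\<close> for the node \<open>0\<close>. The Cartan generators
  are indexed by \<open>Q\<^sup>\<or> \<oplus> \<int>c \<oplus> \<int>d\<close>, with \<open>c\<close> the central element and \<open>d\<close> the degree operator.\<close>

datatype ('j, 'h) generator = E_gen 'j | F_gen 'j | K_gen 'h

type_synonym 'i aff_coweight = "'i coweight \<times> int \<times> int"
type_synonym 'i free_alg = "('i option, 'i aff_coweight) generator word \<Rightarrow>\<^sub>0 ratfun"

definition cst :: "ratfun \<Rightarrow> ('i::finite) free_alg" where
  "cst a = Poly_Mapping.single 0 a"

definition Eg :: "('i::finite) option \<Rightarrow> 'i free_alg" where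
  "Eg j = Poly_Mapping.single (Word [E_gen j]) 1"

definition Fg :: "('i::finite) option \<Rightarrow> 'i free_alg" where
  "Fg j = Poly_Mapping.single (Word [F_gen j]) 1"

definition Kg :: "('i::finite) aff_coweight \<Rightarrow> 'i free_alg" where
  "Kg h = Poly_Mapping.single (Word [K_gen h]) 1"

definition divpow :: "('i::finite) free_alg \<Rightarrow> nat \<Rightarrow> 'i free_alg" where
  "divpow a n = cst (inverse (qfact n)) * a ^ n"

definition left_ideal :: "('i::finite) free_alg set \<Rightarrow> bool" where
  "left_ideal L \<longleftrightarrow> 0 \<in> L \<and> (\<forall>a\<in>L. \<forall>b\<in>L. a + b \<in> L) \<and> (\<forall>a. \<forall>b\<in>L. a * b \<in> L)"

definition two_sided_ideal :: "('i::finite) free_alg set \<Rightarrow> bool" where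
  "two_sided_ideal J \<longleftrightarrow> left_ideal J \<and> (\<forall>a\<in>J. \<forall>b. a * b \<in> J)"

definition F_subalgebra :: "('i::finite) free_alg set" where
  "F_subalgebra = {a. \<forall>u\<in>Poly_Mapping.keys a. set (letters u) \<subseteq> range F_gen}"

text \<open>For a left ideal \<open>L\<close>, the dimension of the image in the quotient by \<open>L\<close> of a linear
  subspace \<open>S\<close>, as the maximal size of a subset of \<open>S\<close> linearly independent modulo \<open>L\<close>. It is
  only meaningful when the image is finite-dimensional.\<close>

definition independent_mod :: "('i::finite) free_alg set \<Rightarrow> 'i free_alg set \<Rightarrow> bool" where
  "independent_mod L B \<longleftrightarrow>
     finite B \<and> (\<forall>c. (\<Sum>b\<in>B. cst (c b) * b) \<in> L \<longrightarrow> (\<forall>b\<in>B. c b = 0))"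

definition dim_mod :: "('i::finite) free_alg set \<Rightarrow> 'i free_alg set \<Rightarrow> nat" where
  "dim_mod L S = Sup {card B | B. B \<subseteq> S \<and> independent_mod L B}"


subsection \<open>Coefficient rings and formal combinations\<close>

text \<open>\<open>\<int>[q\<^sup>\<plusminus>\<^sup>1][P]\<close> is the group ring of \<open>P \<times> \<int>\<close>, with \<open>(\<beta>, k)\<close> standing for \<open>e\<^sup>\<beta> q\<^sup>k\<close>. Elements of
  \<open>'i formal\<close> are formal finite sums of symbols \<open>(x, \<mu>)\<close>, each standing for the class
  \<open>[\<O>\<^bsub>Q(x)\<^esub>(\<mu>)]\<close>, with coefficients in this ring.\<close>

type_synonym 'i coeff = "'i aff_weight \<Rightarrow>\<^sub>0 int"
type_synonym 'i formal = "('i aff_weyl \<times> 'i weight) \<Rightarrow>\<^sub>0 'i coeff"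

definition e_exp :: "int^'i \<Rightarrow> ('i::finite) coeff" where
  "e_exp \<beta> = Poly_Mapping.single (\<beta>, 0) 1"

definition q_pow :: "int \<Rightarrow> ('i::finite) coeff" where
  "q_pow k = Poly_Mapping.single (0, k) 1"

definition Schubert :: "('i::finite) aff_weyl \<Rightarrow> 'i weight \<Rightarrow> 'i formal" where
  "Schubert x \<mu> = Poly_Mapping.single (x, \<mu>) 1"

definition coeff_scale :: "('i::finite) coeff \<Rightarrow> 'i formal \<Rightarrow> 'i formal" where
  "coeff_scale c f = Poly_Mapping.map (\<lambda>a. c * a) f"


subsection \<open>The root datum\<close>

definition E8_edges :: "(nat \<times> nat) set" where
  "E8_edges = {(1,3), (3,4), (4,5), (5,6), (6,7), (7,8), (2,4)}"

definition type_E8 :: "int^'i^'i \<Rightarrow> bool" where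
  "type_E8 A \<longleftrightarrow> (\<exists>f. bij_betw f (UNIV :: 'i set) {1..8} \<and>
     (\<forall>i j. i \<noteq> j \<longrightarrow>
        A $ i $ j = (if (f i, f j) \<in> E8_edges \<or> (f j, f i) \<in> E8_edges then -1 else 0)))"

text \<open>A simply-connected simple group is determined by its Cartan matrix
  \<open>A $ i $ j = \<langle>\<alpha>\<^sub>i, \<alpha>\<^sub>j\<^sup>\<or>\<rangle>\<close>, here of finite, indecomposable, simply-laced type.\<close>

locale simply_laced =
  fixes A :: "int^'i^'i"
  assumes diagonal: "A $ i $ i = 2"
    and off_diagonal: "i \<noteq> j \<Longrightarrow> A $ i $ j \<in> {0, -1}"
    and symmetric: "A $ i $ j = A $ j $ i"
    and positive_definite:
      "x \<noteq> 0 \<Longrightarrow> (\<Sum>i\<in>UNIV. \<Sum>j\<in>UNIV. real_of_int (A $ i $ j) * x $ i * x $ j) > 0"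
    and indecomposable: "J \<noteq> {} \<Longrightarrow> J \<noteq> UNIV \<Longrightarrow> \<exists>i\<in>J. \<exists>j\<in>-J. A $ i $ j \<noteq> 0"
    and not_E8: "\<not> type_E8 A"
begin

definition simple_root :: "'i \<Rightarrow> 'i weight" where
  "simple_root i = A $ i"

definition simple_coroot :: "'i \<Rightarrow> 'i coweight" where
  "simple_coroot i = axis i 1"

definition simple_refl :: "'i \<Rightarrow> 'i weyl" where
  "simple_refl i \<nu> = \<nu> - pairing \<nu> (simple_coroot i) *s simple_root i"

definition weyl_word :: "'i list \<Rightarrow> 'i weyl" where
  "weyl_word is = foldr (\<lambda>i w. simple_refl i \<circ> w) is id"

definition W :: "'i weyl set" where
  "W = range weyl_word"

definition len :: "'i weyl \<Rightarrow> nat" where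
  "len w = (LEAST n. \<exists>is. length is = n \<and> weyl_word is = w)"

definition longest :: "'i weyl" where
  "longest = (THE w. w \<in> W \<and> (\<forall>u\<in>W. len u \<le> len w))"

text \<open>Action of \<open>w\<close> on \<open>Q\<^sup>\<or>\<close>: the \<open>i\<close>-th coordinate of \<open>w\<xi>\<close> is
  \<open>\<langle>\<varpi>\<^sub>i, w\<xi>\<rangle> = \<langle>w\<^sup>-\<^sup>1\<varpi>\<^sub>i, \<xi>\<rangle>\<close>.\<close>

definition coact :: "'i weyl \<Rightarrow> 'i coweight \<Rightarrow> 'i coweight" where
  "coact w \<xi> = (\<chi> i. pairing (inv w (axis i 1)) \<xi>)"

definition roots :: "'i weight set" where
  "roots = {w (simple_root i) | w i. w \<in> W}"

definition coroot :: "'i weight \<Rightarrow> 'i coweight" where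
  "coroot \<alpha> = (THE \<xi>. \<exists>w\<in>W. \<exists>i. \<alpha> = w (simple_root i) \<and> \<xi> = coact w (simple_coroot i))"

definition root_cone :: "'i weight set" where
  "root_cone = {\<Sum>i\<in>UNIV. int (c i) *s simple_root i | c :: 'i \<Rightarrow> nat. True}"

definition pos_roots :: "'i weight set" where
  "pos_roots = roots \<inter> root_cone"

definition highest_root :: "'i weight" where
  "highest_root = (THE \<theta>. \<theta> \<in> roots \<and> (\<forall>\<beta>\<in>roots. \<theta> - \<beta> \<in> root_cone))"

definition two_rho :: "'i weight" where
  "two_rho = (\<Sum>\<alpha>\<in>pos_roots. \<alpha>)"

definition rsgn :: "'i weight \<Rightarrow> int" where
  "rsgn \<alpha> = (if \<alpha> \<in> pos_roots then 1 else -1)"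

definition rabs :: "'i weight \<Rightarrow> 'i weight" where
  "rabs \<alpha> = rsgn \<alpha> *s \<alpha>"

definition refl :: "'i weight \<Rightarrow> 'i weyl" where
  "refl \<alpha> \<nu> = \<nu> - pairing \<nu> (coroot \<alpha>) *s \<alpha>"

definition bruhat_less :: "'i weyl \<Rightarrow> 'i weyl \<Rightarrow> bool" where
  "bruhat_less = (\<lambda>x y. x \<in> W \<and> (\<exists>\<alpha>\<in>roots. y = refl \<alpha> \<circ> x) \<and> len x < len y)\<^sup>+\<^sup>+"

definition QBG_edge :: "'i weyl \<Rightarrow> 'i weight \<Rightarrow> 'i weyl \<Rightarrow> bool" where
  "QBG_edge x \<alpha> y \<longleftrightarrow> x \<in> W \<and> \<alpha> \<in> pos_roots \<and> y = x \<circ> refl \<alpha> \<and>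
     (len y = len x + 1 \<or> int (len y) = int (len x) - pairing two_rho (coroot \<alpha>) + 1)"


subsection \<open>Alcove paths\<close>

definition hyperplane :: "'i weight \<Rightarrow> int \<Rightarrow> (real^'i) set" where
  "hyperplane \<alpha> k = {\<nu>. pairing_real \<nu> (coroot \<alpha>) = of_int k}"

definition alcoves :: "(real^'i) set set" where
  "alcoves = components (UNIV - (\<Union>\<alpha>\<in>roots. \<Union>k. hyperplane \<alpha> k))"

definition fund_alcove :: "(real^'i) set" where
  "fund_alcove =
     {\<nu>. \<forall>\<alpha>\<in>pos_roots. 0 < pairing_real \<nu> (coroot \<alpha>) \<and> pairing_real \<nu> (coroot \<alpha>) < 1}"

text \<open>Two alcoves share a wall in \<open>H\<^bsub>\<alpha>,k\<^esub>\<close> iff the intersection of their closures has codimension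
  one and spans this hyperplane; \<open>\<alpha>\<close> then points from \<open>X\<close> to \<open>Y\<close>.\<close>

definition crosses :: "(real^'i) set \<Rightarrow> 'i weight \<Rightarrow> int \<Rightarrow> (real^'i) set \<Rightarrow> bool" where
  "crosses X \<alpha> k Y \<longleftrightarrow> X \<in> alcoves \<and> Y \<in> alcoves \<and> X \<noteq> Y \<and> \<alpha> \<in> roots \<and>
     affine hull (closure X \<inter> closure Y) = hyperplane \<alpha> k \<and>
     (\<forall>\<nu>\<in>X. pairing_real \<nu> (coroot \<alpha>) < of_int k) \<and>
     (\<forall>\<nu>\<in>Y. of_int k < pairing_real \<nu> (coroot \<alpha>))"

definition alcove_walk ::
  "'i weight list \<Rightarrow> int list \<Rightarrow> (real^'i) set list \<Rightarrow> bool" where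
  "alcove_walk \<Gamma> ls As \<longleftrightarrow> length ls = length \<Gamma> \<and> length As = Suc (length \<Gamma>) \<and>
     As ! 0 = fund_alcove \<and>
     (\<forall>t<length \<Gamma>. crosses (As ! t) (\<Gamma> ! t) (ls ! t) (As ! Suc t))"

definition alcove_path :: "'i weight \<Rightarrow> 'i weight list \<Rightarrow> bool" where
  "alcove_path \<nu> \<Gamma> \<longleftrightarrow>
     (\<exists>ls As. alcove_walk \<Gamma> ls As \<and> As ! length \<Gamma> = (\<lambda>x. x + real_weight \<nu>) ` fund_alcove)"

text \<open>The integers \<open>l\<^sub>1, \<dots>, l\<^sub>m\<close> are determined by the roots \<open>\<gamma>\<^sub>1, \<dots>, \<gamma>\<^sub>m\<close>. Roots and levels are
  numbered from \<open>1\<close>.\<close>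

definition gam :: "'i weight list \<Rightarrow> nat \<Rightarrow> 'i weight" where
  "gam \<Gamma> t = \<Gamma> ! (t - 1)"

definition level :: "'i weight list \<Rightarrow> nat \<Rightarrow> int" where
  "level \<Gamma> t = (THE ls. \<exists>As. alcove_walk \<Gamma> ls As) ! (t - 1)"

definition level' :: "'i weight \<Rightarrow> 'i weight list \<Rightarrow> nat \<Rightarrow> int" where
  "level' \<nu> \<Gamma> t = pairing \<nu> (coroot (gam \<Gamma> t)) - level \<Gamma> t"

text \<open>Affine reflections are only needed on \<open>P\<close>, which they map to itself.\<close>

definition aff_refl :: "'i weight \<Rightarrow> int \<Rightarrow> 'i weight \<Rightarrow> 'i weight" where
  "aff_refl \<alpha> k \<nu> = refl \<alpha> \<nu> + k *s \<alpha>"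


subsection \<open>Decorated quantum walks\<close>

definition QW :: "'i weight list \<Rightarrow> 'i weyl \<Rightarrow> 'i weyl list set" where
  "QW \<Gamma> w = {ws. length ws = Suc (length \<Gamma>) \<and> set ws \<subseteq> W \<and> ws ! 0 = w \<and>
     (\<forall>t\<in>{1..length \<Gamma>}. ws ! t = ws ! (t - 1) \<or>
        (ws ! t = refl (gam \<Gamma> t) \<circ> ws ! (t - 1) \<and> (\<exists>\<alpha>. QBG_edge (ws ! (t - 1)) \<alpha> (ws ! t))))}"

definition T_set :: "'i weight list \<Rightarrow> 'i weyl list \<Rightarrow> nat set" where
  "T_set \<Gamma> ws = {t\<in>{1..length \<Gamma>}. ws ! t = refl (gam \<Gamma> t) \<circ> ws ! (t - 1)}"

definition Tminus_set :: "'i weight list \<Rightarrow> 'i weyl list \<Rightarrow> nat set" where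
  "Tminus_set \<Gamma> ws = {t\<in>{1..length \<Gamma>}. bruhat_less (ws ! t) (ws ! (t - 1))}"

definition S_set :: "'i weight list \<Rightarrow> 'i weyl list \<Rightarrow> nat set" where
  "S_set \<Gamma> ws = {t\<in>{1..length \<Gamma>}. ws ! t = ws ! (t - 1) \<and>
     - (inv (ws ! t) (gam \<Gamma> t)) \<in> range simple_root}"

definition decorated_QW ::
  "'i weight list \<Rightarrow> 'i weyl \<Rightarrow> ('i weyl list \<times> (nat \<Rightarrow> int)) set" where
  "decorated_QW \<Gamma> w = (SIGMA ws : QW \<Gamma> w. S_set \<Gamma> ws \<rightarrow>\<^sub>E {0, 1})"

definition walk_end :: "'i weight list \<Rightarrow> 'i weyl list \<Rightarrow> 'i weyl" where
  "walk_end \<Gamma> ws = ws ! length \<Gamma>"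

definition walk_sign :: "'i weight list \<Rightarrow> 'i weyl list \<Rightarrow> (nat \<Rightarrow> int) \<Rightarrow> int" where
  "walk_sign \<Gamma> ws b =
     (\<Prod>t\<in>{t\<in>T_set \<Gamma> ws. inv (ws ! (t - 1)) (gam \<Gamma> t) \<in> pos_roots}. -1) *
     (\<Prod>t\<in>S_set \<Gamma> ws. (-1) ^ nat (b t))"

definition qwt_at :: "'i weight list \<Rightarrow> 'i weyl list \<Rightarrow> (nat \<Rightarrow> int) \<Rightarrow> nat \<Rightarrow> 'i weight" where
  "qwt_at \<Gamma> ws b t =
     (\<Sum>u\<in>{u\<in>Tminus_set \<Gamma> ws. u \<le> t}. rabs (inv (ws ! u) (gam \<Gamma> u))) -
     (\<Sum>u\<in>{u\<in>S_set \<Gamma> ws. u \<le> t}. b u *s inv (ws ! u) (gam \<Gamma> u))"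

definition qwt :: "'i weight list \<Rightarrow> 'i weyl list \<Rightarrow> (nat \<Rightarrow> int) \<Rightarrow> 'i weight" where
  "qwt \<Gamma> ws b = qwt_at \<Gamma> ws b (length \<Gamma>)"

definition coqwt_at :: "'i weight list \<Rightarrow> 'i weyl list \<Rightarrow> (nat \<Rightarrow> int) \<Rightarrow> nat \<Rightarrow> 'i coweight" where
  "coqwt_at \<Gamma> ws b t =
     (\<Sum>u\<in>{u\<in>Tminus_set \<Gamma> ws. u \<le> t}. coroot (rabs (inv (ws ! u) (gam \<Gamma> u)))) -
     (\<Sum>u\<in>{u\<in>S_set \<Gamma> ws. u \<le> t}. b u *s coact (inv (ws ! u)) (coroot (gam \<Gamma> u)))"

definition coqwt :: "'i weight list \<Rightarrow> 'i weyl list \<Rightarrow> (nat \<Rightarrow> int) \<Rightarrow> 'i coweight" where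
  "coqwt \<Gamma> ws b = coqwt_at \<Gamma> ws b (length \<Gamma>)"

primrec rhat :: "'i weight list \<Rightarrow> 'i weyl list \<Rightarrow> nat \<Rightarrow> 'i weight \<Rightarrow> 'i weight" where
  "rhat \<Gamma> ws 0 = inv (ws ! 0)"
| "rhat \<Gamma> ws (Suc t) =
     (if Suc t \<in> T_set \<Gamma> ws
      then rhat \<Gamma> ws t \<circ> aff_refl (gam \<Gamma> (Suc t)) (level \<Gamma> (Suc t))
      else rhat \<Gamma> ws t)"

definition wt_at :: "'i weight \<Rightarrow> 'i weight list \<Rightarrow> 'i weyl list \<Rightarrow> nat \<Rightarrow> 'i weight" where
  "wt_at \<nu> \<Gamma> ws t = rhat \<Gamma> ws t \<nu> - rhat \<Gamma> ws (t - 1) \<nu>"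

definition wt :: "'i weight \<Rightarrow> 'i weight list \<Rightarrow> 'i weyl list \<Rightarrow> 'i weight" where
  "wt \<nu> \<Gamma> ws = rhat \<Gamma> ws (length \<Gamma>) \<nu>"

text \<open>The integer division by \<open>2\<close> is exact, since \<open>\<langle>qwt, qwt\<^sup>\<or>\<rangle>\<close> is a value of the even quadratic
  form on the simply-laced root lattice.\<close>

definition walk_deg ::
  "'i weight \<Rightarrow> 'i weight list \<Rightarrow> 'i weyl list \<Rightarrow> (nat \<Rightarrow> int) \<Rightarrow> int" where
  "walk_deg \<nu> \<Gamma> ws b =
     pairing (qwt \<Gamma> ws b) (coqwt \<Gamma> ws b) div 2
     + (\<Sum>t\<in>{1..length \<Gamma>}. pairing (wt_at \<nu> \<Gamma> ws t) (coqwt_at \<Gamma> ws b t))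
     - (\<Sum>t\<in>Tminus_set \<Gamma> ws. rsgn (gam \<Gamma> t) * level' \<nu> \<Gamma> t)
     - (\<Sum>t\<in>S_set \<Gamma> ws. b t * level' \<nu> \<Gamma> t)"

definition FF :: "'i weight \<Rightarrow> 'i weyl \<Rightarrow> 'i weight list \<Rightarrow> 'i formal" where
  "FF \<nu> w \<Gamma> = (\<Sum>(ws, b)\<in>decorated_QW \<Gamma> w.
     coeff_scale (of_int (walk_sign \<Gamma> ws b) * q_pow (walk_deg \<nu> \<Gamma> ws b))
       (Schubert (walk_end \<Gamma> ws, coqwt \<Gamma> ws b)
          (- longest (wt \<nu> \<Gamma> ws) - longest (qwt \<Gamma> ws b))))"


subsection \<open>The affine Weyl group and level-zero weights\<close>

definition W_aff :: "'i aff_weyl set" where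
  "W_aff = W \<times> UNIV"

text \<open>\<open>w t\<^sub>\<xi> u t\<^sub>\<zeta> = w u t\<^bsub>u\<^sup>-\<^sup>1\<xi> + \<zeta>\<^esub>\<close>.\<close>

definition aff_mult :: "'i aff_weyl \<Rightarrow> 'i aff_weyl \<Rightarrow> 'i aff_weyl" where
  "aff_mult x y = (fst x \<circ> fst y, coact (inv (fst y)) (snd x) + snd y)"

definition aff_act :: "'i aff_weyl \<Rightarrow> 'i aff_weight \<Rightarrow> 'i aff_weight" where
  "aff_act x \<beta> = (fst x (fst \<beta>), snd \<beta> - pairing (fst \<beta>) (snd x))"

text \<open>\<open>\<alpha>\<^sub>0 = -\<theta> + \<delta>\<close>, \<open>\<alpha>\<^sub>0\<^sup>\<or> = -\<theta>\<^sup>\<or> + c\<close> and \<open>s\<^sub>0 = t\<^bsub>\<theta>\<^sup>\<or>\<^esub> s\<^sub>\<theta> = s\<^sub>\<theta> t\<^bsub>-\<theta>\<^sup>\<or>\<^esub>\<close>.\<close>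

definition aff_root :: "'i option \<Rightarrow> 'i aff_weight" where
  "aff_root j = (case j of None \<Rightarrow> (- highest_root, 1) | Some i \<Rightarrow> (simple_root i, 0))"

definition aff_coroot :: "'i option \<Rightarrow> 'i aff_coweight" where
  "aff_coroot j =
     (case j of None \<Rightarrow> (- coroot highest_root, 1, 0) | Some i \<Rightarrow> (simple_coroot i, 0, 0))"

definition aff_simple_refl :: "'i option \<Rightarrow> 'i aff_weyl" where
  "aff_simple_refl j =
     (case j of None \<Rightarrow> (refl highest_root, - coroot highest_root) | Some i \<Rightarrow> (simple_refl i, 0))"

text \<open>Level-zero weights vanish on \<open>c\<close>.\<close>

definition aff_pairing :: "'i aff_weight \<Rightarrow> 'i aff_coweight \<Rightarrow> int" where
  "aff_pairing \<beta> h = pairing (fst \<beta>) (fst h) + snd \<beta> * snd (snd h)"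


subsection \<open>The quantum affine algebra and extremal weight modules\<close>

text \<open>Since the type is simply-laced, all the parameters \<open>v\<^sub>j\<close> are \<open>v\<close>.\<close>

definition U_relations :: "'i free_alg set" where
  "U_relations =
     {Kg 0 - 1} \<union>
     {Kg h * Kg h' - Kg (h + h') | h h'. True} \<union>
     {Kg h * Eg j - cst (qv powi aff_pairing (aff_root j) h) * Eg j * Kg h | h j. True} \<union>
     {Kg h * Fg j - cst (qv powi (- aff_pairing (aff_root j) h)) * Fg j * Kg h | h j. True} \<union>
     {Eg j * Fg k - Fg k * Eg j -
        (if j = k then cst (inverse (qv - inverse qv)) * (Kg (aff_coroot j) - Kg (- aff_coroot j))
         else 0) | j k. True} \<union>
     {\<Sum>r\<le>n. (-1) ^ r * divpow (Eg j) (n - r) * Eg k * divpow (Eg j) r | j k n.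
        j \<noteq> k \<and> int n = 1 - aff_pairing (aff_root k) (aff_coroot j)} \<union>
     {\<Sum>r\<le>n. (-1) ^ r * divpow (Fg j) (n - r) * Fg k * divpow (Fg j) r | j k n.
        j \<noteq> k \<and> int n = 1 - aff_pairing (aff_root k) (aff_coroot j)}"

text \<open>The quantum affine algebra is the quotient of the free algebra by \<open>U_ideal\<close>. A cyclic left
  module over it is the quotient of the free algebra by a left ideal \<open>L\<close> containing \<open>U_ideal\<close>;
  its vectors are given below by representatives in the free algebra.\<close>

definition U_ideal :: "'i free_alg set" where
  "U_ideal = \<Inter>{J. two_sided_ideal J \<and> U_relations \<subseteq> J}"

definition has_weight :: "'i free_alg set \<Rightarrow> 'i aff_weight \<Rightarrow> 'i free_alg \<Rightarrow> bool" where
  "has_weight L \<beta> a \<longleftrightarrow> (\<forall>h. Kg h * a - cst (qv powi aff_pairing \<beta> h) * a \<in> L)"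

text \<open>Kashiwara's definition: \<open>a\<close> is an extremal weight vector of weight \<open>\<beta>\<close>, with associated
  extremal vectors \<open>f x\<close>. The module generated by such a vector is integrable.\<close>

definition extremal_family ::
  "'i free_alg set \<Rightarrow> 'i aff_weight \<Rightarrow> 'i free_alg \<Rightarrow> ('i aff_weyl \<Rightarrow> 'i free_alg) \<Rightarrow> bool" where
  "extremal_family L \<beta> a f \<longleftrightarrow> has_weight L \<beta> a \<and> f (id, 0) = a \<and>
     (\<forall>x\<in>W_aff. \<forall>j. let n = aff_pairing (aff_act x \<beta>) (aff_coroot j);
                         y = aff_mult (aff_simple_refl j) x in
        (n \<ge> 0 \<longrightarrow> Eg j * f x \<in> L \<and> divpow (Fg j) (nat n) * f x - f y \<in> L) \<and>
        (n \<le> 0 \<longrightarrow> Fg j * f x \<in> L \<and> divpow (Eg j) (nat (- n)) * f x - f y \<in> L))"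

text \<open>\<open>V(\<mu>)\<close> is the quotient of the free algebra by \<open>V_ideal \<mu>\<close>, with generator \<open>v\<^sub>\<mu>\<close> the image
  of \<open>1\<close>: its only defining relations are that this vector is extremal of weight \<open>\<mu>\<close>.\<close>

definition V_ideal :: "'i weight \<Rightarrow> 'i free_alg set" where
  "V_ideal \<mu> =
     \<Inter>{L. left_ideal L \<and> U_ideal \<subseteq> L \<and> (\<exists>f. extremal_family L (\<mu>, 0) 1 f)}"

definition ext_vec :: "'i weight \<Rightarrow> 'i aff_weyl \<Rightarrow> 'i free_alg" where
  "ext_vec \<mu> = (SOME f. extremal_family (V_ideal \<mu>) (\<mu>, 0) 1 f)"

definition Demazure :: "'i aff_weyl \<Rightarrow> 'i weight \<Rightarrow> 'i free_alg set" where
  "Demazure x \<mu> = {a * ext_vec \<mu> x | a. a \<in> F_subalgebra}"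

text \<open>\<open>gch x \<mu> (\<beta>, k)\<close> is the coefficient of \<open>e\<^sup>\<beta> q\<^sup>k\<close> in \<open>gch V\<^sub>x\<^sup>-(\<mu>)\<close>, i.e. the dimension of a
  weight space.\<close>

definition gch :: "'i aff_weyl \<Rightarrow> 'i weight \<Rightarrow> 'i aff_weight \<Rightarrow> int" where
  "gch x \<mu> \<beta> =
     int (dim_mod (V_ideal \<mu>) {a \<in> Demazure x \<mu>. has_weight (V_ideal \<mu>) \<beta> a})"


subsection \<open>The K-group\<close>

text \<open>The coefficients of \<open>\<Sum>\<^sub>j c\<^sub>j gch V\<^sup>-\<^bsub>x\<^sub>j\<^esub>(-w\<^sub>\<circ>(\<mu>\<^sub>j + \<nu>))\<close>.\<close>

definition euler_char :: "'i formal \<Rightarrow> 'i weight \<Rightarrow> 'i aff_weight \<Rightarrow> int" where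
  "euler_char f \<nu> \<beta> = (\<Sum>(x, \<mu>)\<in>Poly_Mapping.keys f. \<Sum>\<zeta>\<in>Poly_Mapping.keys (Poly_Mapping.lookup f (x, \<mu>)).
     Poly_Mapping.lookup (Poly_Mapping.lookup f (x, \<mu>)) \<zeta> * gch x (- longest (\<mu> + \<nu>)) (\<beta> - \<zeta>))"

definition formal_sums :: "'i formal set" where
  "formal_sums = {f. \<forall>(x, \<mu>)\<in>Poly_Mapping.keys f. x \<in> W_aff}"

text \<open>The characters are those of \<open>V(\<mu>)\<close> with \<open>\<mu>\<close> dominant, so \<open>\<nu>\<^sub>0\<close> is taken large enough that
  all \<open>\<mu>\<^sub>j + \<nu>\<^sub>0\<close> are dominant.\<close>

definition K_zero :: "'i formal \<Rightarrow> bool" where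
  "K_zero f \<longleftrightarrow> (\<exists>\<nu>\<^sub>0\<in>dominant. (\<forall>(x, \<mu>)\<in>Poly_Mapping.keys f. \<mu> + \<nu>\<^sub>0 \<in> dominant) \<and>
     (\<forall>\<nu>\<in>dominant. \<forall>\<beta>. euler_char f (\<nu>\<^sub>0 + \<nu>) \<beta> = 0))"

definition K_rel :: "('i formal \<times> 'i formal) set" where
  "K_rel = {(f, g). f \<in> formal_sums \<and> g \<in> formal_sums \<and> K_zero (f - g)}"

definition K_class :: "'i formal \<Rightarrow> 'i formal set" where
  "K_class f = K_rel `` {f}"

text \<open>\<open>\<K>\<close>: the classes of sums whose coefficients lie in \<open>\<int>[q\<^sup>\<plusminus>\<^sup>1]\<close>.\<close>

definition KK :: "'i formal set set" where
  "KK = {K_class f | f. f \<in> formal_sums \<and>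
     (\<forall>s\<in>Poly_Mapping.keys f. \<forall>(\<beta>, k)\<in>Poly_Mapping.keys (Poly_Mapping.lookup f s). \<beta> = 0)}"

definition holds_in_KK :: "'i formal \<Rightarrow> 'i formal \<Rightarrow> bool" where
  "holds_in_KK f g \<longleftrightarrow> K_class f \<in> KK \<and> K_class g \<in> KK \<and> K_class f = K_class g"

end

end

theory Submission
  imports Defs
begin

text \<open>
  Expanding \<open>e\<^sup>\<lambda> [\<O>\<^bsub>Q(w)\<^esub>]\<close> along the first alcove path gives classes \<open>[\<O>\<^bsub>Q(u t\<^sub>\<xi>)\<^esub>(\<kappa>)]\<close>, one for each
  decorated walk, where \<open>u\<close> is the end and \<open>\<xi>\<close> the coweight \<open>qwt\<^sup>\<or>\<close> of the walk. To multiply them by \<open>e\<^sup>\<mu>\<close>, the second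
  formula is needed for \<open>u t\<^sub>\<xi>\<close> and with a line bundle, whereas it is assumed only for \<open>u\<close> and
  without one. Twisting by \<open>\<O>(\<kappa>)\<close> is harmless, because classes are compared through their
  characters at all sufficiently dominant weights. Translation by \<open>\<xi>\<close> is a symmetry of extremal
  weight modules: \<open>v\<^sub>\<nu> \<mapsto> v\<^bsub>t\<^sub>\<xi>\<^esub>\<close> extends to an automorphism of \<open>V(\<nu>)\<close> up to a shift of the
  weights by \<open>-\<langle>\<nu>, \<xi>\<rangle>\<delta>\<close>, so that \<open>gch V\<^sup>-\<^bsub>x t\<^sub>\<xi>\<^esub>(\<nu>) = q\<^bsup>-\<langle>\<nu>, \<xi>\<rangle>\<^esup> gch V\<^sup>-\<^sub>x(\<nu>)\<close> (lemma \<open>gch_translate\<close>). It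
  follows that \<open>e\<^sup>\<mu> [\<O>\<^bsub>Q(u t\<^sub>\<xi>)\<^esub>(\<kappa>)]\<close> is the sum over the walks along the second path of the twisted and translated
  classes, with an additional factor \<open>q\<^bsup>\<langle>wt + qwt, \<xi>\<rangle>\<^esup>\<close>, where \<open>wt\<close> and \<open>qwt\<close> belong to the second walk.

  On the combinatorial side, decorated walks along \<open>\<Gamma> * \<Xi>\<close> are pairs of decorated walks, the second
  starting at the end of the first (\<open>sum_decorated_QW_append\<close>). Signs multiply, and \<open>wt\<close>, \<open>qwt\<close> and
  \<open>qwt\<^sup>\<or>\<close> add up; for \<open>wt\<close> one uses that the second path is translated by \<open>\<lambda>\<close>, which raises the level at a
  root \<open>\<gamma>\<close> of that path by \<open>\<langle>\<lambda>, \<gamma>\<^sup>\<or>\<rangle>\<close>. The degree is not additive, and its defect is exactly \<open>\<langle>wt + qwt, \<xi>\<rangle>\<close>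
  (\<open>walk_deg_append\<close>). The computation of the defect uses that in simply-laced type \<open>qwt\<close> and
  \<open>qwt\<^sup>\<or>\<close> correspond under an even symmetric form, and that \<open>w\<^sub>t\<^sup>-\<^sup>1\<gamma>\<^sub>t\<close> has the sign of \<open>\<gamma>\<^sub>t\<close> at a
  descent.

  The translation symmetry is proved from the universal property of \<open>V(\<nu>)\<close>. The vectors
  \<open>v\<^bsub>x t\<^sub>\<xi>\<^esub>\<close> form an extremal family starting at \<open>v\<^bsub>t\<^sub>\<xi>\<^esub>\<close>, which gives an endomorphism, and the
  translation by \<open>-\<xi>\<close> gives its inverse. For this the extremal vectors have to be determined by \<open>v\<^sub>\<nu>\<close>, that
  is, the affine Weyl group has to be generated by its simple reflections
  (\<open>W_aff_induct\<close>); this is where the highest root is used.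
\<close>

section \<open>The pairing of weights and coweights\<close>

lemma pairing_add_left: "pairing (x + y) z = pairing x z + pairing y z"
  and pairing_add_right: "pairing z (x + y) = pairing z x + pairing z y"
  and pairing_diff_left: "pairing (x - y) z = pairing x z - pairing y z"
  and pairing_diff_right: "pairing z (x - y) = pairing z x - pairing z y"
  and pairing_minus_left: "pairing (- x) z = - pairing x z"
  and pairing_minus_right: "pairing z (- x) = - pairing z x"
  and pairing_scale_left: "pairing (c *s x) z = c * pairing x z"
  and pairing_scale_right: "pairing z (c *s x) = c * pairing z x"
  and pairing_zero_left: "pairing 0 z = 0"
  and pairing_zero_right: "pairing z 0 = 0"
  for x y z :: "int^'i"
  by (simp_all add: pairing_def algebra_simps sum.distrib sum_subtractf sum_negf sum_distrib_left)

lemmas pairing_linear =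
  pairing_add_left pairing_add_right pairing_diff_left pairing_diff_right
  pairing_minus_left pairing_minus_right pairing_scale_left pairing_scale_right
  pairing_zero_left pairing_zero_right

lemma pairing_sum_left: "pairing (\<Sum>i\<in>S. f i) z = (\<Sum>i\<in>S. pairing (f i) z)"
  by (induction S rule: infinite_finite_induct) (simp_all add: pairing_linear)

lemma pairing_axis: "pairing \<nu> (axis i 1) = \<nu> $ i"
  by (simp add: pairing_def axis_def if_distrib cong: if_cong)

lemma weight_expansion: "(\<nu> :: int^'i) = (\<Sum>i\<in>UNIV. \<nu> $ i *s axis i 1)"
  by (vector axis_def) (simp add: if_distrib cong: if_cong)

lemma scale_minus_one [simp]: "(- 1 :: int) *s x = - x"
  by (simp add: vec_eq_iff)

lemma coweight_eqI:
  fixes x y :: "int^'i"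
  assumes "\<And>\<nu>. pairing \<nu> x = pairing \<nu> y"
  shows "x = y"
proof -
  have "pairing (axis i 1) z = z $ i" for i and z :: "int^'i"
    by (simp add: pairing_def axis_def if_distrib if_distribR cong: if_cong)
  then show ?thesis using assms by (metis vec_eq_iff)
qed

context simply_laced
begin

section \<open>Roots and coroots\<close>

text \<open>The identification of coroot and root lattice in simply-laced type, with matrix \<open>A\<close> in the bases
  of simple coroots and fundamental weights. It turns the pairing into the symmetric form
  \<open>\<Sum> A\<^sub>i\<^sub>j x\<^sub>i y\<^sub>j\<close>, and \<open>coroot\<close> will be its inverse on roots.\<close>

definition root_of :: "'i coweight \<Rightarrow> 'i weight" where
  "root_of \<xi> = (\<Sum>i\<in>UNIV. \<xi> $ i *s simple_root i)"

lemma root_of_linear: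
  "root_of (x + y) = root_of x + root_of y" "root_of (x - y) = root_of x - root_of y"
  "root_of (- x) = - root_of x" "root_of (c *s x) = c *s root_of x" "root_of 0 = 0"
  by (simp_all add: root_of_def vec_eq_iff sum.distrib sum_subtractf sum_negf algebra_simps sum_distrib_left)

lemma root_of_sum: "root_of (\<Sum>i\<in>S. f i) = (\<Sum>i\<in>S. root_of (f i))"
  by (induction S rule: infinite_finite_induct) (simp_all add: root_of_linear)

lemma root_of_simple_coroot [simp]: "root_of (simple_coroot i) = simple_root i"
  by (simp add: root_of_def simple_coroot_def axis_def vec_eq_iff if_distrib if_distribR cong: if_cong)

lemma root_of_axis [simp]: "root_of (axis i 1) = simple_root i"
  using root_of_simple_coroot[of i] by (simp add: simple_coroot_def)

lemma pairing_simple_coroot [simp]: "pairing \<nu> (simple_coroot i) = \<nu> $ i"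
  by (simp add: simple_coroot_def pairing_axis)

lemma pairing_root_of: "pairing (root_of x) y = (\<Sum>i\<in>UNIV. \<Sum>j\<in>UNIV. A $ i $ j * x $ i * y $ j)"
  by (simp add: root_of_def pairing_sum_left pairing_scale_left simple_root_def)
     (simp add: pairing_def sum_distrib_left algebra_simps)

lemma form_symmetric: "pairing (root_of x) y = pairing (root_of y) x"
proof -
  have "pairing (root_of x) y = (\<Sum>j\<in>UNIV. \<Sum>i\<in>UNIV. A $ i $ j * x $ i * y $ j)"
    unfolding pairing_root_of by (rule sum.swap)
  also have "\<dots> = pairing (root_of y) x"
    unfolding pairing_root_of by (intro sum.cong refl) (metis symmetric mult.assoc mult.commute)
  finally show ?thesis .
qed

lemma form_positive: "x \<noteq> 0 \<Longrightarrow> pairing (root_of x) x > 0"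
proof -
  assume "x \<noteq> 0"
  then have "real_weight x \<noteq> 0" by (auto simp: real_weight_def vec_eq_iff)
  from positive_definite[OF this] have "real_of_int (pairing (root_of x) x) > 0"
    by (simp add: pairing_root_of real_weight_def)
  then show ?thesis by simp
qed

lemma form_nonneg: "pairing (root_of x) x \<ge> 0"
  using form_positive[of x] by (cases "x = 0") (auto simp: pairing_linear root_of_linear)

text \<open>The off-diagonal terms of \<open>\<Sum> A\<^sub>i\<^sub>j x\<^sub>i x\<^sub>j\<close> come in equal pairs and the diagonal ones are
  \<open>2 x\<^sub>i\<^sup>2\<close>. Adding the coordinates of \<open>x\<close> one at a time makes this precise without ordering the
  index set.\<close>

lemma form_even: "even (pairing (root_of x) x)"
proof -
  have "even (pairing (root_of (\<Sum>i\<in>S. x $ i *s axis i 1)) (\<Sum>i\<in>S. x $ i *s axis i 1))"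
    if "finite S" for S
    using that
  proof (induction S)
    case (insert k S)
    let ?a = "x $ k *s axis k 1" and ?y = "\<Sum>i\<in>S. x $ i *s axis i 1"
    have "pairing (root_of (?a + ?y)) (?a + ?y) =
       pairing (root_of ?a) ?a + 2 * pairing (root_of ?a) ?y + pairing (root_of ?y) ?y"
      using form_symmetric[of ?a ?y] by (simp add: root_of_linear pairing_add_left pairing_add_right)
    moreover have "pairing (root_of ?a) ?a = 2 * (x $ k * x $ k)"
      by (simp add: root_of_linear pairing_linear pairing_axis simple_root_def diagonal)
    ultimately show ?case using insert by simp
  qed (simp add: pairing_linear)
  from this[of UNIV] show ?thesis using weight_expansion[of x] by simp
qed

lemma root_of_inject: "root_of x = root_of y \<longleftrightarrow> x = y"
proof
  assume "root_of x = root_of y"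
  then have "pairing (root_of (x - y)) (x - y) = 0" by (simp add: root_of_linear pairing_linear)
  then show "x = y" using form_positive[of "x - y"] by (metis eq_iff_diff_eq_0 less_irrefl)
qed simp

lemma simple_root_component: "simple_root i $ j = A $ i $ j"
  by (simp add: simple_root_def)

lemma simple_root_self [simp]: "simple_root i $ i = 2"
  by (simp add: simple_root_def diagonal)

section \<open>The Weyl group\<close>

lemma simple_refl_eq: "simple_refl i \<nu> = \<nu> - \<nu> $ i *s simple_root i"
  by (simp add: simple_refl_def)

lemma simple_refl_involutive [simp]: "simple_refl i (simple_refl i \<nu>) = \<nu>"
  by (simp add: simple_refl_eq vec_eq_iff algebra_simps)

lemma simple_refl_comp_self [simp]: "simple_refl i \<circ> simple_refl i = id"
  by (simp add: fun_eq_iff)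

lemma weyl_word_Nil [simp]: "weyl_word [] = id"
  and weyl_word_Cons [simp]: "weyl_word (i # is) = simple_refl i \<circ> weyl_word is"
  by (simp_all add: weyl_word_def)

lemma weyl_word_append: "weyl_word (is @ js) = weyl_word is \<circ> weyl_word js"
  by (induction "is") (simp_all add: o_assoc)

lemma weyl_word_in_W [simp]: "weyl_word is \<in> W"
  by (simp add: W_def)

lemma W_id [simp]: "id \<in> W"
  using weyl_word_in_W[of "[]"] by simp

lemma simple_refl_in_W [simp]: "simple_refl i \<in> W"
  using weyl_word_in_W[of "[i]"] by simp

lemma W_comp [simp]: "u \<in> W \<Longrightarrow> w \<in> W \<Longrightarrow> u \<circ> w \<in> W"
  by (auto simp: W_def image_iff) (metis weyl_word_append)

lemma W_induct [consumes 1, case_names id step]: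
  assumes "w \<in> W" "P id" "\<And>i w. w \<in> W \<Longrightarrow> P w \<Longrightarrow> P (simple_refl i \<circ> w)"
  shows "P w"
proof -
  have "P (weyl_word is)" for "is"
  proof (induction "is")
    case Nil
    show ?case unfolding weyl_word_Nil by (rule assms(2))
  next
    case (Cons i "is")
    show ?case unfolding weyl_word_Cons by (rule assms(3)[OF weyl_word_in_W Cons])
  qed
  then show ?thesis using assms(1) by (auto simp: W_def)
qed

lemma weyl_word_rev: "weyl_word (rev is) \<circ> weyl_word is = id"
proof (induction "is")
  case (Cons i "is")
  have "weyl_word (rev is) \<circ> simple_refl i \<circ> (simple_refl i \<circ> weyl_word is)
      = weyl_word (rev is) \<circ> (simple_refl i \<circ> simple_refl i) \<circ> weyl_word is"
    by (simp only: o_assoc)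
  then show ?case using Cons by (simp add: weyl_word_append)
qed simp

lemma W_bij: "w \<in> W \<Longrightarrow> bij w"
proof -
  assume "w \<in> W"
  then obtain "is" where "w = weyl_word is" by (auto simp: W_def)
  then show ?thesis
    using weyl_word_rev[of "is"] weyl_word_rev[of "rev is"] o_bij by (metis rev_rev_ident)
qed

lemma inv_weyl_word: "inv (weyl_word is) = weyl_word (rev is)"
  using weyl_word_rev[of "is"] weyl_word_rev[of "rev is"]
  by (metis inv_unique_comp rev_rev_ident)

lemma W_inv [simp]: "w \<in> W \<Longrightarrow> inv w \<in> W"
  by (auto simp: W_def inv_weyl_word)

lemma W_inv_cancel [simp]:
  assumes "w \<in> W"
  shows "inv w (w x) = x" "w (inv w x) = x" "inv w \<circ> w = id" "w \<circ> inv w = id" "inv (inv w) = w"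
  using W_bij[OF assms]
  by (simp_all add: fun_eq_iff bij_is_inj bij_is_surj surj_f_inv_f inv_inv_eq)

lemma W_inv_comp: "u \<in> W \<Longrightarrow> w \<in> W \<Longrightarrow> inv (u \<circ> w) = inv w \<circ> inv u"
  using W_bij o_inv_distrib by blast

lemma simple_refl_inv [simp]: "inv (simple_refl i) = simple_refl i"
  by (rule inv_unique_comp) simp_all

lemma W_linear:
  assumes "w \<in> W"
  shows "w (x + y) = w x + w y" "w (c *s x) = c *s w x"
proof -
  have "\<forall>x y c. w (x + y) = w x + w y \<and> w (c *s x) = c *s w x"
    using assms by (induction rule: W_induct) (simp_all add: simple_refl_eq vec_eq_iff algebra_simps)
  then show "w (x + y) = w x + w y" "w (c *s x) = c *s w x" by auto
qed

lemma W_minus: "w \<in> W \<Longrightarrow> w (- x) = - w x"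
  using W_linear(2)[of w "-1" x] by simp

lemma W_diff: "w \<in> W \<Longrightarrow> w (x - y) = w x - w y"
  using W_linear(1)[of w x "- y"] by (simp add: W_minus)

lemma W_zero: "w \<in> W \<Longrightarrow> w 0 = 0"
  using W_diff[of w 0 0] by simp

lemma W_sum: "w \<in> W \<Longrightarrow> w (\<Sum>i\<in>S. f i) = (\<Sum>i\<in>S. w (f i))"
  by (induction S rule: infinite_finite_induct) (simp_all add: W_linear W_zero)

lemma pairing_coact: "w \<in> W \<Longrightarrow> pairing \<nu> (coact w \<xi>) = pairing (inv w \<nu>) \<xi>"
proof -
  assume w: "w \<in> W"
  have "pairing (inv w \<nu>) \<xi> = pairing (inv w (\<Sum>i\<in>UNIV. \<nu> $ i *s axis i 1)) \<xi>"
    using weight_expansion[of \<nu>] by simp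
  also have "\<dots> = pairing \<nu> (coact w \<xi>)"
    using w by (simp add: W_sum W_linear pairing_sum_left pairing_scale_left coact_def)
      (simp add: pairing_def[of \<nu>])
  finally show ?thesis by simp
qed

lemma pairing_W_coact: "w \<in> W \<Longrightarrow> pairing (w \<nu>) (coact w \<xi>) = pairing \<nu> \<xi>"
  by (simp add: pairing_coact)

lemma coact_linear:
  "coact w (x + y) = coact w x + coact w y" "coact w (c *s x) = c *s coact w x"
  "coact w (- x) = - coact w x" "coact w 0 = 0"
  by (simp_all add: coact_def vec_eq_iff pairing_linear)

lemma coact_id [simp]: "coact id \<xi> = \<xi>"
  by (rule coweight_eqI) (simp add: pairing_coact)

lemma coact_comp: "u \<in> W \<Longrightarrow> w \<in> W \<Longrightarrow> coact (u \<circ> w) \<xi> = coact u (coact w \<xi>)"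
  by (rule coweight_eqI) (simp add: pairing_coact W_inv_comp)

lemma coact_inv [simp]:
  "w \<in> W \<Longrightarrow> coact (inv w) (coact w \<xi>) = \<xi>" "w \<in> W \<Longrightarrow> coact w (coact (inv w) \<xi>) = \<xi>"
  by (simp_all flip: coact_comp)

lemma coact_simple_refl: "coact (simple_refl i) \<xi> = \<xi> - pairing (simple_root i) \<xi> *s simple_coroot i"
  by (rule coweight_eqI) (simp add: pairing_coact simple_refl_eq pairing_linear)

lemma root_of_coact: "w \<in> W \<Longrightarrow> root_of (coact w \<xi>) = w (root_of \<xi>)"
proof (induction rule: W_induct)
  case (step i w)
  have comm: "pairing (simple_root i) \<xi> = root_of \<xi> $ i" for \<xi>
    using form_symmetric[of "simple_coroot i" \<xi>] by simp
  have "root_of (coact (simple_refl i \<circ> w) \<xi>) = root_of (coact (simple_refl i) (coact w \<xi>))"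
    using coact_comp[OF simple_refl_in_W step(1)] by metis
  also have "\<dots> = simple_refl i (root_of (coact w \<xi>))"
    unfolding coact_simple_refl root_of_linear simple_refl_eq by (simp add: comm)
  also have "\<dots> = (simple_refl i \<circ> w) (root_of \<xi>)" using step(2) by simp
  finally show ?case .
next
  case id
  have "root_of (coact id \<xi>) = id (root_of \<xi>)" by simp
  then show ?case .
qed

lemma roots_W [simp]: "w \<in> W \<Longrightarrow> \<alpha> \<in> roots \<Longrightarrow> w \<alpha> \<in> roots"
  unfolding roots_def by clarify (metis W_comp comp_apply)

lemma simple_root_in_roots [simp]: "simple_root i \<in> roots"
  unfolding roots_def using W_id by (metis (mono_tags, lifting) id_apply mem_Collect_eq)

text \<open>The candidate \<open>w\<alpha>\<^sub>i\<^sup>\<or>\<close> does not depend on how the root is written as \<open>w\<alpha>\<^sub>i\<close>, because \<open>root_of\<close> is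
  equivariant and injective.\<close>

lemma coroot_of_image:
  assumes "w \<in> W" shows "coroot (w (simple_root i)) = coact w (simple_coroot i)"
  unfolding coroot_def
proof (rule the_equality)
  show "\<exists>u\<in>W. \<exists>j. w (simple_root i) = u (simple_root j) \<and>
      coact w (simple_coroot i) = coact u (simple_coroot j)"
    using assms by blast
next
  fix \<xi> assume "\<exists>u\<in>W. \<exists>j. w (simple_root i) = u (simple_root j) \<and> \<xi> = coact u (simple_coroot j)"
  then have "root_of \<xi> = root_of (coact w (simple_coroot i))"
    using assms by (auto simp: root_of_coact)
  then show "\<xi> = coact w (simple_coroot i)" by (simp add: root_of_inject)
qed

lemma rootE:
  assumes "\<alpha> \<in> roots"
  obtains w i where "w \<in> W" "\<alpha> = w (simple_root i)" "coroot \<alpha> = coact w (simple_coroot i)"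
  using assms coroot_of_image unfolding roots_def by blast

lemma root_of_coroot [simp]: "\<alpha> \<in> roots \<Longrightarrow> root_of (coroot \<alpha>) = \<alpha>"
  by (erule rootE) (simp add: root_of_coact)

lemma coroot_W: "w \<in> W \<Longrightarrow> \<alpha> \<in> roots \<Longrightarrow> coroot (w \<alpha>) = coact w (coroot \<alpha>)"
  by (metis root_of_coact root_of_coroot root_of_inject roots_W)

lemma pairing_root_coroot [simp]: "\<alpha> \<in> roots \<Longrightarrow> pairing \<alpha> (coroot \<alpha>) = 2"
  by (erule rootE) (simp add: pairing_W_coact)

lemma pairing_roots_commute: "\<alpha> \<in> roots \<Longrightarrow> \<beta> \<in> roots \<Longrightarrow> pairing \<alpha> (coroot \<beta>) = pairing \<beta> (coroot \<alpha>)"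
  using form_symmetric[of "coroot \<alpha>" "coroot \<beta>"] by simp

lemma coroot_simple_root [simp]: "coroot (simple_root i) = simple_coroot i"
  using coroot_of_image[OF W_id] by simp

lemma refl_simple_root [simp]: "refl (simple_root i) = simple_refl i"
  by (simp add: refl_def simple_refl_def fun_eq_iff)

lemma refl_conjugate: "w \<in> W \<Longrightarrow> \<alpha> \<in> roots \<Longrightarrow> refl (w \<alpha>) = w \<circ> refl \<alpha> \<circ> inv w"
  by (simp add: refl_def fun_eq_iff W_diff W_linear coroot_W pairing_coact)

lemma refl_in_W [simp]: "\<alpha> \<in> roots \<Longrightarrow> refl \<alpha> \<in> W"
  by (erule rootE) (simp add: refl_conjugate)

lemma refl_self: "\<alpha> \<in> roots \<Longrightarrow> refl \<alpha> \<alpha> = - \<alpha>"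
  by (simp add: refl_def vec_eq_iff)

lemma roots_minus [simp]: "\<alpha> \<in> roots \<Longrightarrow> - \<alpha> \<in> roots"
  by (metis refl_in_W refl_self roots_W)

lemma coroot_minus: "\<alpha> \<in> roots \<Longrightarrow> coroot (- \<alpha>) = - coroot \<alpha>"
  by (metis root_of_coroot root_of_inject root_of_linear(3) roots_minus)

lemma refl_minus: "\<alpha> \<in> roots \<Longrightarrow> refl (- \<alpha>) = refl \<alpha>"
  by (simp add: refl_def fun_eq_iff coroot_minus pairing_linear vec_eq_iff)

lemma refl_involutive: "\<alpha> \<in> roots \<Longrightarrow> refl \<alpha> (refl \<alpha> \<nu>) = \<nu>"
  by (simp add: refl_def pairing_linear vec_eq_iff algebra_simps)

lemma refl_comp_self: "\<alpha> \<in> roots \<Longrightarrow> refl \<alpha> \<circ> refl \<alpha> = id"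
  by (simp add: fun_eq_iff refl_involutive)

lemma refl_inv: "\<alpha> \<in> roots \<Longrightarrow> inv (refl \<alpha>) = refl \<alpha>"
  by (rule inv_unique_comp) (simp_all add: refl_comp_self)

lemma root_nonzero: "\<alpha> \<in> roots \<Longrightarrow> \<alpha> \<noteq> 0"
  using pairing_root_coroot[of \<alpha>] pairing_zero_left[of "coroot \<alpha>"] by force

section \<open>Positive roots\<close>

lemma root_cone_iff: "root_of x \<in> root_cone \<longleftrightarrow> (\<forall>i. 0 \<le> x $ i)"
proof
  assume "root_of x \<in> root_cone"
  then obtain c :: "'i \<Rightarrow> nat" where "root_of x = (\<Sum>i\<in>UNIV. int (c i) *s simple_root i)"
    by (auto simp: root_cone_def)
  then have "root_of x = root_of (\<chi> i. int (c i))" by (simp add: root_of_def)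
  then show "\<forall>i. 0 \<le> x $ i" by (simp add: root_of_inject)
next
  assume "\<forall>i. 0 \<le> x $ i"
  then have "root_of x = (\<Sum>i\<in>UNIV. int (nat (x $ i)) *s simple_root i)" by (simp add: root_of_def)
  then show "root_of x \<in> root_cone" unfolding root_cone_def by (auto intro!: exI[of _ "\<lambda>i. nat (x $ i)"])
qed

lemma pos_root_iff: "\<alpha> \<in> roots \<Longrightarrow> \<alpha> \<in> pos_roots \<longleftrightarrow> (\<forall>i. 0 \<le> coroot \<alpha> $ i)"
  by (metis IntD2 IntI pos_roots_def root_cone_iff root_of_coroot)

lemma pos_roots_subset [simp]: "\<alpha> \<in> pos_roots \<Longrightarrow> \<alpha> \<in> roots"
  by (simp add: pos_roots_def)

lemma simple_root_pos [simp]: "simple_root i \<in> pos_roots"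
  by (simp add: pos_root_iff simple_coroot_def axis_def)

text \<open>A root has norm \<open>2\<close>. Split it as \<open>p - n\<close> with \<open>p\<close>, \<open>n\<close> nonnegative of disjoint supports: as
  \<open>(p, n) \<le> 0\<close>, the norms of \<open>p\<close> and \<open>n\<close> add up to at most \<open>2\<close>, and both are even.\<close>

lemma pos_or_neg:
  assumes "\<alpha> \<in> roots" shows "\<alpha> \<in> pos_roots \<or> - \<alpha> \<in> pos_roots"
proof -
  define x where "x = coroot \<alpha>"
  define p where "p = (\<chi> i. max 0 (x $ i))"
  define n where "n = (\<chi> i. max 0 (- x $ i))"
  have x: "x $ i = p $ i - n $ i" for i by (simp add: p_def n_def max_def)
  then have xpn: "x = p - n" by (simp add: vec_eq_iff)
  have nonneg: "0 \<le> p $ i" "0 \<le> n $ i" for i by (simp_all add: p_def n_def)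
  have "pairing (root_of p) n \<le> 0"
    unfolding pairing_root_of
  proof (intro sum_nonpos)
    fix i j
    show "A $ i $ j * p $ i * n $ j \<le> 0"
    proof (cases "i = j")
      case True then show ?thesis by (auto simp: p_def n_def max_def)
    next
      case False
      have "p $ i * n $ j \<ge> 0" by (simp add: p_def n_def)
      then show ?thesis using off_diagonal[OF False] by auto
    qed
  qed
  moreover have "pairing (root_of x) x =
      pairing (root_of p) p - 2 * pairing (root_of p) n + pairing (root_of n) n"
    unfolding xpn using form_symmetric[of p n] by (simp add: root_of_linear pairing_linear)
  moreover have "pairing (root_of x) x = 2" using assms by (simp add: x_def)
  ultimately have "pairing (root_of p) p + pairing (root_of n) n \<le> 2" by simp
  then have "p = 0 \<or> n = 0"
    using form_positive[of p] form_positive[of n] form_even[of p] form_even[of n]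
    by (smt (verit) even_iff_mod_2_eq_zero mod_pos_pos_trivial)
  then show ?thesis
  proof
    assume "p = 0"
    then have "\<forall>i. 0 \<le> (- x) $ i" using x nonneg by simp
    then show ?thesis using assms by (simp add: pos_root_iff x_def coroot_minus)
  next
    assume "n = 0"
    then have "\<forall>i. 0 \<le> x $ i" using x nonneg by simp
    then show ?thesis using assms by (simp add: pos_root_iff x_def)
  qed
qed

lemma not_pos_and_neg: "\<alpha> \<in> pos_roots \<Longrightarrow> - \<alpha> \<notin> pos_roots"
proof
  assume *: "\<alpha> \<in> pos_roots" "- \<alpha> \<in> pos_roots"
  then have "\<forall>i. 0 \<le> coroot \<alpha> $ i" "\<forall>i. 0 \<le> - coroot \<alpha> $ i"
    using pos_root_iff[of \<alpha>] pos_root_iff[of "-\<alpha>"] by (simp_all add: coroot_minus)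
  then have "coroot \<alpha> = 0" by (simp add: vec_eq_iff antisym)
  then show False using * pairing_root_coroot[of \<alpha>] by (simp add: pairing_linear)
qed

lemma rabs_in_roots: "\<alpha> \<in> roots \<Longrightarrow> rabs \<alpha> \<in> roots"
  using roots_minus[of \<alpha>] by (simp add: rabs_def rsgn_def)

text \<open>The norms \<open>4 \<mp> 2\<langle>\<alpha>, \<beta>\<^sup>\<or>\<rangle>\<close> of \<open>\<alpha> \<mp> \<beta>\<close> are nonnegative, and zero only for the zero vector.\<close>

lemma roots_pairing_bound:
  assumes "\<alpha> \<in> roots" "\<beta> \<in> roots"
  shows "\<bar>pairing \<alpha> (coroot \<beta>)\<bar> \<le> 2"
    and "pairing \<alpha> (coroot \<beta>) = 2 \<Longrightarrow> \<alpha> = \<beta>"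
    and "pairing \<alpha> (coroot \<beta>) = -2 \<Longrightarrow> \<alpha> = - \<beta>"
proof -
  let ?a = "coroot \<alpha>" and ?b = "coroot \<beta>"
  have m: "pairing (root_of (?a - ?b)) (?a - ?b) = 4 - 2 * pairing \<alpha> ?b"
    using assms by (simp add: root_of_linear pairing_linear pairing_roots_commute)
  have p: "pairing (root_of (?a + ?b)) (?a + ?b) = 4 + 2 * pairing \<alpha> ?b"
    using assms by (simp add: root_of_linear pairing_linear pairing_roots_commute)
  show "\<bar>pairing \<alpha> ?b\<bar> \<le> 2"
    using m p form_nonneg[of "?a - ?b"] form_nonneg[of "?a + ?b"] by linarith
  { assume "pairing \<alpha> ?b = 2"
    then have "?a - ?b = 0" using m form_positive[of "?a - ?b"] by (cases "?a - ?b = 0") simp_all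
    then show "\<alpha> = \<beta>" by (metis assms eq_iff_diff_eq_0 root_of_coroot) }
  { assume "pairing \<alpha> ?b = -2"
    then have "?a + ?b = 0" using p form_positive[of "?a + ?b"] by (cases "?a + ?b = 0") simp_all
    then have "?a = - ?b" by (simp add: eq_neg_iff_add_eq_0)
    then show "\<alpha> = - \<beta>" by (metis assms root_of_coroot root_of_linear(3)) }
qed

text \<open>The coordinates of a root are its pairings with the simple coroots, hence at most \<open>2\<close> in
  absolute value.\<close>

lemma finite_roots: "finite roots"
proof (rule finite_subset)
  show "roots \<subseteq> vec_lambda ` (UNIV \<rightarrow>\<^sub>E {-2..2})"
  proof
    fix \<alpha> assume "\<alpha> \<in> roots"
    then have "\<bar>\<alpha> $ i\<bar> \<le> 2" for i
      using roots_pairing_bound(1)[of \<alpha> "simple_root i"] by simp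
    then have "vec_nth \<alpha> \<in> UNIV \<rightarrow>\<^sub>E {-2..2}" by (auto simp: abs_le_iff minus_le_iff)
    then show "\<alpha> \<in> vec_lambda ` (UNIV \<rightarrow>\<^sub>E {-2..2})" by (metis image_eqI vec_nth_inverse)
  qed
  show "finite (vec_lambda ` ((UNIV :: 'i set) \<rightarrow>\<^sub>E {-2..2::int}))"
    by (intro finite_imageI finite_PiE) auto
qed

text \<open>Weights are determined by their pairings with coroots, and
  \<open>\<langle>w\<^sup>-\<^sup>1\<nu>, \<alpha>\<^sub>i\<^sup>\<or>\<rangle> = \<langle>\<nu>, (w\<alpha>\<^sub>i)\<^sup>\<or>\<rangle>\<close>; so the images of the simple roots suffice although they need not
  span the weight lattice.\<close>

lemma W_eqI:
  assumes "u \<in> W" "w \<in> W" "\<And>i. u (simple_root i) = w (simple_root i)"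
  shows "u = w"
proof -
  have "inv u \<nu> = inv w \<nu>" for \<nu>
  proof -
    have "inv v \<nu> $ i = pairing \<nu> (coroot (v (simple_root i)))" if "v \<in> W" for v i
      using that by (simp add: coroot_W pairing_coact)
    from this[OF assms(1)] this[OF assms(2)] show ?thesis
      using assms(3) by (simp add: vec_eq_iff del: vec_eq_iff) (metis vec_eq_iff)
  qed
  then have "inv (inv u) = inv (inv w)" by (metis ext)
  then show ?thesis using assms by simp
qed

lemma finite_W: "finite W"
proof (rule finite_imageD)
  show "finite ((\<lambda>w i. w (simple_root i)) ` W)"
  proof (rule finite_subset)
    show "(\<lambda>w i. w (simple_root i)) ` W \<subseteq> (UNIV \<rightarrow>\<^sub>E roots)" by auto
    show "finite ((UNIV :: 'i set) \<rightarrow>\<^sub>E roots)" by (intro finite_PiE) (auto simp: finite_roots)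
  qed
  show "inj_on (\<lambda>w i. w (simple_root i)) W"
    by (intro inj_onI) (metis W_eqI)
qed

end


lemma finite_maximizer:
  fixes f :: "'a \<Rightarrow> 'b :: linorder"
  assumes "finite S" "S \<noteq> {}"
  shows "\<exists>x\<in>S. \<forall>y\<in>S. f y \<le> f x"
proof -
  have "Max (f ` S) \<in> f ` S" using assms by simp
  then obtain x where "x \<in> S" "Max (f ` S) = f x" by auto
  then show ?thesis using assms by (metis Max_ge finite_imageI imageI)
qed

context simply_laced
begin

section \<open>Length and reflections\<close>

text \<open>Applying \<open>s\<^sub>j\<close> changes only the coefficient of \<open>\<alpha>\<^sub>j\<close>. If the sign changes, all other coefficients
  vanish, and the norm forces the remaining one to be \<open>1\<close>.\<close>

lemma simple_refl_pos_root:
  assumes "\<beta> \<in> pos_roots" "simple_refl j \<beta> \<notin> pos_roots"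
  shows "\<beta> = simple_root j"
proof -
  let ?c = "coroot \<beta>"
  have b: "\<beta> \<in> roots" and sb: "simple_refl j \<beta> \<in> roots" using assms(1) by simp_all
  have "- simple_refl j \<beta> \<in> pos_roots" using pos_or_neg[OF sb] assms(2) by blast
  then have "0 \<le> - (coroot (simple_refl j \<beta>) $ i)" for i
    using pos_root_iff[of "- simple_refl j \<beta>"] sb by (simp add: coroot_minus)
  moreover have "coroot (simple_refl j \<beta>) $ i = ?c $ i" if "i \<noteq> j" for i
    using that b by (simp add: coroot_W coact_simple_refl simple_coroot_def axis_def)
  moreover have "0 \<le> ?c $ i" for i using assms(1) b by (simp add: pos_root_iff)
  ultimately have "?c $ i = 0" if "i \<noteq> j" for i using that by (metis antisym neg_0_le_iff_le)
  then have c: "?c = ?c $ j *s simple_coroot j"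
    by (simp add: vec_eq_iff simple_coroot_def axis_def)
  then have beta: "\<beta> = ?c $ j *s simple_root j"
    by (metis b root_of_coroot root_of_linear(4) root_of_simple_coroot)
  have "pairing \<beta> ?c = 2" using b by simp
  also have "pairing \<beta> ?c = ?c $ j * \<beta> $ j"
    by (subst c) (simp add: pairing_scale_right)
  also have "\<beta> $ j = ?c $ j * 2" by (subst beta) simp
  finally have "(?c $ j)\<^sup>2 = 1" by (simp add: power2_eq_square)
  then have "?c $ j = 1" using \<open>\<And>i. 0 \<le> ?c $ i\<close>[of j] by (simp add: power2_eq_1_iff)
  then show ?thesis using beta by simp
qed

text \<open>Reading a word from the right, the root \<open>\<gamma>\<close> changes sign at some letter; there the image of
  \<open>\<gamma>\<close> is the corresponding simple root, so that deleting the letter amounts to multiplying by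
  the reflection in \<open>\<gamma>\<close>.\<close>

lemma strong_exchange:
  assumes "\<gamma> \<in> pos_roots" "weyl_word is \<gamma> \<notin> pos_roots"
  shows "\<exists>js. length js < length is \<and> weyl_word js = weyl_word is \<circ> refl \<gamma>"
  using assms(2)
proof (induction "is")
  case (Cons j "is")
  let ?w = "weyl_word is"
  show ?case
  proof (cases "?w \<gamma> \<in> pos_roots")
    case True
    then have "?w \<gamma> = simple_root j" using simple_refl_pos_root Cons.prems by simp
    then have "simple_refl j = ?w \<circ> refl \<gamma> \<circ> inv ?w"
      using refl_conjugate[of ?w \<gamma>] assms(1) by (metis refl_simple_root pos_roots_subset weyl_word_in_W)
    then have "simple_refl j \<circ> ?w \<circ> refl \<gamma> = ?w \<circ> refl \<gamma> \<circ> (inv ?w \<circ> ?w) \<circ> refl \<gamma>"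
      by (simp only: o_assoc)
    also have "\<dots> = ?w" using assms(1) by (simp add: refl_comp_self comp_assoc)
    finally have "weyl_word is = weyl_word (j # is) \<circ> refl \<gamma>" unfolding weyl_word_Cons ..
    moreover have "length is < length (j # is)" by simp
    ultimately show ?thesis by blast
  next
    case False
    with Cons.IH obtain js where "length js < length is" "weyl_word js = ?w \<circ> refl \<gamma>" by blast
    then show ?thesis by (intro exI[of _ "j # js"]) (simp add: comp_assoc)
  qed
qed (use assms in simp)

lemma reduced_word:
  assumes "w \<in> W" obtains "is" where "weyl_word is = w" "length is = len w"
proof -
  have "\<exists>n is. length is = n \<and> weyl_word is = w" using assms by (auto simp: W_def)
  from LeastI_ex[OF this] show ?thesis using that by (auto simp: len_def)
qed

lemma len_le: "len (weyl_word is) \<le> length is"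
  unfolding len_def by (rule Least_le) blast

lemma len_refl_less:
  assumes "w \<in> W" "\<gamma> \<in> pos_roots" "w \<gamma> \<notin> pos_roots"
  shows "len (w \<circ> refl \<gamma>) < len w"
proof -
  obtain "is" where "weyl_word is = w" "length is = len w" using assms(1) by (rule reduced_word)
  then show ?thesis using strong_exchange[of \<gamma> "is"] assms by (metis len_le order_le_less_trans)
qed

lemma len_refl_greater:
  assumes "w \<in> W" "\<gamma> \<in> pos_roots" "w \<gamma> \<in> pos_roots"
  shows "len w < len (w \<circ> refl \<gamma>)"
proof -
  have "(w \<circ> refl \<gamma>) \<gamma> \<notin> pos_roots"
    using assms by (simp add: refl_self W_minus not_pos_and_neg)
  then have "len (w \<circ> refl \<gamma> \<circ> refl \<gamma>) < len (w \<circ> refl \<gamma>)"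
    using assms by (intro len_refl_less) simp_all
  then show ?thesis using assms by (simp add: comp_assoc refl_comp_self)
qed

text \<open>Since \<open>s\<^sub>\<gamma> w = w s\<^sub>\<beta>\<close> with \<open>\<beta> = w\<^sup>-\<^sup>1\<gamma>\<close>, the comparison of lengths for right multiplication applies
  to whichever of \<open>\<plusminus>\<beta>\<close> is positive.\<close>

lemma rsgn_eq_if_len_less:
  assumes w: "w \<in> W" and g: "\<gamma> \<in> roots" and less: "len w < len (refl \<gamma> \<circ> w)"
  shows "rsgn (inv w \<gamma>) = rsgn \<gamma>"
proof -
  define \<beta> where "\<beta> = inv w \<gamma>"
  have b: "\<beta> \<in> roots" and wb: "w \<beta> = \<gamma>" using w g by (simp_all add: \<beta>_def)
  have r: "refl \<gamma> \<circ> w = w \<circ> refl \<beta>"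
    unfolding wb[symmetric] refl_conjugate[OF w b] using w by (simp add: comp_assoc)
  show ?thesis
  proof (cases "\<beta> \<in> pos_roots")
    case True
    then have "\<gamma> \<in> pos_roots" using len_refl_less[OF w True] less r wb by fastforce
    then show ?thesis using True by (simp add: rsgn_def \<beta>_def)
  next
    case False
    then have nb: "- \<beta> \<in> pos_roots" using pos_or_neg[OF b] by blast
    have "w (- \<beta>) \<in> pos_roots"
      using len_refl_less[OF w nb] less r b by (fastforce simp: refl_minus)
    then have "\<gamma> \<notin> pos_roots" using not_pos_and_neg[of \<gamma>] w wb by (auto simp: W_minus)
    then show ?thesis using False by (simp add: rsgn_def \<beta>_def)
  qed
qed

lemma bruhat_less_imp: "bruhat_less x y \<Longrightarrow> x \<in> W \<and> y \<in> W \<and> len x < len y"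
  unfolding bruhat_less_def by (induction rule: tranclp_induct) auto

section \<open>The longest element\<close>

text \<open>Otherwise a reduced word of \<open>w\<close> has a last letter \<open>i\<close>, so that \<open>w s\<^sub>i\<close> is shorter than \<open>w\<close>, which
  contradicts that \<open>w\<alpha>\<^sub>i\<close> is positive.\<close>

lemma W_pos_simple_imp_id:
  assumes "w \<in> W" "\<And>i. w (simple_root i) \<in> pos_roots"
  shows "w = id"
proof -
  obtain "is" where w: "weyl_word is = w" and l: "length is = len w" using assms(1) by (rule reduced_word)
  show ?thesis
  proof (cases "is" rule: rev_cases)
    case (snoc js i)
    have "weyl_word js = w \<circ> simple_refl i"
      unfolding w[symmetric] snoc weyl_word_append by (simp add: comp_assoc)
    then have "len (w \<circ> simple_refl i) < len w" using len_le[of js] l snoc by simp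
    moreover have "len w < len (w \<circ> simple_refl i)"
      using len_refl_greater[OF assms(1), of "simple_root i"] assms(2) by simp
    ultimately show ?thesis by simp
  qed (use w in simp)
qed

lemma len_max_neg:
  assumes "w \<in> W" "\<forall>u\<in>W. len u \<le> len w" "\<beta> \<in> pos_roots"
  shows "w \<beta> \<notin> pos_roots"
  using len_refl_greater[OF assms(1,3)] assms by (metis W_comp linorder_not_le pos_roots_subset refl_in_W)

text \<open>Elements of maximal length make all positive roots negative, so \<open>w\<^sup>-\<^sup>1 w'\<close> keeps them positive.\<close>

lemma len_max_unique:
  assumes "w \<in> W" "\<forall>u\<in>W. len u \<le> len w" "w' \<in> W" "\<forall>u\<in>W. len u \<le> len w'"
  shows "w' = w"
proof -
  have "inv w \<circ> w' = id"
  proof (rule W_pos_simple_imp_id)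
    fix i
    have "- w' (simple_root i) \<in> pos_roots"
      using pos_or_neg[of "w' (simple_root i)"] len_max_neg[OF assms(3,4), of "simple_root i"] assms by simp
    then have "inv w (- w' (simple_root i)) \<notin> pos_roots"
      using len_max_neg[OF assms(1,2)] assms(1) by (metis W_inv_cancel(2))
    then have "- inv w (w' (simple_root i)) \<notin> pos_roots" using assms by (simp add: W_minus)
    then show "(inv w \<circ> w') (simple_root i) \<in> pos_roots"
      using pos_or_neg[of "inv w (w' (simple_root i))"] assms by simp
  qed (use assms in simp)
  then have "w \<circ> (inv w \<circ> w') = w" by simp
  then show ?thesis using assms by (simp add: o_assoc)
qed

lemma len_inv: "w \<in> W \<Longrightarrow> len (inv w) \<le> len w"
  by (metis inv_weyl_word len_le length_rev reduced_word)

lemma longest_in_W [simp]: "longest \<in> W"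
  and longest_involutive: "longest (longest x) = x"
proof -
  have "\<exists>!w. w \<in> W \<and> (\<forall>u\<in>W. len u \<le> len w)"
    using finite_maximizer[OF finite_W, of len] W_id len_max_unique by blast
  then have w: "longest \<in> W \<and> (\<forall>u\<in>W. len u \<le> len longest)"
    unfolding longest_def by (rule theI')
  then show *: "longest \<in> W" by blast
  have "len longest \<le> len (inv longest)" using len_inv[of "inv longest"] * by simp
  then have "inv longest = longest"
    using w len_max_unique[of longest "inv longest"] by (meson W_inv order_trans)
  then show "longest (longest x) = x" using * by (metis W_inv_cancel(1))
qed

section \<open>The highest root\<close>

lemma root_diff_in_cone: "\<alpha> \<in> roots \<Longrightarrow> \<beta> \<in> roots \<Longrightarrow>
    \<alpha> - \<beta> \<in> root_cone \<longleftrightarrow> (\<forall>i. coroot \<beta> $ i \<le> coroot \<alpha> $ i)"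
  using root_cone_iff[of "coroot \<alpha> - coroot \<beta>"] by (simp add: root_of_linear)

text \<open>Take \<open>\<theta>\<close> of maximal height among the roots above \<open>\<beta>\<close>: if \<open>\<langle>\<theta>, \<alpha>\<^sub>i\<^sup>\<or>\<rangle>\<close> were negative, then \<open>s\<^sub>i \<theta>\<close> would be
  higher.\<close>

lemma dominant_root_above:
  assumes "\<beta> \<in> roots"
  shows "\<exists>\<theta>\<in>roots. \<theta> - \<beta> \<in> root_cone \<and> (\<forall>i. 0 \<le> \<theta> $ i)"
proof -
  define S where "S = {\<theta>\<in>roots. \<theta> - \<beta> \<in> root_cone}"
  define h where "h = (\<lambda>\<theta>. \<Sum>i\<in>UNIV. coroot \<theta> $ i)"
  have "finite S" "\<beta> \<in> S"
    using finite_roots assms root_diff_in_cone[OF assms assms] by (simp_all add: S_def)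
  then obtain \<theta> where \<theta>: "\<theta> \<in> S" "\<And>\<gamma>. \<gamma> \<in> S \<Longrightarrow> h \<gamma> \<le> h \<theta>"
    using finite_maximizer[of S h] by blast
  then have r: "\<theta> \<in> roots" by (simp add: S_def)
  have "0 \<le> \<theta> $ i" for i
  proof (rule ccontr)
    assume neg: "\<not> 0 \<le> \<theta> $ i"
    have c: "coroot (simple_refl i \<theta>) = coroot \<theta> - \<theta> $ i *s axis i 1"
      using r pairing_roots_commute[of "simple_root i" \<theta>]
      by (simp add: coroot_W coact_simple_refl simple_coroot_def pairing_axis)
    have le: "coroot \<theta> $ k \<le> coroot (simple_refl i \<theta>) $ k" for k
      using neg by (simp add: c axis_def)
    moreover have "coroot \<beta> $ k \<le> coroot \<theta> $ k" for k
      using \<theta>(1) root_diff_in_cone[OF r assms] by (simp add: S_def)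
    ultimately have "\<forall>k. coroot \<beta> $ k \<le> coroot (simple_refl i \<theta>) $ k" by (meson order_trans)
    then have "simple_refl i \<theta> \<in> S"
      using root_diff_in_cone[OF _ assms] r by (simp add: S_def)
    moreover have "h \<theta> < h (simple_refl i \<theta>)"
      unfolding h_def using le neg by (intro sum_strict_mono_ex1) (auto intro!: bexI[of _ i] simp: c axis_def)
    ultimately show False using \<theta>(2) by fastforce
  qed
  then show ?thesis using \<theta>(1) by (auto simp: S_def)
qed

text \<open>If the support were proper, some \<open>j\<close> outside it would be adjacent to it by indecomposability, and
  then \<open>\<langle>\<gamma>, \<alpha>\<^sub>j\<^sup>\<or>\<rangle> < 0\<close>.\<close>

lemma dominant_root_full_support:
  assumes "\<gamma> \<in> roots" "\<And>i. 0 \<le> \<gamma> $ i"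
  shows "1 \<le> coroot \<gamma> $ i"
proof -
  let ?c = "coroot \<gamma>"
  have pos: "\<gamma> \<in> pos_roots"
  proof (rule ccontr)
    assume "\<gamma> \<notin> pos_roots"
    then have "- \<gamma> \<in> pos_roots" using pos_or_neg assms(1) by blast
    then have "?c $ i \<le> 0" for i using assms(1) pos_root_iff[of "- \<gamma>"] by (simp add: coroot_minus)
    then have "pairing \<gamma> ?c \<le> 0" unfolding pairing_def
      using assms(2) by (intro sum_nonpos) (simp add: mult_nonneg_nonpos)
    then show False using assms(1) by simp
  qed
  then have c: "0 \<le> ?c $ i" for i using assms(1) by (simp add: pos_root_iff)
  have "{i. ?c $ i \<noteq> 0} = UNIV"
  proof (rule ccontr)
    assume "{i. ?c $ i \<noteq> 0} \<noteq> UNIV"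
    moreover have "{i. ?c $ i \<noteq> 0} \<noteq> {}"
    proof
      assume "{i. ?c $ i \<noteq> 0} = {}"
      then have "pairing \<gamma> ?c = 0" by (auto simp: pairing_def)
      then show False using assms(1) by simp
    qed
    ultimately obtain i j where ij: "?c $ i \<noteq> 0" "?c $ j = 0" "A $ i $ j \<noteq> 0"
      using indecomposable[of "{i. ?c $ i \<noteq> 0}"] by auto
    have "\<gamma> $ j = root_of ?c $ j" using assms(1) by simp
    also have "\<dots> = (\<Sum>k\<in>UNIV. ?c $ k * A $ k $ j)" by (simp add: root_of_def simple_root_def)
    also have "\<dots> < 0"
    proof -
      have nonpos: "?c $ k * A $ k $ j \<le> 0" for k
        using ij(2) c[of k] off_diagonal[of k j] by (cases "k = j") (auto simp: mult_nonneg_nonpos)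
      have "i \<noteq> j" using ij by auto
      then have "?c $ i * A $ i $ j < 0" using ij c[of i] off_diagonal[of i j] by auto
      moreover have "(\<Sum>k\<in>UNIV. ?c $ k * A $ k $ j) = ?c $ i * A $ i $ j + (\<Sum>k\<in>UNIV-{i}. ?c $ k * A $ k $ j)"
        by (simp add: sum.remove)
      moreover have "(\<Sum>k\<in>UNIV-{i}. ?c $ k * A $ k $ j) \<le> 0" using nonpos by (intro sum_nonpos)
      ultimately show ?thesis by linarith
    qed
    finally show False using assms(2)[of j] by simp
  qed
  then have "?c $ i \<noteq> 0" by auto
  then show ?thesis using c[of i] by linarith
qed

text \<open>Two dominant roots \<open>\<theta>\<close>, \<open>\<gamma>\<close> pair positively, because the second has full support. If they differ
  then the pairing is \<open>1\<close> and \<open>\<theta> - \<gamma>\<close> is a root, which pairs to \<open>1\<close> with \<open>\<theta>\<close> and to \<open>-1\<close> with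
  \<open>\<gamma>\<close>: whatever its sign, this contradicts dominance of one of them.\<close>

lemma dominant_root_unique:
  assumes t: "\<theta> \<in> roots" "\<And>i. 0 \<le> \<theta> $ i" and g: "\<gamma> \<in> roots" "\<And>i. 0 \<le> \<gamma> $ i"
  shows "\<theta> = \<gamma>"
proof (rule ccontr)
  assume ne: "\<theta> \<noteq> \<gamma>"
  have nonneg: "0 \<le> pairing \<nu> (coroot \<beta>)" if "\<beta> \<in> pos_roots" "\<And>i. 0 \<le> \<nu> $ i" for \<nu> \<beta>
    using that pos_root_iff[of \<beta>] by (auto simp: pairing_def intro!: sum_nonneg)
  have "\<exists>k. 0 < \<theta> $ k"
  proof (rule ccontr)
    assume "\<nexists>k. 0 < \<theta> $ k"
    then have "\<theta> = 0" using t(2) by (simp add: vec_eq_iff) (metis antisym not_less)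
    then show False using root_nonzero t by blast
  qed
  then obtain k where k: "0 < \<theta> $ k" ..
  have "0 < (\<Sum>i\<in>UNIV. \<theta> $ i * coroot \<gamma> $ i)"
    using k t(2) dominant_root_full_support[OF g]
    by (intro sum_pos2[of _ k]) (auto intro!: mult_nonneg_nonneg mult_pos_pos intro: order_trans[of 0 1]
        simp: less_le_trans[of 0 1])
  then have "0 < pairing \<theta> (coroot \<gamma>)" by (simp add: pairing_def)
  moreover have "pairing \<theta> (coroot \<gamma>) \<le> 2" "pairing \<theta> (coroot \<gamma>) \<noteq> 2"
    using roots_pairing_bound[OF t(1) g(1)] ne by auto
  ultimately have tg1: "pairing \<theta> (coroot \<gamma>) = 1" by linarith
  have "refl \<gamma> \<theta> \<in> roots" using t g by simp
  then have d: "\<theta> - \<gamma> \<in> roots" using tg1 by (simp add: refl_def)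
  have c: "coroot (\<theta> - \<gamma>) = coroot \<theta> - coroot \<gamma>"
    by (metis d g(1) root_of_coroot root_of_inject root_of_linear(2) t(1))
  have tg: "pairing \<theta> (coroot \<gamma>) = 1" "pairing \<gamma> (coroot \<theta>) = 1"
    using tg1 pairing_roots_commute t g by simp_all
  from pos_or_neg[OF d] show False
  proof
    assume "\<theta> - \<gamma> \<in> pos_roots"
    then have "0 \<le> pairing \<gamma> (coroot (\<theta> - \<gamma>))" using nonneg g by blast
    then show False using g tg by (simp add: c pairing_linear)
  next
    assume "- (\<theta> - \<gamma>) \<in> pos_roots"
    then have "0 \<le> pairing \<theta> (coroot (- (\<theta> - \<gamma>)))" using nonneg t by blast
    then show False using t tg coroot_minus[OF d] by (simp add: c pairing_linear)
  qed
qed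

lemma highest_root_in_roots [simp]: "highest_root \<in> roots"
proof -
  obtain \<theta> where \<theta>: "\<theta> \<in> roots" "\<And>i. 0 \<le> \<theta> $ i"
    using dominant_root_above[OF simple_root_in_roots] by blast
  have max: "\<theta> - \<beta> \<in> root_cone" if "\<beta> \<in> roots" for \<beta>
    using dominant_root_above[OF that] dominant_root_unique[OF \<theta>] by blast
  have "highest_root = \<theta>"
    unfolding highest_root_def
  proof (rule the_equality)
    fix \<gamma> assume g: "\<gamma> \<in> roots \<and> (\<forall>\<beta>\<in>roots. \<gamma> - \<beta> \<in> root_cone)"
    then have "\<theta> - \<gamma> \<in> root_cone" "\<gamma> - \<theta> \<in> root_cone" using \<theta>(1) max by blast+
    then have "coroot \<gamma> = coroot \<theta>"
      using g \<theta>(1) by (simp add: root_diff_in_cone vec_eq_iff antisym)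
    then show "\<gamma> = \<theta>" using g \<theta>(1) by (metis root_of_coroot)
  qed (use \<theta> max in blast)
  then show ?thesis using \<theta> by simp
qed

section \<open>The affine Weyl group\<close>

lemma W_aff_iff: "x \<in> W_aff \<longleftrightarrow> fst x \<in> W"
  by (cases x) (simp add: W_aff_def)

lemma aff_mult_in_W_aff [simp]: "x \<in> W_aff \<Longrightarrow> y \<in> W_aff \<Longrightarrow> aff_mult x y \<in> W_aff"
  by (simp add: W_aff_iff aff_mult_def)

lemma aff_simple_refl_in_W_aff [simp]: "aff_simple_refl j \<in> W_aff"
  by (simp add: W_aff_iff aff_simple_refl_def split: option.split)

lemma aff_mult_id [simp]: "aff_mult (id, 0) x = x" "aff_mult x (id, 0) = x"
  by (simp_all add: aff_mult_def coact_linear)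

lemma aff_mult_assoc:
  "x \<in> W_aff \<Longrightarrow> y \<in> W_aff \<Longrightarrow> z \<in> W_aff \<Longrightarrow> aff_mult (aff_mult x y) z = aff_mult x (aff_mult y z)"
  by (simp add: aff_mult_def W_aff_iff comp_assoc W_inv_comp coact_comp coact_linear)

lemma aff_mult_translation: "aff_mult (w, \<xi>) (id, \<zeta>) = (w, \<xi> + \<zeta>)"
  by (simp add: aff_mult_def)

lemma aff_act_mult: "x \<in> W_aff \<Longrightarrow> y \<in> W_aff \<Longrightarrow> aff_act (aff_mult x y) \<beta> = aff_act x (aff_act y \<beta>)"
  by (simp add: aff_act_def aff_mult_def W_aff_iff pairing_linear pairing_coact)

lemma aff_act_simple_refl:
  "aff_act (aff_simple_refl j) \<beta> = (let n = aff_pairing \<beta> (aff_coroot j) in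
     (fst \<beta> - n *s fst (aff_root j), snd \<beta> - n * snd (aff_root j)))"
  by (cases j) (simp_all add: aff_act_def aff_simple_refl_def aff_coroot_def aff_root_def aff_pairing_def
    Let_def refl_def simple_refl_eq pairing_linear vec_eq_iff)

inductive aff_generated :: "'i aff_weyl \<Rightarrow> bool" where
  one: "aff_generated (id, 0)"
| mult: "aff_generated x \<Longrightarrow> aff_generated (aff_mult (aff_simple_refl j) x)"

lemma aff_generated_in_W_aff: "aff_generated x \<Longrightarrow> x \<in> W_aff"
  by (induction rule: aff_generated.induct) (simp_all add: W_aff_iff aff_mult_def aff_simple_refl_def split: option.split)

lemma aff_generated_mult: "aff_generated x \<Longrightarrow> aff_generated y \<Longrightarrow> aff_generated (aff_mult x y)"
proof (induction rule: aff_generated.induct)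
  case (mult x j)
  then show ?case
    using aff_generated.mult[of "aff_mult x y" j] by (simp add: aff_mult_assoc aff_generated_in_W_aff)
qed simp

lemma aff_generated_simple: "aff_generated (aff_simple_refl j)"
  using aff_generated.mult[OF one, of j] by simp

lemma aff_generated_finite: "w \<in> W \<Longrightarrow> aff_generated (w, 0)"
proof (induction rule: W_induct)
  case (step i w)
  have "aff_generated (simple_refl i \<circ> w, 0)"
    using aff_generated_mult[OF aff_generated_simple[of "Some i"] step(2)]
    by (simp add: aff_simple_refl_def aff_mult_def coact_linear)
  then show ?case .
qed (use one in metis)

lemma aff_generated_translation_W:
  assumes "w \<in> W" "aff_generated (id, \<xi>)" shows "aff_generated (id, coact w \<xi>)"
  using aff_generated_mult[OF aff_generated_mult[OF aff_generated_finite assms(2)] aff_generated_finite, of w "inv w"]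
    assms by (simp add: aff_mult_def)

text \<open>Up to the finite Weyl group, \<open>s\<^sub>0\<close> is the translation by \<open>\<theta>\<^sup>\<or>\<close>, hence conjugate to the translation
  by some \<open>\<alpha>\<^sub>i\<^sup>\<or>\<close>. If \<open>j\<close> is adjacent to \<open>i\<close>, then \<open>s\<^sub>j \<alpha>\<^sub>i\<^sup>\<or> = \<alpha>\<^sub>i\<^sup>\<or> + \<alpha>\<^sub>j\<^sup>\<or>\<close>, so the translations by simple
  coroots propagate along the connected Dynkin diagram.\<close>

lemma aff_generated_translation: "aff_generated (id, \<xi>)"
proof -
  have plus: "aff_generated (id, x + y)" if "aff_generated (id, x)" "aff_generated (id, y)" for x y
    using aff_generated_mult[OF that] by (simp add: aff_mult_def)
  have refl_minus: "coact (refl \<alpha>) (coroot \<alpha>) = - coroot \<alpha>" if "\<alpha> \<in> roots" for \<alpha>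
    using that by (metis coroot_W coroot_minus refl_in_W refl_self)
  have "aff_generated (aff_mult (aff_simple_refl None) (refl highest_root, 0))"
    by (intro aff_generated_mult aff_generated_simple aff_generated_finite) simp
  then have theta: "aff_generated (id, coroot highest_root)"
    by (simp add: aff_simple_refl_def aff_mult_def refl_comp_self refl_inv coact_linear refl_minus)
  let ?J = "{i. aff_generated (id, simple_coroot i)}"
  obtain w i where "w \<in> W" "coroot highest_root = coact w (simple_coroot i)"
    using rootE[OF highest_root_in_roots] by metis
  then have "aff_generated (id, simple_coroot i)"
    using aff_generated_translation_W[OF W_inv theta, of w] by simp
  then have "?J \<noteq> {}" by blast
  moreover have minus: "aff_generated (id, - simple_coroot i)" if "i \<in> ?J" for i
    using aff_generated_translation_W[OF refl_in_W, of "simple_root i" "simple_coroot i"] that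
      refl_minus[of "simple_root i"] by simp
  have "False" if ij: "i \<in> ?J" "j \<notin> ?J" "A $ i $ j \<noteq> 0" for i j
  proof -
    have "i \<noteq> j" using ij by auto
    then have "A $ j $ i = -1" using ij off_diagonal[of i j] symmetric[of i j] by auto
    then have "coact (simple_refl j) (simple_coroot i) = simple_coroot i + simple_coroot j"
      by (simp add: coact_simple_refl simple_root_component)
    then have "aff_generated (id, simple_coroot i + simple_coroot j)"
      using ij(1) aff_generated_translation_W[of "simple_refl j" "simple_coroot i"] by simp
    from plus[OF this minus[OF ij(1)]] show False using ij(2) by simp
  qed
  ultimately have "?J = UNIV" using indecomposable[of ?J] by blast
  then have simple: "aff_generated (id, simple_coroot i)" for i by blast
  have nat: "aff_generated (id, int n *s x)" if "aff_generated (id, x)" for n x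
  proof (induction n)
    case 0
    have "int 0 *s x = 0" by (simp add: vec_eq_iff)
    then show ?case using one by metis
  next
    case (Suc n)
    have "int (Suc n) *s x = x + int n *s x" by (simp add: vec_eq_iff algebra_simps)
    then show ?case using plus[OF that Suc] by metis
  qed
  have scale: "aff_generated (id, c *s axis i 1)" for c i
  proof (cases "c \<ge> 0")
    case True
    then show ?thesis using nat[OF simple, of "nat c" i] by (simp add: simple_coroot_def)
  next
    case False
    then have "aff_generated (id, int (nat (- c)) *s - simple_coroot i)"
      using minus simple by (intro nat) simp
    moreover have "- c *s - axis i 1 = c *s axis i (1 :: int)" by (simp add: vec_eq_iff)
    ultimately show ?thesis using False by (simp add: simple_coroot_def)
  qed
  have "aff_generated (id, \<Sum>i\<in>S. \<xi> $ i *s axis i 1)" if "finite S" for S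
    using that 
  proof (induction S)
    case empty
    show ?case using one by (metis sum.empty)
  next
    case (insert i S)
    show ?case unfolding sum.insert[OF insert.hyps] by (rule plus[OF scale insert.IH])
  qed
  from this[of UNIV] show ?thesis using weight_expansion[of \<xi>] by simp
qed

lemma aff_generated_iff: "aff_generated x \<longleftrightarrow> x \<in> W_aff"
proof
  assume "x \<in> W_aff"
  then have "aff_generated (aff_mult (fst x, 0) (id, snd x))"
    by (intro aff_generated_mult aff_generated_finite aff_generated_translation) (simp add: W_aff_iff)
  then show "aff_generated x" by (simp add: aff_mult_translation)
qed (rule aff_generated_in_W_aff)

lemma W_aff_induct [consumes 1, case_names one mult]:
  assumes "x \<in> W_aff" "P (id, 0)"
    and "\<And>x j. x \<in> W_aff \<Longrightarrow> P x \<Longrightarrow> P (aff_mult (aff_simple_refl j) x)"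
  shows "P x"
proof -
  have "aff_generated x" using assms(1) by (simp add: aff_generated_iff)
  then show ?thesis
    by (induction rule: aff_generated.induct) (use assms(2,3) aff_generated_in_W_aff in blast)+
qed

end


section \<open>Twisting the free algebra by the degree operator\<close>

definition K_degree :: "('j, 'h \<times> int \<times> int) generator word \<Rightarrow> int" where
  "K_degree u = sum_list (map (\<lambda>g. case g of K_gen h \<Rightarrow> snd (snd h) | _ \<Rightarrow> 0) (letters u))"

text \<open>The algebra automorphism \<open>K\<^sub>h \<mapsto> v\<^bsup>k \<langle>\<delta>, h\<rangle>\<^esup> K\<^sub>h\<close>, which fixes the other generators. Pulling a module
  back along it adds \<open>k \<delta>\<close> to all weights.\<close>

definition twist :: "int \<Rightarrow> ('i::finite) free_alg \<Rightarrow> 'i free_alg" where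
  "twist k a = Poly_Mapping.mapp (\<lambda>u c. qv powi (k * K_degree u) * c) a"

lemma qv_nonzero [simp]: "qv \<noteq> 0"
  by (simp add: qv_def Zero_fract_def eq_fract)

lemma K_degree_add: "K_degree (u + w) = K_degree u + K_degree w"
  and K_degree_zero: "K_degree 0 = 0"
  by (simp_all add: K_degree_def plus_word_def zero_word_def)

lemma lookup_twist: "Poly_Mapping.lookup (twist k a) u = qv powi (k * K_degree u) * Poly_Mapping.lookup a u"
  by (simp add: twist_def lookup_mapp when_def in_keys_iff)

lemma twist_add: "twist k (a + b) = twist k a + twist k b"
  and twist_diff: "twist k (a - b) = twist k a - twist k b"
  and twist_uminus: "twist k (- a) = - twist k a"
  and twist_zero: "twist k 0 = 0"
  by (auto intro!: poly_mapping_eqI simp: lookup_twist lookup_add lookup_minus algebra_simps)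

lemma twist_sum: "twist k (sum f S) = (\<Sum>i\<in>S. twist k (f i))"
  by (induction S rule: infinite_finite_induct) (simp_all add: twist_add twist_zero)

lemma twist_single: "twist k (Poly_Mapping.single u c) = Poly_Mapping.single u (qv powi (k * K_degree u) * c)"
  by (auto intro!: poly_mapping_eqI simp: lookup_twist lookup_single when_def)

lemma poly_mapping_expansion: "a = (\<Sum>u\<in>Poly_Mapping.keys a. Poly_Mapping.single u (Poly_Mapping.lookup a u))"
  by (rule poly_mapping_eqI)
     (simp add: lookup_sum lookup_single when_def in_keys_iff if_distrib sum.delta cong: if_cong)

lemma twist_mult: "twist k (a * b) = twist k a * twist k b"
proof -
  have single: "twist k (Poly_Mapping.single u c * Poly_Mapping.single w d) =
      twist k (Poly_Mapping.single u c) * twist k (Poly_Mapping.single w d)" for u w c d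
  proof -
    have "qv powi (k * K_degree (u + w)) * (c * d) = qv powi (k * K_degree u) * c * (qv powi (k * K_degree w) * d)"
      unfolding K_degree_add distrib_left by (simp only: power_int_add[OF disjI1[OF qv_nonzero]] mult_ac)
    then show ?thesis by (simp only: mult_single twist_single)
  qed
  let ?A = "\<lambda>u. Poly_Mapping.single u (Poly_Mapping.lookup a u)"
  let ?B = "\<lambda>u. Poly_Mapping.single u (Poly_Mapping.lookup b u)"
  have "a * b = (\<Sum>u\<in>Poly_Mapping.keys a. ?A u) * (\<Sum>w\<in>Poly_Mapping.keys b. ?B w)"
    unfolding poly_mapping_expansion[symmetric] ..
  then have "twist k (a * b) = (\<Sum>u\<in>Poly_Mapping.keys a. \<Sum>w\<in>Poly_Mapping.keys b. twist k (?A u) * twist k (?B w))"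
    by (simp only: sum_product twist_sum single)
  also have "\<dots> = twist k (\<Sum>u\<in>Poly_Mapping.keys a. ?A u) * twist k (\<Sum>w\<in>Poly_Mapping.keys b. ?B w)"
    by (simp only: twist_sum sum_product)
  also have "\<dots> = twist k a * twist k b"
    unfolding poly_mapping_expansion[symmetric] ..
  finally show ?thesis .
qed

lemma twist_cst [simp]: "twist k (cst c) = cst c"
  by (simp add: cst_def twist_single K_degree_zero)

lemma cst_one: "cst 1 = 1"
  by (simp add: cst_def)

lemma twist_one [simp]: "twist k 1 = 1"
  using twist_cst[of k 1] by (simp add: cst_one)

lemma twist_power: "twist k (a ^ n) = twist k a ^ n"
  by (induction n) (simp_all add: twist_mult)

lemma twist_Eg [simp]: "twist k (Eg j) = Eg j"
  and twist_Fg [simp]: "twist k (Fg j) = Fg j"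
  by (simp_all add: Eg_def Fg_def twist_single K_degree_def)

lemma cst_mult: "cst a * cst b = cst (a * b)"
  by (simp add: cst_def mult_single)

lemma cst_commute: "a * cst c = cst c * a"
proof -
  have single: "Poly_Mapping.single u d * cst c = cst c * Poly_Mapping.single u d" for u d
    by (simp add: cst_def mult_single mult.commute)
  let ?A = "\<Sum>u\<in>Poly_Mapping.keys a. Poly_Mapping.single u (Poly_Mapping.lookup a u)"
  have "?A * cst c = cst c * ?A"
    unfolding sum_distrib_left sum_distrib_right single ..
  then show ?thesis unfolding poly_mapping_expansion[symmetric] .
qed

lemma cst_left_commute: "a * (cst c * b) = cst c * (a * b)"
  unfolding mult.assoc[symmetric] cst_commute[of a] ..

lemma cst_left_commute_cst: "cst c * (cst d * a) = cst (c * d) * a"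
  by (simp only: cst_mult flip: mult.assoc)

lemma twist_Kg: "twist k (Kg h) = cst (qv powi (k * snd (snd h))) * Kg h"
  by (simp add: Kg_def twist_single K_degree_def cst_def mult_single)

lemma twist_divpow: "twist k (divpow a n) = divpow (twist k a) n"
  by (simp add: divpow_def twist_mult twist_power)

lemma twist_twist: "twist k (twist l a) = twist (k + l) a"
  by (rule poly_mapping_eqI) (simp only: lookup_twist power_int_add[OF disjI1[OF qv_nonzero]] distrib_right mult.assoc)

lemma twist_0 [simp]: "twist 0 a = a"
  by (rule poly_mapping_eqI) (simp add: lookup_twist)

lemma twist_F_subalgebra: "a \<in> F_subalgebra \<Longrightarrow> twist k a \<in> F_subalgebra"
  using keys_mapp_subset[of _ a] unfolding F_subalgebra_def twist_def by blast

lemma left_ideal_zero: "left_ideal L \<Longrightarrow> 0 \<in> L"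
  and left_ideal_add: "left_ideal L \<Longrightarrow> a \<in> L \<Longrightarrow> b \<in> L \<Longrightarrow> a + b \<in> L"
  and left_ideal_mult: "left_ideal L \<Longrightarrow> b \<in> L \<Longrightarrow> c * b \<in> L"
  by (auto simp: left_ideal_def)

lemma left_ideal_minus: "left_ideal L \<Longrightarrow> a \<in> L \<Longrightarrow> - a \<in> L"
  using left_ideal_mult[of L a "- 1"] by simp

lemma left_ideal_diff: "left_ideal L \<Longrightarrow> a \<in> L \<Longrightarrow> b \<in> L \<Longrightarrow> a - b \<in> L"
  using left_ideal_add[of L a "- b"] left_ideal_minus[of L b] by simp

lemma left_ideal_sum: "left_ideal L \<Longrightarrow> (\<And>i. i \<in> S \<Longrightarrow> f i \<in> L) \<Longrightarrow> sum f S \<in> L"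
  by (induction S rule: infinite_finite_induct) (simp_all add: left_ideal_zero left_ideal_add)

lemma left_ideal_cong: "left_ideal L \<Longrightarrow> a - b \<in> L \<Longrightarrow> a \<in> L \<longleftrightarrow> b \<in> L"
  by (metis add_diff_cancel_left' diff_add_cancel left_ideal_add left_ideal_diff)

text \<open>The elements \<open>h b\<close> need to agree with \<open>\<Phi> b\<close> only modulo \<open>M\<close>, because extremal vectors are only
  known modulo the defining ideal of the module.\<close>

lemma independent_mod_image:
  assumes L: "left_ideal L" and M: "left_ideal M"
    and lin: "\<And>a b. \<Phi> (a + b) = \<Phi> a + \<Phi> b" "\<And>c a. \<Phi> (cst c * a) = cst c * \<Phi> a"
    and inj: "\<And>a. \<Phi> a \<in> M \<Longrightarrow> a \<in> L"
    and h: "\<And>b. b \<in> B \<Longrightarrow> h b - \<Phi> b \<in> M"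
    and ind: "independent_mod L B"
  shows "independent_mod M (h ` B) \<and> card (h ` B) = card B"
proof -
  have fin: "finite B" and indep: "\<And>c. (\<Sum>b\<in>B. cst (c b) * b) \<in> L \<Longrightarrow> \<forall>b\<in>B. c b = 0"
    using ind by (auto simp: independent_mod_def)
  have zero: "\<Phi> 0 = 0" using lin(1)[of 0 0] by simp
  have sum: "\<Phi> (\<Sum>b\<in>B. f b) = (\<Sum>b\<in>B. \<Phi> (f b))" for f
    using sum_comp_morphism[of \<Phi> f B] zero lin(1) by (simp add: o_def)
  have key: "\<forall>b\<in>B. c b = 0" if "(\<Sum>b\<in>B. cst (c b) * h b) \<in> M" for c
  proof -
    have "(\<Sum>b\<in>B. cst (c b) * h b) - \<Phi> (\<Sum>b\<in>B. cst (c b) * b) = (\<Sum>b\<in>B. cst (c b) * (h b - \<Phi> b))"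
      by (simp add: sum lin right_diff_distrib sum_subtractf)
    also have "\<dots> \<in> M" using h by (intro left_ideal_sum[OF M] left_ideal_mult[OF M])
    finally have "\<Phi> (\<Sum>b\<in>B. cst (c b) * b) \<in> M" using that left_ideal_cong[OF M] by blast
    then show ?thesis using inj indep by blast
  qed
  have "inj_on h B"
  proof (rule inj_onI, rule ccontr)
    fix a b assume ab: "a \<in> B" "b \<in> B" "h a = h b" "a \<noteq> b"
    define c where "c = (\<lambda>x. if x = a then 1 else if x = b then - 1 else (0 :: ratfun))"
    have "(\<Sum>x\<in>B. cst (c x) * h x) = (\<Sum>x\<in>{a, b}. cst (c x) * h x)"
      using ab fin by (intro sum.mono_neutral_right) (auto simp: c_def cst_def)
    also have "\<dots> = 0"
      using ab by (simp add: c_def cst_def single_uminus)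
    finally have "(\<Sum>x\<in>B. cst (c x) * h x) \<in> M" using left_ideal_zero[OF M] by simp
    then have "c a = 0" using key[of c] ab(1) by blast
    then show False by (simp add: c_def)
  qed
  moreover have "independent_mod M (h ` B)"
    unfolding independent_mod_def
  proof (intro conjI allI impI ballI)
    fix c b assume "(\<Sum>b\<in>h ` B. cst (c b) * b) \<in> M" "b \<in> h ` B"
    then show "c b = 0" using key[of "c \<circ> h"] \<open>inj_on h B\<close> by (auto simp: sum.reindex)
  qed (use fin in simp)
  ultimately show ?thesis by (simp add: card_image)
qed

context simply_laced
begin

section \<open>The defining ideals and extremal vectors\<close>

lemma U_ideal_left: "left_ideal U_ideal"
  and U_ideal_right: "a \<in> U_ideal \<Longrightarrow> a * b \<in> U_ideal"
  and U_relations_subset: "r \<in> U_relations \<Longrightarrow> r \<in> U_ideal"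
  and U_ideal_least: "two_sided_ideal J \<Longrightarrow> U_relations \<subseteq> J \<Longrightarrow> a \<in> U_ideal \<Longrightarrow> a \<in> J"
  unfolding U_ideal_def left_ideal_def two_sided_ideal_def by blast+

lemma Kg_Eg: "Kg h * Eg j - cst (qv powi aff_pairing (aff_root j) h) * Eg j * Kg h \<in> U_ideal"
  and Kg_Fg: "Kg h * Fg j - cst (qv powi (- aff_pairing (aff_root j) h)) * Fg j * Kg h \<in> U_ideal"
  by (rule U_relations_subset; unfold U_relations_def; blast)+

lemma twist_U_relations:
  assumes "r \<in> U_relations"
  shows "\<exists>c. twist k r = cst c * r"
proof -
  have 1: "twist k r = cst 1 * r" if "twist k r = r" for r using that by (simp add: cst_one)
  have neg: "twist k ((- 1) ^ n) = (- 1) ^ n" for n by (simp add: twist_power twist_uminus)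
  from assms consider
      "r = Kg 0 - 1"
    | h h' where "r = Kg h * Kg h' - Kg (h + h')"
    | h j where "r = Kg h * Eg j - cst (qv powi aff_pairing (aff_root j) h) * Eg j * Kg h"
    | h j where "r = Kg h * Fg j - cst (qv powi (- aff_pairing (aff_root j) h)) * Fg j * Kg h"
    | j l where "r = Eg j * Fg l - Fg l * Eg j -
        (if j = l then cst (inverse (qv - inverse qv)) * (Kg (aff_coroot j) - Kg (- aff_coroot j)) else 0)"
    | j l n where "r = (\<Sum>r\<le>n. (-1) ^ r * divpow (Eg j) (n - r) * Eg l * divpow (Eg j) r)"
    | j l n where "r = (\<Sum>r\<le>n. (-1) ^ r * divpow (Fg j) (n - r) * Fg l * divpow (Fg j) r)"
    unfolding U_relations_def by blast
  then show ?thesis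
  proof cases
    case 1
    show ?thesis
      by (intro exI[of _ 1]) (simp add: 1 cst_one twist_diff twist_Kg)
  next
    case (2 h h')
    let ?t = "\<lambda>h :: 'i aff_coweight. qv powi (k * snd (snd h))"
    have t: "?t (h + h') = ?t h * ?t h'"
      by (simp add: distrib_left power_int_add)
    have "twist k (Kg h * Kg h') = cst (?t h) * (Kg h * (cst (?t h') * Kg h'))"
      by (simp only: twist_mult twist_Kg mult.assoc)
    also have "\<dots> = cst (?t (h + h')) * (Kg h * Kg h')"
      by (simp only: cst_left_commute[of "Kg h"] cst_left_commute_cst t)
    finally show ?thesis
      by (intro exI[of _ "?t (h + h')"]) (simp only: 2 twist_diff twist_Kg right_diff_distrib)
  next
    case (3 h j)
    show ?thesis
      by (intro exI[of _ "qv powi (k * snd (snd h))"])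
         (simp only: 3 twist_diff twist_mult twist_Kg twist_cst twist_Eg cst_left_commute[of "Eg j"]
           cst_left_commute_cst mult.commute[of "qv powi (k * _)"] mult.assoc right_diff_distrib)
  next
    case (4 h j)
    show ?thesis
      by (intro exI[of _ "qv powi (k * snd (snd h))"])
         (simp only: 4 twist_diff twist_mult twist_Kg twist_cst twist_Fg cst_left_commute[of "Fg j"]
           cst_left_commute_cst mult.commute[of "qv powi (k * _)"] mult.assoc right_diff_distrib)
  next
    case (5 j l)
    have "snd (snd (aff_coroot j)) = 0" for j
      by (simp add: aff_coroot_def split: option.split)
    then show ?thesis
      by (intro exI[of _ 1]) (simp add: 5 cst_one twist_diff twist_mult twist_Kg twist_zero)
  next
    case (6 j l n)
    show ?thesis
      by (intro exI[of _ 1]) (simp add: 6 cst_one twist_sum twist_mult twist_divpow neg)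
  next
    case (7 j l n)
    show ?thesis
      by (intro exI[of _ 1]) (simp add: 7 cst_one twist_sum twist_mult twist_divpow neg)
  qed
qed

lemma twist_U_ideal: "a \<in> U_ideal \<Longrightarrow> twist k a \<in> U_ideal"
proof -
  let ?J = "{a. twist k a \<in> U_ideal}"
  have "two_sided_ideal ?J"
    using U_ideal_left U_ideal_right
    by (simp add: two_sided_ideal_def left_ideal_def twist_zero twist_add twist_mult)
  moreover have "U_relations \<subseteq> ?J"
    using twist_U_relations[of _ k] left_ideal_mult[OF U_ideal_left] U_relations_subset by fastforce
  moreover assume "a \<in> U_ideal"
  ultimately show ?thesis using U_ideal_least[of ?J a] by simp
qed

definition module_ideal :: "'i free_alg set \<Rightarrow> bool" where
  "module_ideal L \<longleftrightarrow> left_ideal L \<and> U_ideal \<subseteq> L"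

lemma module_ideal_left [simp]: "module_ideal L \<Longrightarrow> left_ideal L"
  by (simp add: module_ideal_def)

text \<open>The operator that carries \<open>v\<^sub>x\<close> to \<open>v\<^bsub>s\<^sub>j x\<^esub>\<close> when \<open>n = \<langle>x\<beta>, \<alpha>\<^sub>j\<^sup>\<or>\<rangle>\<close>.\<close>

definition ext_step :: "'i option \<Rightarrow> int \<Rightarrow> 'i free_alg" where
  "ext_step j n = (if n \<ge> 0 then divpow (Fg j) (nat n) else divpow (Eg j) (nat (- n)))"

lemma twist_ext_step [simp]: "twist k (ext_step j n) = ext_step j n"
  by (simp add: ext_step_def twist_divpow)

lemma extremal_family_step:
  assumes "extremal_family L \<beta> a f" "x \<in> W_aff"
  shows "ext_step j (aff_pairing (aff_act x \<beta>) (aff_coroot j)) * f x - f (aff_mult (aff_simple_refl j) x) \<in> L"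
  using assms unfolding extremal_family_def ext_step_def Let_def by (cases "aff_pairing (aff_act x \<beta>) (aff_coroot j) \<ge> 0") auto

lemma extremal_family_cong:
  assumes L: "left_ideal L" and f: "extremal_family L \<beta> a f"
    and h: "\<And>x. x \<in> W_aff \<Longrightarrow> f x - h x \<in> L" "h (id, 0) = a"
  shows "extremal_family L \<beta> a h"
proof -
  have mult: "c * f x \<in> L \<longleftrightarrow> c * h x \<in> L" if "x \<in> W_aff" for c x
    using left_ideal_cong[OF L, of "c * f x" "c * h x"] left_ideal_mult[OF L h(1)[OF that], of c]
    by (simp add: right_diff_distrib)
  have diff: "c * f x - f y \<in> L \<longleftrightarrow> c * h x - h y \<in> L" if "x \<in> W_aff" "y \<in> W_aff" for c x y
    using left_ideal_cong[OF L, of "c * f x - f y" "c * h x - h y"]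
      left_ideal_diff[OF L left_ideal_mult[OF L h(1)[OF that(1)], of c] h(1)[OF that(2)]]
    by (simp add: algebra_simps)
  show ?thesis
    using f h(2) unfolding extremal_family_def Let_def by (simp add: mult diff)
qed

lemma V_ideal_module: "module_ideal (V_ideal \<mu>)"
  unfolding module_ideal_def V_ideal_def left_ideal_def by blast

lemma V_ideal_left [simp]: "left_ideal (V_ideal \<mu>)"
  by (simp add: V_ideal_module)

lemma V_ideal_least:
  "module_ideal L \<Longrightarrow> extremal_family L (\<mu>, 0) 1 f \<Longrightarrow> V_ideal \<mu> \<subseteq> L"
  unfolding module_ideal_def V_ideal_def by blast

text \<open>Since every element of the affine Weyl group is a product of simple reflections, the extremal
  vectors are prescribed by words in divided powers that do not depend on the module. The same
  lifts therefore work for all the ideals whose intersection is \<open>V_ideal \<mu>\<close>.\<close>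

lemma ext_vec_family: "extremal_family (V_ideal \<mu>) (\<mu>, 0) 1 (ext_vec \<mu>)"
proof -
  define I where "I = {L. module_ideal L \<and> (\<exists>f. extremal_family L (\<mu>, 0) 1 f)}"
  have "\<exists>g. \<forall>L\<in>I. \<forall>f. extremal_family L (\<mu>, 0) 1 f \<longrightarrow> f x - g \<in> L" if "x \<in> W_aff" for x
    using that
  proof (induction rule: W_aff_induct)
    case one
    show ?case
      by (intro exI[of _ 1]) (auto simp: I_def extremal_family_def left_ideal_zero)
  next
    case (mult x j)
    let ?c = "ext_step j (aff_pairing (aff_act x (\<mu>, 0)) (aff_coroot j))"
    obtain g where g: "\<And>L f. L \<in> I \<Longrightarrow> extremal_family L (\<mu>, 0) 1 f \<Longrightarrow> f x - g \<in> L"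
      using mult by blast
    have "f (aff_mult (aff_simple_refl j) x) - ?c * g \<in> L"
      if L: "L \<in> I" and f: "extremal_family L (\<mu>, 0) 1 f" for L f
    proof -
      have left: "left_ideal L" using L by (simp add: I_def)
      have "?c * (f x - g) - (?c * f x - f (aff_mult (aff_simple_refl j) x)) \<in> L"
        by (intro left_ideal_diff[OF left] left_ideal_mult[OF left] g[OF L f] extremal_family_step[OF f mult(1)])
      then show ?thesis by (simp add: algebra_simps)
    qed
    then show ?case by blast
  qed
  then obtain g where g: "\<And>x L f. x \<in> W_aff \<Longrightarrow> L \<in> I \<Longrightarrow> extremal_family L (\<mu>, 0) 1 f \<Longrightarrow> f x - g x \<in> L"
    by metis
  define h where "h = (\<lambda>x. if x = (id, 0) then 1 else g x)"
  have h: "extremal_family L (\<mu>, 0) 1 h" if L: "L \<in> I" for L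
  proof -
    obtain f where f: "extremal_family L (\<mu>, 0) 1 f" using L by (auto simp: I_def)
    have left: "left_ideal L" using L by (simp add: I_def)
    show ?thesis
    proof (rule extremal_family_cong[OF left f])
      fix x assume "x \<in> W_aff"
      then show "f x - h x \<in> L"
        using g[OF _ L f] f left_ideal_zero[OF left] by (auto simp: h_def extremal_family_def)
    qed (simp add: h_def)
  qed
  have "V_ideal \<mu> = \<Inter>I" by (auto simp: V_ideal_def I_def module_ideal_def)
  then have "extremal_family (V_ideal \<mu>) (\<mu>, 0) 1 h"
    using h unfolding extremal_family_def has_weight_def Let_def by (simp add: h_def)
  then show ?thesis unfolding ext_vec_def by (rule someI[where P = "extremal_family (V_ideal \<mu>) (\<mu>, 0) 1"])
qed

lemma ext_vec_one: "ext_vec \<mu> (id, 0) = 1"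
  using ext_vec_family by (simp add: extremal_family_def)

lemma has_weightD: "has_weight L \<beta> a \<Longrightarrow> Kg h * a - cst (qv powi aff_pairing \<beta> h) * a \<in> L"
  unfolding has_weight_def by (rule spec)

lemma has_weight_cong:
  assumes L: "left_ideal L" and ab: "a - b \<in> L" and a: "has_weight L \<beta> a"
  shows "has_weight L \<beta> b"
  unfolding has_weight_def
proof
  fix h
  let ?c = "cst (qv powi aff_pairing \<beta> h)"
  have "Kg h * a - ?c * a \<in> L" using a by (rule has_weightD)
  moreover have "Kg h * (a - b) - ?c * (a - b) \<in> L"
    by (intro left_ideal_diff[OF L] left_ideal_mult[OF L] ab)
  ultimately have "(Kg h * a - ?c * a) - (Kg h * (a - b) - ?c * (a - b)) \<in> L" by (rule left_ideal_diff[OF L])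
  then show "Kg h * b - ?c * b \<in> L" by (simp add: algebra_simps)
qed

text \<open>With \<open>X = E\<^sub>j\<close>, \<open>\<gamma> = \<alpha>\<^sub>j\<close> and \<open>X = F\<^sub>j\<close>, \<open>\<gamma> = -\<alpha>\<^sub>j\<close> this follows the weights of extremal vectors along
  divided powers.\<close>

lemma has_weight_power:
  assumes L: "module_ideal L" and a: "has_weight L \<beta> a"
    and X: "\<And>h. Kg h * X - cst (qv powi aff_pairing \<gamma> h) * X * Kg h \<in> U_ideal"
  shows "has_weight L (fst \<beta> + int n *s fst \<gamma>, snd \<beta> + int n * snd \<gamma>) (X ^ n * a)"
proof (induction n)
  case 0
  have "int 0 *s fst \<gamma> = 0" by (simp add: vec_eq_iff)
  then show ?case using a by simp
next
  case (Suc n)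
  have left: "left_ideal L" using L by simp
  let ?\<beta> = "\<lambda>n. (fst \<beta> + int n *s fst \<gamma>, snd \<beta> + int n * snd \<gamma>)"
  show ?case
    unfolding has_weight_def
  proof
    fix h
    let ?b = "X ^ n * a" and ?c = "qv powi aff_pairing \<gamma> h" and ?d = "qv powi aff_pairing (?\<beta> n) h"
    have "aff_pairing (?\<beta> (Suc n)) h = aff_pairing \<gamma> h + aff_pairing (?\<beta> n) h"
      by (simp add: aff_pairing_def pairing_linear algebra_simps)
    then have cd: "qv powi aff_pairing (?\<beta> (Suc n)) h = ?c * ?d" by (simp add: power_int_add)
    have "(Kg h * X - cst ?c * X * Kg h) * ?b \<in> L"
      using U_ideal_right[OF X] L unfolding module_ideal_def by blast
    moreover have "cst ?c * X * (Kg h * ?b - cst ?d * ?b) \<in> L"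
      by (intro left_ideal_mult[OF left] has_weightD Suc)
    ultimately have "(Kg h * X - cst ?c * X * Kg h) * ?b + cst ?c * X * (Kg h * ?b - cst ?d * ?b) \<in> L"
      by (rule left_ideal_add[OF left])
    also have "(Kg h * X - cst ?c * X * Kg h) * ?b + cst ?c * X * (Kg h * ?b - cst ?d * ?b) =
        Kg h * (X ^ Suc n * a) - cst (qv powi aff_pairing (?\<beta> (Suc n)) h) * (X ^ Suc n * a)"
      unfolding cd power_Suc by (simp add: algebra_simps cst_left_commute[of X] cst_left_commute_cst)
    finally show "Kg h * (X ^ Suc n * a) - cst (qv powi aff_pairing (?\<beta> (Suc n)) h) * (X ^ Suc n * a) \<in> L" .
  qed
qed

lemma has_weight_cst:
  assumes "left_ideal L" "has_weight L \<beta> a" shows "has_weight L \<beta> (cst c * a)"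
  unfolding has_weight_def
proof
  fix h
  show "Kg h * (cst c * a) - cst (qv powi aff_pairing \<beta> h) * (cst c * a) \<in> L"
    using left_ideal_mult[OF assms(1) has_weightD[OF assms(2)], of "cst c" h]
    by (simp add: cst_left_commute[of "Kg h"] cst_left_commute_cst right_diff_distrib mult.commute)
qed

lemma extremal_family_weight:
  assumes L: "module_ideal L" and f: "extremal_family L \<beta> a f" and x: "x \<in> W_aff"
  shows "has_weight L (aff_act x \<beta>) (f x)"
  using x
proof (induction rule: W_aff_induct)
  case one
  have "aff_act (id, 0) \<beta> = \<beta>" by (simp add: aff_act_def pairing_linear)
  then show ?case using f unfolding extremal_family_def by metis
next
  case (mult x j)
  let ?n = "aff_pairing (aff_act x \<beta>) (aff_coroot j)"
  let ?y = "aff_mult (aff_simple_refl j) x"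
  have left: "left_ideal L" using L by simp
  have y: "aff_act ?y \<beta> = (fst (aff_act x \<beta>) - ?n *s fst (aff_root j), snd (aff_act x \<beta>) - ?n * snd (aff_root j))"
    using mult(1) by (simp add: aff_act_mult aff_act_simple_refl Let_def)
  have F: "has_weight L (fst \<gamma> + int n *s - fst (aff_root j), snd \<gamma> + int n * - snd (aff_root j)) (divpow (Fg j) n * b)"
    if "has_weight L \<gamma> b" for \<gamma> b n
  proof -
    have "aff_pairing (- fst (aff_root j), - snd (aff_root j)) h = - aff_pairing (aff_root j) h" for h
      by (simp add: aff_pairing_def pairing_linear)
    then have "has_weight L (fst \<gamma> + int n *s - fst (aff_root j), snd \<gamma> + int n * - snd (aff_root j)) (Fg j ^ n * b)"
      using has_weight_power[OF L that, where X = "Fg j" and \<gamma> = "(- fst (aff_root j), - snd (aff_root j))" and n = n]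
        Kg_Fg by simp
    from has_weight_cst[OF left this] show ?thesis by (simp add: divpow_def mult.assoc)
  qed
  have E: "has_weight L (fst \<gamma> + int n *s fst (aff_root j), snd \<gamma> + int n * snd (aff_root j)) (divpow (Eg j) n * b)"
    if "has_weight L \<gamma> b" for \<gamma> b n
    using has_weight_cst[OF left has_weight_power[OF L that, where X = "Eg j" and \<gamma> = "aff_root j" and n = n, OF Kg_Eg]]
    by (simp add: divpow_def mult.assoc)
  have "has_weight L (aff_act ?y \<beta>) (ext_step j ?n * f x)"
  proof (cases "?n \<ge> 0")
    case True
    then have "aff_act ?y \<beta> = (fst (aff_act x \<beta>) + int (nat ?n) *s - fst (aff_root j),
        snd (aff_act x \<beta>) + int (nat ?n) * - snd (aff_root j))"
      unfolding y by (simp add: vec_eq_iff)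
    then show ?thesis using F[OF mult(2), of "nat ?n"] True by (simp add: ext_step_def)
  next
    case False
    then have "aff_act ?y \<beta> = (fst (aff_act x \<beta>) + int (nat (- ?n)) *s fst (aff_root j),
        snd (aff_act x \<beta>) + int (nat (- ?n)) * snd (aff_root j))"
      unfolding y by (simp add: vec_eq_iff)
    then show ?thesis using E[OF mult(2), of "nat (- ?n)"] False by (simp add: ext_step_def)
  qed
  then show ?case
    by (rule has_weight_cong[OF left extremal_family_step[OF f mult(1)]])
qed

section \<open>Translation symmetry of extremal weight modules\<close>

text \<open>The map \<open>v\<^sub>\<mu> \<mapsto> v\<^bsub>t\<^sub>\<zeta>\<^esub>\<close> of the module \<open>V(\<mu>)\<close>, twisted so that it is compatible with the degree operator.\<close>

definition translate :: "'i weight \<Rightarrow> 'i coweight \<Rightarrow> 'i free_alg \<Rightarrow> 'i free_alg" where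
  "translate \<mu> \<zeta> a = twist (pairing \<mu> \<zeta>) a * ext_vec \<mu> (id, \<zeta>)"

lemma translate_linear:
  "translate \<mu> \<zeta> (a + b) = translate \<mu> \<zeta> a + translate \<mu> \<zeta> b"
  "translate \<mu> \<zeta> (a - b) = translate \<mu> \<zeta> a - translate \<mu> \<zeta> b"
  "translate \<mu> \<zeta> (c * a) = twist (pairing \<mu> \<zeta>) c * translate \<mu> \<zeta> a"
  by (simp_all add: translate_def twist_add twist_diff twist_mult algebra_simps)

lemma translation_in_W_aff [simp]: "(id, \<zeta>) \<in> W_aff"
  by (simp add: W_aff_iff)

lemma aff_act_translation: "aff_act (id, \<zeta>) (\<mu>, 0) = (\<mu>, - pairing \<mu> \<zeta>)"
  by (simp add: aff_act_def)

lemma aff_pairing_translation: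
  "x \<in> W_aff \<Longrightarrow> aff_pairing (aff_act (aff_mult x (id, \<zeta>)) (\<mu>, 0)) (aff_coroot j) =
    aff_pairing (aff_act x (\<mu>, 0)) (aff_coroot j)"
  by (simp add: aff_act_mult aff_act_translation)
     (simp add: aff_pairing_def aff_act_def aff_coroot_def split: option.split)

lemma aff_mult_translation_assoc:
  "x \<in> W_aff \<Longrightarrow> aff_mult (aff_simple_refl j) (aff_mult x (id, \<zeta>)) = aff_mult (aff_mult (aff_simple_refl j) x) (id, \<zeta>)"
  by (simp add: aff_mult_assoc)

text \<open>By the universal property of \<open>V(\<mu>)\<close> it suffices that \<open>v\<^bsub>t\<^sub>\<zeta>\<^esub>\<close>, with the vectors \<open>v\<^bsub>x t\<^sub>\<zeta>\<^esub>\<close>, is again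
  extremal, of a weight that the twist corrects to \<open>\<mu>\<close>.\<close>

lemma translate_V_ideal:
  assumes "a \<in> V_ideal \<mu>" shows "translate \<mu> \<zeta> a \<in> V_ideal \<mu>"
proof -
  let ?V = "V_ideal \<mu>" and ?f = "ext_vec \<mu>" and ?k = "pairing \<mu> \<zeta>"
  define L where "L = {a. translate \<mu> \<zeta> a \<in> ?V}"
  note V = V_ideal_left[of \<mu>]
  have zero: "translate \<mu> \<zeta> 0 = 0" by (simp add: translate_def twist_zero)
  have "left_ideal L"
    unfolding L_def left_ideal_def
    by (simp add: translate_linear zero left_ideal_zero[OF V] left_ideal_add[OF V] left_ideal_mult[OF V])
  moreover have "U_ideal \<subseteq> L"
    using twist_U_ideal U_ideal_right V_ideal_module[of \<mu>] by (auto simp: L_def translate_def module_ideal_def)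
  ultimately have L: "module_ideal L" by (simp add: module_ideal_def)
  have "\<exists>g. translate \<mu> \<zeta> g - ?f (aff_mult x (id, \<zeta>)) \<in> ?V" if "x \<in> W_aff" for x
    using that
  proof (induction rule: W_aff_induct)
    case one
    have "translate \<mu> \<zeta> 1 - ?f (aff_mult (id, 0) (id, \<zeta>)) \<in> ?V"
      by (simp add: translate_def left_ideal_zero)
    then show ?case by blast
  next
    case (mult x j)
    let ?c = "ext_step j (aff_pairing (aff_act x (\<mu>, 0)) (aff_coroot j))"
    let ?y = "aff_mult (aff_mult (aff_simple_refl j) x) (id, \<zeta>)"
    obtain g where "translate \<mu> \<zeta> g - ?f (aff_mult x (id, \<zeta>)) \<in> ?V" using mult by blast
    then have "?c * (translate \<mu> \<zeta> g - ?f (aff_mult x (id, \<zeta>))) \<in> ?V" by (rule left_ideal_mult[OF V])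
    moreover have "?c * ?f (aff_mult x (id, \<zeta>)) - ?f ?y \<in> ?V"
      using extremal_family_step[OF ext_vec_family, of "aff_mult x (id, \<zeta>)" j \<mu>] mult(1)
      by (simp add: aff_pairing_translation aff_mult_translation_assoc)
    ultimately have "?c * (translate \<mu> \<zeta> g - ?f (aff_mult x (id, \<zeta>))) + (?c * ?f (aff_mult x (id, \<zeta>)) - ?f ?y) \<in> ?V"
      by (rule left_ideal_add[OF V])
    then have "translate \<mu> \<zeta> (?c * g) - ?f ?y \<in> ?V"
      by (simp add: translate_linear algebra_simps)
    then show ?case by blast
  qed
  then obtain g where g: "\<And>x. x \<in> W_aff \<Longrightarrow> translate \<mu> \<zeta> (g x) - ?f (aff_mult x (id, \<zeta>)) \<in> ?V" by metis
  define h where "h = (\<lambda>x. if x = (id, 0) then 1 else g x)"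
  have h: "translate \<mu> \<zeta> (h x) - ?f (aff_mult x (id, \<zeta>)) \<in> ?V" if "x \<in> W_aff" for x
    using g[OF that] by (simp add: h_def translate_def left_ideal_zero)
  have mult: "c * h x \<in> L \<longleftrightarrow> c * ?f (aff_mult x (id, \<zeta>)) \<in> ?V"
    if "x \<in> W_aff" "twist ?k c = c" for c x
    using left_ideal_cong[OF V, of "c * translate \<mu> \<zeta> (h x)" "c * ?f (aff_mult x (id, \<zeta>))"]
      left_ideal_mult[OF V h[OF that(1)], of c] that(2)
    by (simp add: right_diff_distrib L_def translate_linear)
  have diff: "c * h x - h y \<in> L \<longleftrightarrow> c * ?f (aff_mult x (id, \<zeta>)) - ?f (aff_mult y (id, \<zeta>)) \<in> ?V"
    if "x \<in> W_aff" "y \<in> W_aff" "twist ?k c = c" for c x y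
    using left_ideal_cong[OF V, of "c * translate \<mu> \<zeta> (h x) - translate \<mu> \<zeta> (h y)"
        "c * ?f (aff_mult x (id, \<zeta>)) - ?f (aff_mult y (id, \<zeta>))"]
      left_ideal_diff[OF V left_ideal_mult[OF V h[OF that(1)], of c] h[OF that(2)]] that(3)
    by (simp add: algebra_simps L_def translate_linear)
  have "has_weight L (\<mu>, 0) 1"
    unfolding has_weight_def
  proof
    fix h :: "'i aff_coweight"
    let ?c = "qv powi aff_pairing (\<mu>, 0) h" and ?t = "qv powi (?k * snd (snd h))"
    have "has_weight ?V (\<mu>, - ?k) (?f (id, \<zeta>))"
      using extremal_family_weight[OF V_ideal_module ext_vec_family translation_in_W_aff]
      by (simp add: aff_act_translation)
    then have "cst ?t * (Kg h * ?f (id, \<zeta>) - cst (qv powi aff_pairing (\<mu>, - ?k) h) * ?f (id, \<zeta>)) \<in> ?V"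
      by (intro left_ideal_mult[OF V] has_weightD)
    moreover have "?c = ?t * qv powi aff_pairing (\<mu>, - ?k) h"
      by (simp add: aff_pairing_def flip: power_int_add)
    ultimately show "Kg h * 1 - cst ?c * 1 \<in> L"
      by (simp add: L_def translate_def twist_diff twist_Kg twist_mult algebra_simps flip: cst_mult)
  qed
  moreover have "h (id, 0) = 1" by (simp add: h_def)
  ultimately have "extremal_family L (\<mu>, 0) 1 h"
    unfolding extremal_family_def
  proof (intro conjI ballI allI)
    fix x :: "'i aff_weyl" and j assume x: "x \<in> W_aff"
    let ?x = "aff_mult x (id, \<zeta>)"
    have fam: "\<forall>x\<in>W_aff. \<forall>j. let n = aff_pairing (aff_act x (\<mu>, 0)) (aff_coroot j);
           y = aff_mult (aff_simple_refl j) x in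
        (n \<ge> 0 \<longrightarrow> Eg j * ?f x \<in> ?V \<and> divpow (Fg j) (nat n) * ?f x - ?f y \<in> ?V) \<and>
        (n \<le> 0 \<longrightarrow> Fg j * ?f x \<in> ?V \<and> divpow (Eg j) (nat (- n)) * ?f x - ?f y \<in> ?V)"
      using ext_vec_family[of \<mu>] unfolding extremal_family_def by (elim conjE)
    have "?x \<in> W_aff" using x by simp
    then show "let n = aff_pairing (aff_act x (\<mu>, 0)) (aff_coroot j);
           y = aff_mult (aff_simple_refl j) x in
        (n \<ge> 0 \<longrightarrow> Eg j * h x \<in> L \<and> divpow (Fg j) (nat n) * h x - h y \<in> L) \<and>
        (n \<le> 0 \<longrightarrow> Fg j * h x \<in> L \<and> divpow (Eg j) (nat (- n)) * h x - h y \<in> L)"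
      using bspec[OF fam \<open>?x \<in> W_aff\<close>, THEN spec[of _ j]]
        aff_pairing_translation[OF x, of \<zeta> \<mu> j] aff_mult_translation_assoc[OF x, of j \<zeta>]
        mult[OF x] diff[OF x, of "aff_mult (aff_simple_refl j) x"] x
      unfolding Let_def by (simp add: twist_divpow)
  qed
  then have "?V \<subseteq> L" by (rule V_ideal_least[OF L])
  then show ?thesis using assms by (auto simp: L_def)
qed

text \<open>Both families arise from the same divided powers, starting from \<open>v\<^bsub>t\<^sub>\<zeta>\<^esub>\<close>.\<close>

lemma translate_ext_vec:
  assumes "x \<in> W_aff"
  shows "translate \<mu> \<zeta> (ext_vec \<mu> x) - ext_vec \<mu> (aff_mult x (id, \<zeta>)) \<in> V_ideal \<mu>"
  using assms
proof (induction rule: W_aff_induct)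
  case one
  have "translate \<mu> \<zeta> (ext_vec \<mu> (id, 0)) - ext_vec \<mu> (aff_mult (id, 0) (id, \<zeta>)) \<in> V_ideal \<mu>"
    by (simp add: translate_def ext_vec_one left_ideal_zero)
  then show ?case .
next
  case (mult x j)
  let ?c = "ext_step j (aff_pairing (aff_act x (\<mu>, 0)) (aff_coroot j))"
  let ?f = "ext_vec \<mu>" and ?y = "aff_mult (aff_simple_refl j) x"
  note V = V_ideal_left[of \<mu>]
  have 1: "translate \<mu> \<zeta> (?c * ?f x - ?f ?y) \<in> V_ideal \<mu>"
    by (intro translate_V_ideal extremal_family_step[OF ext_vec_family mult(1)])
  have 2: "?c * (translate \<mu> \<zeta> (?f x) - ?f (aff_mult x (id, \<zeta>))) \<in> V_ideal \<mu>"
    by (intro left_ideal_mult[OF V] mult)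
  have 3: "?c * ?f (aff_mult x (id, \<zeta>)) - ?f (aff_mult ?y (id, \<zeta>)) \<in> V_ideal \<mu>"
    using extremal_family_step[OF ext_vec_family, of "aff_mult x (id, \<zeta>)" j \<mu>] mult(1)
    by (simp add: aff_pairing_translation aff_mult_translation_assoc)
  have "?c * (translate \<mu> \<zeta> (?f x) - ?f (aff_mult x (id, \<zeta>)))
      + (?c * ?f (aff_mult x (id, \<zeta>)) - ?f (aff_mult ?y (id, \<zeta>)))
      - translate \<mu> \<zeta> (?c * ?f x - ?f ?y) \<in> V_ideal \<mu>"
    by (rule left_ideal_diff[OF V left_ideal_add[OF V 2 3] 1])
  then have "translate \<mu> \<zeta> (?f ?y) - ?f (aff_mult ?y (id, \<zeta>)) \<in> V_ideal \<mu>"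
    by (simp add: translate_linear algebra_simps)
  then show ?case .
qed

text \<open>The translation by \<open>-\<zeta>\<close> is an inverse modulo \<open>V_ideal \<mu>\<close>.\<close>

lemma translate_inject:
  assumes "translate \<mu> \<zeta> a \<in> V_ideal \<mu>" shows "a \<in> V_ideal \<mu>"
proof -
  note V = V_ideal_left[of \<mu>]
  have "translate \<mu> (- \<zeta>) (translate \<mu> \<zeta> a) \<in> V_ideal \<mu>" using assms by (rule translate_V_ideal)
  moreover have "translate \<mu> (- \<zeta>) (translate \<mu> \<zeta> a) = a * translate \<mu> (- \<zeta>) (ext_vec \<mu> (id, \<zeta>))"
    by (simp add: translate_def twist_mult twist_twist pairing_linear mult.assoc)
  moreover have "a * (translate \<mu> (- \<zeta>) (ext_vec \<mu> (id, \<zeta>)) - ext_vec \<mu> (id, 0)) \<in> V_ideal \<mu>"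
    using translate_ext_vec[of "(id, \<zeta>)" \<mu> "- \<zeta>"]
    by (intro left_ideal_mult[OF V]) (simp add: aff_mult_translation)
  ultimately show ?thesis
    using left_ideal_cong[OF V, of "a * translate \<mu> (- \<zeta>) (ext_vec \<mu> (id, \<zeta>))" a]
    by (simp add: ext_vec_one right_diff_distrib)
qed

lemma translate_weight:
  assumes "has_weight (V_ideal \<mu>) \<beta> a"
  shows "has_weight (V_ideal \<mu>) (\<beta> - (0, pairing \<mu> \<zeta>)) (translate \<mu> \<zeta> a)"
  unfolding has_weight_def
proof
  fix h :: "'i aff_coweight"
  let ?k = "pairing \<mu> \<zeta>"
  let ?t = "qv powi (?k * snd (snd h))"
  let ?c = "qv powi aff_pairing \<beta> h" and ?d = "qv powi aff_pairing (\<beta> - (0, ?k)) h"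
  have c: "?c = ?t * ?d"
    by (simp add: aff_pairing_def algebra_simps flip: power_int_add)
  have t: "inverse ?t * ?t = 1" by (simp add: power_int_not_zero)
  have "translate \<mu> \<zeta> (Kg h * a - cst ?c * a) \<in> V_ideal \<mu>"
    by (intro translate_V_ideal has_weightD assms)
  then have "cst (inverse ?t) * translate \<mu> \<zeta> (Kg h * a - cst ?c * a) \<in> V_ideal \<mu>"
    by (rule left_ideal_mult[OF V_ideal_left])
  also have "translate \<mu> \<zeta> (Kg h * a - cst ?c * a) = cst ?t * (Kg h * translate \<mu> \<zeta> a - cst ?d * translate \<mu> \<zeta> a)"
    by (simp add: translate_linear twist_Kg c algebra_simps flip: cst_mult)
  also have "cst (inverse ?t) * \<dots> = Kg h * translate \<mu> \<zeta> a - cst ?d * translate \<mu> \<zeta> a"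
    using t by (simp add: cst_mult cst_one flip: mult.assoc)
  finally show "Kg h * translate \<mu> \<zeta> a - cst ?d * translate \<mu> \<zeta> a \<in> V_ideal \<mu>" .
qed

text \<open>The map \<open>translate\<close> carries the Demazure module of \<open>x\<close> into that of \<open>x t\<^sub>\<zeta>\<close>, because the twist
  preserves the subalgebra of the \<open>F\<^sub>j\<close>, and shifts weights by \<open>-\<langle>\<mu>, \<zeta>\<rangle>\<delta>\<close>. Only one inclusion
  needs a proof: the other one is the same statement for \<open>x t\<^sub>\<zeta>\<close> and \<open>-\<zeta>\<close>.\<close>

lemma independent_cards_translate:
  assumes x: "x \<in> W_aff"
  shows "{card B |B. B \<subseteq> {a \<in> Demazure x \<mu>. has_weight (V_ideal \<mu>) \<beta> a} \<and> independent_mod (V_ideal \<mu>) B}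
    \<subseteq> {card B |B. B \<subseteq> {a \<in> Demazure (aff_mult x (id, \<zeta>)) \<mu>.
          has_weight (V_ideal \<mu>) (\<beta> - (0, pairing \<mu> \<zeta>)) a} \<and> independent_mod (V_ideal \<mu>) B}"
    (is "?L \<subseteq> ?R")
proof
  fix n assume "n \<in> ?L"
  then obtain B where n: "n = card B" and B: "\<And>b. b \<in> B \<Longrightarrow> b \<in> Demazure x \<mu>"
    and w: "\<And>b. b \<in> B \<Longrightarrow> has_weight (V_ideal \<mu>) \<beta> b" and ind: "independent_mod (V_ideal \<mu>) B"
    by blast
  let ?V = "V_ideal \<mu>" and ?y = "aff_mult x (id, \<zeta>)"
  note V = V_ideal_left[of \<mu>]
  have "\<exists>c. c \<in> Demazure ?y \<mu> \<and> translate \<mu> \<zeta> b - c \<in> ?V" if b: "b \<in> B" for b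
  proof -
    obtain a where a: "a \<in> F_subalgebra" "b = a * ext_vec \<mu> x" using B[OF b] by (auto simp: Demazure_def)
    let ?a = "twist (pairing \<mu> \<zeta>) a"
    have "?a * (translate \<mu> \<zeta> (ext_vec \<mu> x) - ext_vec \<mu> ?y) \<in> ?V"
      by (intro left_ideal_mult[OF V] translate_ext_vec x)
    then have "translate \<mu> \<zeta> b - ?a * ext_vec \<mu> ?y \<in> ?V"
      by (simp add: a translate_linear right_diff_distrib)
    moreover have "?a * ext_vec \<mu> ?y \<in> Demazure ?y \<mu>"
      using twist_F_subalgebra[OF a(1)] by (auto simp: Demazure_def)
    ultimately show ?thesis by blast
  qed
  then obtain h where h: "\<And>b. b \<in> B \<Longrightarrow> h b \<in> Demazure ?y \<mu>"
    and hV: "\<And>b. b \<in> B \<Longrightarrow> translate \<mu> \<zeta> b - h b \<in> ?V" by metis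
  have "has_weight ?V (\<beta> - (0, pairing \<mu> \<zeta>)) (h b)" if "b \<in> B" for b
    using has_weight_cong[OF V hV[OF that] translate_weight[OF w[OF that]]] .
  then have "h ` B \<subseteq> {a \<in> Demazure ?y \<mu>. has_weight ?V (\<beta> - (0, pairing \<mu> \<zeta>)) a}"
    using h by blast
  moreover have "independent_mod ?V (h ` B) \<and> card (h ` B) = card B"
  proof (rule independent_mod_image[OF V V _ _ _ _ ind, of "translate \<mu> \<zeta>"])
    show "h b - translate \<mu> \<zeta> b \<in> ?V" if "b \<in> B" for b
      using left_ideal_minus[OF V hV[OF that]] by simp
  qed (use translate_inject in \<open>auto simp: translate_linear\<close>)
  ultimately show "n \<in> ?R" unfolding n by (intro CollectI exI[of _ "h ` B"]) simp
qed

lemma gch_translation: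
  assumes x: "x \<in> W_aff"
  shows "gch (aff_mult x (id, \<zeta>)) \<mu> (\<beta> - (0, pairing \<mu> \<zeta>)) = gch x \<mu> \<beta>"
proof -
  let ?C = "\<lambda>x \<beta>. {card B |B. B \<subseteq> {a \<in> Demazure x \<mu>. has_weight (V_ideal \<mu>) \<beta> a} \<and> independent_mod (V_ideal \<mu>) B}"
  let ?y = "aff_mult x (id, \<zeta>)" and ?\<gamma> = "\<beta> - (0, pairing \<mu> \<zeta>)"
  have "aff_mult ?y (id, - \<zeta>) = x"
    by (cases x) (simp add: aff_mult_translation)
  moreover have "?\<gamma> - (0, pairing \<mu> (- \<zeta>)) = \<beta>"
    by (cases \<beta>) (simp add: pairing_linear)
  moreover have "?y \<in> W_aff" using x by simp
  ultimately have "?C ?y ?\<gamma> \<subseteq> ?C x \<beta>"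
    using independent_cards_translate[of ?y \<mu> ?\<gamma> "- \<zeta>"] by (simp only:)
  then have "?C ?y ?\<gamma> = ?C x \<beta>"
    using independent_cards_translate[OF x] by (rule subset_antisym)
  then show ?thesis unfolding gch_def dim_mod_def by (rule arg_cong[where f = "\<lambda>S. int (Sup S)"])
qed

text \<open>This is \<open>gch V\<^sup>-\<^bsub>x t\<^sub>\<zeta>\<^esub>(\<mu>) = q\<^bsup>-\<langle>\<mu>, \<zeta>\<rangle>\<^esup> gch V\<^sup>-\<^sub>x(\<mu>)\<close>, read off coefficientwise.\<close>

lemma gch_translate:
  assumes "w \<in> W"
  shows "gch (w, \<xi> + \<zeta>) \<mu> \<beta> = gch (w, \<xi>) \<mu> (\<beta> + (0, pairing \<mu> \<zeta>))"
  using gch_translation[of "(w, \<xi>)" \<zeta> \<mu> "\<beta> + (0, pairing \<mu> \<zeta>)"] assms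
  by (simp add: aff_mult_translation W_aff_iff)

end


section \<open>Alcoves\<close>

lemma pairing_real_linear:
  "pairing_real (x + y) \<xi> = pairing_real x \<xi> + pairing_real y \<xi>"
  "pairing_real (x - y) \<xi> = pairing_real x \<xi> - pairing_real y \<xi>"
  "pairing_real (c *\<^sub>R x) \<xi> = c * pairing_real x \<xi>"
  "pairing_real x (- \<xi>) = - pairing_real x \<xi>"
  by (simp_all add: pairing_real_def algebra_simps sum.distrib sum_subtractf sum_negf sum_distrib_left)

lemma pairing_real_weight: "pairing_real (real_weight \<nu>) \<xi> = of_int (pairing \<nu> \<xi>)"
  by (simp add: pairing_real_def real_weight_def pairing_def)

lemma real_weight_add: "real_weight (x + y) = real_weight x + real_weight y"
  by (simp add: real_weight_def vec_eq_iff)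

lemma continuous_pairing_real: "continuous_on S (\<lambda>x. pairing_real x \<xi>)"
  unfolding pairing_real_def by (intro continuous_intros)

lemma closed_pairing_le: "closed {x. pairing_real x \<xi> \<le> c}" "closed {x. c \<le> pairing_real x \<xi>}"
  by (intro closed_Collect_le continuous_pairing_real continuous_on_const)+

lemma convex_pairing_between: "convex {x. a < pairing_real x \<xi> \<and> pairing_real x \<xi> < b}"
proof -
  have lin: "linear (\<lambda>x. pairing_real x \<xi>)"
    by (rule linearI) (simp_all add: pairing_real_linear)
  have "{x. a < pairing_real x \<xi> \<and> pairing_real x \<xi> < b} = (\<lambda>x. pairing_real x \<xi>) -` {a<..<b}"
    by auto
  then show ?thesis using convex_linear_vimage[OF lin, of "{a<..<b}"] by simp
qed

context simply_laced
begin

abbreviation coord :: "real^'i \<Rightarrow> 'i weight \<Rightarrow> real" where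
  "coord x \<alpha> \<equiv> pairing_real x (coroot \<alpha>)"

definition regular :: "(real^'i) set" where
  "regular = UNIV - (\<Union>\<alpha>\<in>roots. \<Union>k. hyperplane \<alpha> k)"

text \<open>The points lying strictly between the same consecutive hyperplanes as \<open>x\<close>, for all roots. An
  alcove is recovered from any of its points as a cell, which reduces questions about alcoves to
  the integers \<open>\<lfloor>\<langle>x, \<alpha>\<^sup>\<or>\<rangle>\<rfloor>\<close>.\<close>

definition cell :: "real^'i \<Rightarrow> (real^'i) set" where
  "cell x = (\<Inter>\<alpha>\<in>roots. {y. of_int \<lfloor>coord x \<alpha>\<rfloor> < coord y \<alpha> \<and> coord y \<alpha> < of_int \<lfloor>coord x \<alpha>\<rfloor> + 1})"

lemma regular_iff: "x \<in> regular \<longleftrightarrow> (\<forall>\<alpha>\<in>roots. coord x \<alpha> \<notin> \<int>)"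
  by (auto simp: regular_def hyperplane_def Ints_def)

lemma in_cell_iff: "y \<in> cell x \<longleftrightarrow>
    (\<forall>\<alpha>\<in>roots. of_int \<lfloor>coord x \<alpha>\<rfloor> < coord y \<alpha> \<and> coord y \<alpha> < of_int \<lfloor>coord x \<alpha>\<rfloor> + 1)"
  by (simp add: cell_def)

lemma cell_floor: "y \<in> cell x \<Longrightarrow> \<alpha> \<in> roots \<Longrightarrow> \<lfloor>coord y \<alpha>\<rfloor> = \<lfloor>coord x \<alpha>\<rfloor>"
  by (auto simp: in_cell_iff intro!: floor_unique less_imp_le)

lemma regular_in_cell: "x \<in> regular \<Longrightarrow> x \<in> cell x"
  unfolding in_cell_iff regular_iff
  by (metis Ints_of_int floor_less_iff less_floor_iff of_int_floor_le order_le_less real_of_int_floor_add_one_gt)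

lemma cell_subset_regular: "cell x \<subseteq> regular"
proof
  fix y assume y: "y \<in> cell x"
  show "y \<in> regular"
    unfolding regular_iff
  proof (intro ballI notI)
    fix \<alpha> assume "\<alpha> \<in> roots" "coord y \<alpha> \<in> \<int>"
    then show False using y cell_floor[OF y] by (fastforce simp: in_cell_iff Ints_def)
  qed
qed

lemma cell_cong: "(\<And>\<alpha>. \<alpha> \<in> roots \<Longrightarrow> \<lfloor>coord x \<alpha>\<rfloor> = \<lfloor>coord y \<alpha>\<rfloor>) \<Longrightarrow> cell x = cell y"
  by (simp add: cell_def)

lemma connected_cell: "connected (cell x)"
  unfolding cell_def by (intro convex_connected convex_INT convex_pairing_between)

lemma alcove_eq_cell:
  assumes "X \<in> alcoves" "x \<in> X"
  shows "X = cell x" and "x \<in> regular"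
proof -
  have X: "X \<in> components regular" using assms(1) by (simp add: alcoves_def regular_def)
  then have sub: "X \<subseteq> regular" and conn: "connected X"
    by (auto dest: in_components_subset in_components_connected)
  then show x: "x \<in> regular" using assms(2) by blast
  have "cell x \<subseteq> X"
    using components_maximal[OF X connected_cell cell_subset_regular] regular_in_cell[OF x] assms(2) by blast
  moreover have "y \<in> cell x" if y: "y \<in> X" for y
    unfolding in_cell_iff
  proof
    fix \<alpha> assume a: "\<alpha> \<in> roots"
    let ?h = "\<lambda>z. coord z \<alpha>" and ?n = "\<lfloor>coord x \<alpha>\<rfloor>"
    have I: "is_interval (?h ` X)"
      using conn by (simp add: is_interval_connected_1 connected_continuous_image continuous_pairing_real)
    have int: "of_int n \<notin> ?h ` X" for n 
    proof
      assume "of_int n \<in> ?h ` X"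
      then obtain z where z: "z \<in> X" "?h z = of_int n" by auto
      then have "?h z \<notin> \<int>" using sub a regular_iff by blast
      then show False using z by simp
    qed
    have xn: "of_int ?n \<le> ?h x" "?h x < of_int ?n + 1" by linarith+
    have mem: "?h x \<in> ?h ` X" "?h y \<in> ?h ` X" using assms(2) y by auto
    have between: "c \<in> ?h ` X" if "?h x \<le> c \<and> c \<le> ?h y \<or> ?h y \<le> c \<and> c \<le> ?h x" for c
      using I mem that unfolding is_interval_1 by blast
    show "of_int ?n < ?h y \<and> ?h y < of_int ?n + 1"
      using between[of "of_int ?n"] between[of "of_int (?n + 1)"] int[of ?n] int[of "?n + 1"] xn
      by (metis less_eq_real_def linorder_not_le of_int_1 of_int_add)
  qed
  ultimately show "X = cell x" by blast
qed

lemma cell_is_alcove: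
  assumes "x \<in> regular" shows "cell x \<in> alcoves"
proof -
  have "\<Union>(components regular) = regular" by simp
  then obtain X where "X \<in> components regular" "x \<in> X" using assms by blast
  then have "X \<in> alcoves" by (simp add: alcoves_def regular_def)
  then show ?thesis using alcove_eq_cell(1)[OF _ \<open>x \<in> X\<close>] by simp
qed

lemma alcove_nonempty: "X \<in> alcoves \<Longrightarrow> \<exists>x. x \<in> X"
  unfolding alcoves_def using in_components_nonempty by blast

lemma closure_cell:
  assumes "\<alpha> \<in> roots" "y \<in> closure (cell x)"
  shows "of_int \<lfloor>coord x \<alpha>\<rfloor> \<le> coord y \<alpha>" "coord y \<alpha> \<le> of_int \<lfloor>coord x \<alpha>\<rfloor> + 1"
proof -
  let ?S = "{y. of_int \<lfloor>coord x \<alpha>\<rfloor> \<le> coord y \<alpha>} \<inter> {y. coord y \<alpha> \<le> of_int \<lfloor>coord x \<alpha>\<rfloor> + 1}"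
  have "closure (cell x) \<subseteq> ?S"
    using assms(1) by (intro closure_minimal closed_Int closed_pairing_le) (auto simp: in_cell_iff less_imp_le)
  then show "of_int \<lfloor>coord x \<alpha>\<rfloor> \<le> coord y \<alpha>" "coord y \<alpha> \<le> of_int \<lfloor>coord x \<alpha>\<rfloor> + 1"
    using assms(2) by auto
qed

lemma hyperplane_point: "\<alpha> \<in> roots \<Longrightarrow> (of_int k / 2) *\<^sub>R real_weight \<alpha> \<in> hyperplane \<alpha> k"
  by (simp add: hyperplane_def pairing_real_linear pairing_real_weight)

lemma affine_hyperplane: "affine (hyperplane \<alpha> k)"
  unfolding affine_def hyperplane_def
  by (auto simp: pairing_real_linear simp flip: distrib_right)

text \<open>The direction \<open>2\<beta> - \<langle>\<beta>, \<alpha>\<^sup>\<or>\<rangle>\<alpha>\<close> is parallel to every \<open>H\<^bsub>\<alpha>,k\<^esub>\<close>; it is parallel to \<open>H\<^bsub>\<beta>,j\<^esub>\<close> only if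
  \<open>\<langle>\<beta>, \<alpha>\<^sup>\<or>\<rangle>\<^sup>2 = 4\<close>.\<close>

lemma hyperplane_subset_imp:
  assumes a: "\<alpha> \<in> roots" and b: "\<beta> \<in> roots" and sub: "hyperplane \<alpha> k \<subseteq> hyperplane \<beta> j"
  shows "\<beta> = \<alpha> \<or> \<beta> = - \<alpha>"
proof -
  let ?u = "(of_int k / 2) *\<^sub>R real_weight \<alpha>" and ?c = "pairing \<beta> (coroot \<alpha>)"
  let ?d = "real_weight (2 *s \<beta> - ?c *s \<alpha>)"
  have u: "?u \<in> hyperplane \<alpha> k" using a by (rule hyperplane_point)
  moreover have "?u + ?d \<in> hyperplane \<alpha> k"
    using u a by (simp add: hyperplane_def pairing_real_linear pairing_real_weight pairing_linear)
  ultimately have "?u \<in> hyperplane \<beta> j" "?u + ?d \<in> hyperplane \<beta> j" using sub by auto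
  then have "coord ?d \<beta> = 0" by (simp add: hyperplane_def pairing_real_linear)
  then have "pairing (2 *s \<beta> - ?c *s \<alpha>) (coroot \<beta>) = 0" by (simp add: pairing_real_weight)
  then have "?c * ?c = 2 * 2"
    using a b by (simp add: pairing_linear pairing_roots_commute)
  then have "?c = 2 \<or> ?c = -2" unfolding square_eq_iff .
  then show ?thesis using roots_pairing_bound(2,3)[OF b a] by blast
qed

text \<open>Across the wall only the coordinates belonging to \<open>\<plusminus>\<alpha>\<close> change: if an integer separated the values
  of another coroot \<open>\<beta>\<^sup>\<or>\<close> on the two alcoves, the common face would lie in a hyperplane of \<open>\<beta>\<close>.\<close>

lemma crosses_floor:
  assumes c: "crosses X \<alpha> k Y" and x: "x \<in> X" and y: "y \<in> Y" and b: "\<beta> \<in> roots"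
  shows "\<lfloor>coord y \<beta>\<rfloor> = (if \<beta> = \<alpha> then k else if \<beta> = - \<alpha> then - k - 1 else \<lfloor>coord x \<beta>\<rfloor>)"
proof -
  let ?F = "closure X \<inter> closure Y"
  have X: "X = cell x" and Y: "Y = cell y" and a: "\<alpha> \<in> roots"
    and hull: "affine hull ?F = hyperplane \<alpha> k" and above: "of_int k < coord y \<alpha>"
    using c x y alcove_eq_cell(1) by (auto simp: crosses_def)
  have "?F \<noteq> {}" using hull hyperplane_point[OF a, of k] by auto
  then obtain f where f: "f \<in> ?F" by blast
  have F: "coord f \<alpha> = of_int k" if "f \<in> ?F" for f
    using that hull hull_subset[of ?F affine] by (auto simp: hyperplane_def)
  have not_in: False if "\<beta> \<noteq> \<alpha>" "\<beta> \<noteq> - \<alpha>" "\<And>f. f \<in> ?F \<Longrightarrow> coord f \<beta> = of_int j" for j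
  proof -
    have "affine hull ?F \<subseteq> hyperplane \<beta> j"
      using that(3) by (intro hull_minimal affine_hyperplane) (auto simp: hyperplane_def)
    then show False using hyperplane_subset_imp[OF a b] that(1,2) hull by metis
  qed
  consider "\<beta> = \<alpha>" | "\<beta> = - \<alpha>" "\<beta> \<noteq> \<alpha>" | "\<beta> \<noteq> \<alpha>" "\<beta> \<noteq> - \<alpha>" by blast
  then show ?thesis
  proof cases
    case 1
    have "of_int \<lfloor>coord y \<alpha>\<rfloor> \<le> (of_int k :: real)"
      using closure_cell(1)[OF a, of f y] f Y F[OF f] by simp
    moreover have "k \<le> \<lfloor>coord y \<alpha>\<rfloor>" using above by linarith
    ultimately show ?thesis using 1 by simp
  next
    case 2
    have m: "coord z \<beta> = - coord z \<alpha>" for z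
      using 2 a by (simp add: coroot_minus pairing_real_linear)
    have "- of_int k \<le> of_int \<lfloor>coord y \<beta>\<rfloor> + (1 :: real)"
      using closure_cell(2)[OF b, of f y] f Y F[OF f] m[of f] by simp
    moreover have "of_int \<lfloor>coord y \<beta>\<rfloor> < - (of_int k :: real)"
      using above m[of y] by linarith
    ultimately have "\<lfloor>coord y \<beta>\<rfloor> = - k - 1" by linarith
    then show ?thesis using 2 by simp
  next
    case 3
    have bx: "of_int \<lfloor>coord x \<beta>\<rfloor> \<le> coord f \<beta>" "coord f \<beta> \<le> of_int \<lfloor>coord x \<beta>\<rfloor> + 1"
      and bY: "of_int \<lfloor>coord y \<beta>\<rfloor> \<le> coord f \<beta>" "coord f \<beta> \<le> of_int \<lfloor>coord y \<beta>\<rfloor> + 1"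
      if "f \<in> ?F" for f
      using closure_cell[OF b, of f x] closure_cell[OF b, of f y] that X Y by simp_all
    have "\<lfloor>coord y \<beta>\<rfloor> = \<lfloor>coord x \<beta>\<rfloor>"
    proof (rule ccontr)
      assume "\<lfloor>coord y \<beta>\<rfloor> \<noteq> \<lfloor>coord x \<beta>\<rfloor>"
      then consider "\<lfloor>coord x \<beta>\<rfloor> + 1 \<le> \<lfloor>coord y \<beta>\<rfloor>" | "\<lfloor>coord y \<beta>\<rfloor> + 1 \<le> \<lfloor>coord x \<beta>\<rfloor>"
        by linarith
      then show False
      proof cases
        case 1
        then have "of_int \<lfloor>coord x \<beta>\<rfloor> + 1 \<le> (of_int \<lfloor>coord y \<beta>\<rfloor> :: real)" by linarith
        then have "coord f \<beta> = of_int (\<lfloor>coord x \<beta>\<rfloor> + 1)" if "f \<in> ?F" for f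
          using bx[OF that] bY[OF that] by simp
        then show False using not_in 3 by blast
      next
        case 2
        then have "of_int \<lfloor>coord y \<beta>\<rfloor> + 1 \<le> (of_int \<lfloor>coord x \<beta>\<rfloor> :: real)" by linarith
        then have "coord f \<beta> = of_int \<lfloor>coord x \<beta>\<rfloor>" if "f \<in> ?F" for f
          using bx[OF that] bY[OF that] by simp
        then show False using not_in 3 by blast
      qed
    qed
    then show ?thesis using 3 by simp
  qed
qed

text \<open>The wall is the supremum of \<open>\<alpha>\<^sup>\<or>\<close> on \<open>X\<close>, and the far side is then determined by its integer
  coordinates. Hence a path is determined by its roots, as is needed for \<open>level\<close> to make sense.\<close>

lemma crosses_unique:
  assumes c: "crosses X \<alpha> k Y" and c': "crosses X \<alpha> k' Y'"
  shows "k = k'" and "Y = Y'"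
proof -
  have le: "k \<le> k'" if c: "crosses X \<alpha> k Y" and c': "crosses X \<alpha> k' Y'" for k k' Y Y'
  proof -
    let ?F = "closure X \<inter> closure Y"
    have hull: "affine hull ?F = hyperplane \<alpha> k" and a: "\<alpha> \<in> roots" using c by (auto simp: crosses_def)
    then have "?F \<noteq> {}" using hyperplane_point[OF a, of k] by auto
    then obtain f where f: "f \<in> ?F" by blast
    then have "coord f \<alpha> = of_int k"
      using hull hull_subset[of ?F affine] by (auto simp: hyperplane_def)
    moreover have "closure X \<subseteq> {x. coord x \<alpha> \<le> of_int k'}"
      using c' by (intro closure_minimal closed_pairing_le) (auto simp: crosses_def less_imp_le)
    ultimately show ?thesis using f by auto
  qed
  show k: "k = k'" using le[OF c c'] le[OF c' c] by simp
  obtain x y y' where x: "x \<in> X" and y: "y \<in> Y" and y': "y' \<in> Y'"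
    using c c' alcove_nonempty unfolding crosses_def by meson
  have "cell y = cell y'"
    using crosses_floor[OF c x y] crosses_floor[OF c' x y'] k by (intro cell_cong) simp
  then show "Y = Y'" using alcove_eq_cell(1)[OF _ y] alcove_eq_cell(1)[OF _ y'] c c' by (simp add: crosses_def)
qed

lemma alcove_walk_unique:
  assumes w: "alcove_walk \<Gamma> ls As" and w': "alcove_walk \<Gamma> ls' As'"
  shows "ls = ls'"
proof (rule nth_equalityI)
  have step: "crosses (As ! t) (\<Gamma> ! t) (ls ! t) (As ! Suc t)" "crosses (As' ! t) (\<Gamma> ! t) (ls' ! t) (As' ! Suc t)"
    if "t < length \<Gamma>" for t using w w' that by (auto simp: alcove_walk_def)
  have "t \<le> length \<Gamma> \<longrightarrow> As ! t = As' ! t" for t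
  proof (induction t)
    case (Suc t)
    then show ?case using step[of t] crosses_unique(2) by (metis Suc_leD Suc_le_lessD)
  qed (use w w' in \<open>simp add: alcove_walk_def\<close>)
  then show "ls ! t = ls' ! t" if "t < length ls" for t
    using that step[of t] crosses_unique(1) w by (metis alcove_walk_def less_imp_le)
qed (use w w' in \<open>simp add: alcove_walk_def\<close>)

lemma level_eq: "alcove_walk \<Gamma> ls As \<Longrightarrow> level \<Gamma> t = ls ! (t - 1)"
  unfolding level_def by (subst the_equality[of _ ls]) (auto dest: alcove_walk_unique)

lemma alcove_walk_roots: "alcove_walk \<Gamma> ls As \<Longrightarrow> set \<Gamma> \<subseteq> roots"
  by (auto simp: alcove_walk_def crosses_def in_set_conv_nth)

lemma gam_in_roots: "set \<Gamma> \<subseteq> roots \<Longrightarrow> t \<in> {1..length \<Gamma>} \<Longrightarrow> gam \<Gamma> t \<in> roots"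
  by (auto simp: gam_def subset_eq)

abbreviation shift_by :: "'i weight \<Rightarrow> real^'i \<Rightarrow> real^'i" where
  "shift_by \<nu> \<equiv> \<lambda>x. x + real_weight \<nu>"

lemma shift_by_eq: "shift_by \<nu> = (\<lambda>x. real_weight \<nu> + x)"
  by (simp add: add.commute)

lemma coord_shift: "coord (shift_by \<nu> x) \<alpha> = coord x \<alpha> + of_int (pairing \<nu> (coroot \<alpha>))"
  by (simp add: pairing_real_linear pairing_real_weight)

lemma cell_shift: "shift_by \<nu> ` cell x = cell (shift_by \<nu> x)"
proof -
  have "y \<in> shift_by \<nu> ` cell x \<longleftrightarrow> y \<in> cell (shift_by \<nu> x)" for y
  proof -
    have "y \<in> shift_by \<nu> ` cell x \<longleftrightarrow> y - real_weight \<nu> \<in> cell x"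
      by (auto simp: image_iff intro!: bexI[of _ "y - real_weight \<nu>"])
    also have "\<dots> \<longleftrightarrow> y \<in> cell (shift_by \<nu> x)"
      unfolding in_cell_iff coord_shift by (simp add: pairing_real_linear pairing_real_weight algebra_simps)
    finally show ?thesis .
  qed
  then show ?thesis by blast
qed

lemma alcove_shift: "X \<in> alcoves \<Longrightarrow> shift_by \<nu> ` X \<in> alcoves"
proof -
  assume X: "X \<in> alcoves"
  then obtain x where x: "x \<in> X" using alcove_nonempty by blast
  have "shift_by \<nu> x \<in> cell (shift_by \<nu> x)"
    using alcove_eq_cell[OF X x] x cell_shift[of \<nu> x] by blast
  then have "shift_by \<nu> x \<in> regular" using cell_subset_regular by blast
  then show ?thesis using cell_is_alcove alcove_eq_cell(1)[OF X x] cell_shift by metis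
qed

lemma hyperplane_shift: "shift_by \<nu> ` hyperplane \<alpha> k = hyperplane \<alpha> (k + pairing \<nu> (coroot \<alpha>))"
proof -
  have "y \<in> shift_by \<nu> ` hyperplane \<alpha> k \<longleftrightarrow> y - real_weight \<nu> \<in> hyperplane \<alpha> k" for y
    by (auto simp: image_iff intro!: bexI[of _ "y - real_weight \<nu>"])
  then show ?thesis
    by (auto simp: hyperplane_def pairing_real_linear pairing_real_weight)
qed

lemma crosses_shift:
  assumes "crosses X \<alpha> k Y"
  shows "crosses (shift_by \<nu> ` X) \<alpha> (k + pairing \<nu> (coroot \<alpha>)) (shift_by \<nu> ` Y)"
proof -
  have inj: "inj (shift_by \<nu>)" by (simp add: inj_def)
  have "closure (shift_by \<nu> ` X) \<inter> closure (shift_by \<nu> ` Y) = shift_by \<nu> ` (closure X \<inter> closure Y)"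
    unfolding image_Int[OF inj] unfolding shift_by_eq closure_translation ..
  then have "affine hull (closure (shift_by \<nu> ` X) \<inter> closure (shift_by \<nu> ` Y))
      = shift_by \<nu> ` (affine hull (closure X \<inter> closure Y))"
    unfolding shift_by_eq by (simp only: affine_hull_translation)
  also have "\<dots> = hyperplane \<alpha> (k + pairing \<nu> (coroot \<alpha>))"
    using assms hyperplane_shift by (simp add: crosses_def)
  finally show ?thesis
    using assms inj unfolding crosses_def
    by (simp add: alcove_shift inj_image_eq_iff coord_shift pairing_real_linear pairing_real_weight)
qed

text \<open>Translated by \<open>\<nu>\<close>, the second walk starts at the last alcove of the first one, and translation
  preserves adjacency and raises the level at a root \<open>\<alpha>\<close> by \<open>\<langle>\<nu>, \<alpha>\<^sup>\<or>\<rangle>\<close>.\<close>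

lemma alcove_walk_append:
  assumes g: "alcove_walk \<Gamma> ls As" and last: "As ! length \<Gamma> = shift_by \<nu> ` fund_alcove"
    and x: "alcove_walk \<Xi> ms Bs"
  shows "alcove_walk (\<Gamma> @ \<Xi>) (ls @ map2 (\<lambda>k \<alpha>. k + pairing \<nu> (coroot \<alpha>)) ms \<Xi>)
      (As @ map (\<lambda>B. shift_by \<nu> ` B) (tl Bs))"
    and "(As @ map (\<lambda>B. shift_by \<nu> ` B) (tl Bs)) ! length (\<Gamma> @ \<Xi>) = shift_by \<nu> ` (Bs ! length \<Xi>)"
proof -
  let ?m = "length \<Gamma>" and ?p = "length \<Xi>"
  let ?Cs = "As @ map (\<lambda>B. shift_by \<nu> ` B) (tl Bs)"
  have len: "length ls = ?m" "length As = Suc ?m" "length ms = ?p" "length Bs = Suc ?p"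
    using g x by (auto simp: alcove_walk_def)
  have C1: "?Cs ! t = As ! t" if "t \<le> ?m" for t using that len by (simp add: nth_append)
  have C2: "?Cs ! (?m + t) = shift_by \<nu> ` (Bs ! t)" if "t \<le> ?p" for t
  proof (cases t)
    case 0
    then show ?thesis using C1[of ?m] last x by (simp add: alcove_walk_def)
  next
    case (Suc s)
    then show ?thesis using that len by (simp add: nth_append nth_tl)
  qed
  show "?Cs ! length (\<Gamma> @ \<Xi>) = shift_by \<nu> ` (Bs ! ?p)" using C2[of ?p] by simp
  show "alcove_walk (\<Gamma> @ \<Xi>) (ls @ map2 (\<lambda>k \<alpha>. k + pairing \<nu> (coroot \<alpha>)) ms \<Xi>) ?Cs"
    unfolding alcove_walk_def
  proof (intro conjI allI impI)
    show "?Cs ! 0 = fund_alcove" using C1[of 0] g by (simp add: alcove_walk_def)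
  next
    fix t assume t: "t < length (\<Gamma> @ \<Xi>)"
    show "crosses (?Cs ! t) ((\<Gamma> @ \<Xi>) ! t) ((ls @ map2 (\<lambda>k \<alpha>. k + pairing \<nu> (coroot \<alpha>)) ms \<Xi>) ! t) (?Cs ! Suc t)"
    proof (cases "t < ?m")
      case True
      then show ?thesis using C1[of t] C1[of "Suc t"] g len by (simp add: alcove_walk_def nth_append)
    next
      case False
      define s where "s = t - ?m"
      have s: "t = ?m + s" "s < ?p" using False t by (auto simp: s_def)
      have "crosses (Bs ! s) (\<Xi> ! s) (ms ! s) (Bs ! Suc s)" using x s by (simp add: alcove_walk_def)
      from crosses_shift[OF this, of \<nu>] show ?thesis
        using C2[of s] C2[of "Suc s"] s len by (simp add: nth_append)
    qed
  qed (simp_all add: len)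
qed

lemma alcove_path_append:
  assumes "alcove_path \<nu> \<Gamma>" "alcove_path \<mu> \<Xi>"
  shows "alcove_path (\<nu> + \<mu>) (\<Gamma> @ \<Xi>)"
    and "t \<in> {1..length \<Gamma>} \<Longrightarrow> level (\<Gamma> @ \<Xi>) t = level \<Gamma> t"
    and "t \<in> {1..length \<Xi>} \<Longrightarrow>
      level (\<Gamma> @ \<Xi>) (length \<Gamma> + t) = level \<Xi> t + pairing \<nu> (coroot (gam \<Xi> t))"
proof -
  obtain ls As ms Bs where g: "alcove_walk \<Gamma> ls As" "As ! length \<Gamma> = shift_by \<nu> ` fund_alcove"
    and x: "alcove_walk \<Xi> ms Bs" "Bs ! length \<Xi> = shift_by \<mu> ` fund_alcove"
    using assms by (auto simp: alcove_path_def)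
  have len: "length ls = length \<Gamma>" "length ms = length \<Xi>"
    using g x by (auto simp: alcove_walk_def)
  note app = alcove_walk_append[OF g x(1)]
  have "shift_by \<nu> ` shift_by \<mu> ` fund_alcove = shift_by (\<nu> + \<mu>) ` fund_alcove"
    by (simp add: image_image real_weight_add add_ac)
  then show "alcove_path (\<nu> + \<mu>) (\<Gamma> @ \<Xi>)"
    unfolding alcove_path_def using app x(2) by metis
  show "level (\<Gamma> @ \<Xi>) t = level \<Gamma> t" if "t \<in> {1..length \<Gamma>}"
    unfolding level_eq[OF app(1)] level_eq[OF g(1)] using that len by (cases t) (simp_all add: nth_append)
  show "level (\<Gamma> @ \<Xi>) (length \<Gamma> + t) = level \<Xi> t + pairing \<nu> (coroot (gam \<Xi> t))" if t: "t \<in> {1..length \<Xi>}"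
  proof -
    obtain s where s: "t = Suc s" "s < length \<Xi>" using t by (cases t) auto
    show ?thesis unfolding level_eq[OF app(1)] level_eq[OF x(1)] gam_def using s len by (simp add: nth_append)
  qed
qed

lemma alcove_path_roots: "alcove_path \<nu> \<Gamma> \<Longrightarrow> set \<Gamma> \<subseteq> roots"
  using alcove_walk_roots by (auto simp: alcove_path_def)

end


section \<open>Decorated quantum walks\<close>

lemma sum_upto_Suc:
  fixes f :: "nat \<Rightarrow> 'b :: comm_monoid_add"
  shows "sum f {u \<in> S. u \<le> Suc t} = sum f {u \<in> S. u \<le> t} + (if Suc t \<in> S then f (Suc t) else 0)"
proof -
  have "{u \<in> S. u \<le> Suc t} = (if Suc t \<in> S then insert (Suc t) {u \<in> S. u \<le> t} else {u \<in> S. u \<le> t})"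
    by (auto simp: le_Suc_eq)
  moreover have "finite {u \<in> S. u \<le> t}" by simp
  ultimately show ?thesis by (simp add: add.commute)
qed

lemma telescope:
  fixes f :: "nat \<Rightarrow> 'b :: ab_group_add"
  shows "(\<Sum>t\<in>{1..n}. f t - f (t - 1)) = f n - f 0"
  by (induction n) simp_all

lemma Collect_interval_append:
  fixes m p :: nat
  assumes "\<And>t. t \<in> {1..m} \<Longrightarrow> R t \<longleftrightarrow> P t" "\<And>t. t \<in> {1..p} \<Longrightarrow> R (m + t) \<longleftrightarrow> Q t"
  shows "{t \<in> {1..m + p}. R t} = {t \<in> {1..m}. P t} \<union> (+) m ` {t \<in> {1..p}. Q t}"
proof (intro equalityI subsetI)
  fix t assume t: "t \<in> {t \<in> {1..m + p}. R t}"
  show "t \<in> {t \<in> {1..m}. P t} \<union> (+) m ` {t \<in> {1..p}. Q t}"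
  proof (cases "t \<le> m")
    case True
    then have "t \<in> {1..m}" using t by simp
    then show ?thesis using t assms(1) by blast
  next
    case False
    then have "t = m + (t - m)" "t - m \<in> {1..p}" using t by auto
    then show ?thesis using t assms(2)[of "t - m"] by (intro UnI2 image_eqI[of _ _ "t - m"]) simp_all
  qed
qed (use assms in auto)

lemma comm_monoid_append:
  fixes m p :: nat
  assumes "S \<subseteq> {1..m}" "R \<subseteq> {1..p}"
  shows "sum f (S \<union> (+) m ` R) = sum f S + (\<Sum>t\<in>R. f (m + t))"
    and "prod g (S \<union> (+) m ` R) = prod g S * (\<Prod>t\<in>R. g (m + t))"
proof -
  have "finite S" "finite R" using assms by (simp_all add: finite_subset)
  moreover have "S \<inter> (+) m ` R = {}" using assms by fastforce
  moreover have "inj_on ((+) m) R" by simp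
  ultimately show "sum f (S \<union> (+) m ` R) = sum f S + (\<Sum>t\<in>R. f (m + t))"
    "prod g (S \<union> (+) m ` R) = prod g S * (\<Prod>t\<in>R. g (m + t))"
    by (simp_all add: sum.union_disjoint prod.union_disjoint sum.reindex prod.reindex)
qed

lemma interval_append: "{1..m + p} = {1..m} \<union> (+) m ` {1..p :: nat}"
  by (auto simp: image_iff)

context simply_laced
begin

lemma QW_D:
  assumes "ws \<in> QW \<Gamma> w"
  shows "length ws = Suc (length \<Gamma>)" "ws ! 0 = w" "t \<le> length \<Gamma> \<Longrightarrow> ws ! t \<in> W"
  using assms by (auto simp: QW_def subset_eq)

lemma finite_QW: "finite (QW \<Gamma> w)"
  by (rule finite_subset[OF _ finite_lists_length_eq[OF finite_W, of "Suc (length \<Gamma>)"]]) (auto simp: QW_def)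

lemma finite_decorated_QW: "finite (decorated_QW \<Gamma> w)"
  unfolding decorated_QW_def by (intro finite_SigmaI finite_QW finite_PiE) (auto simp: S_set_def)

lemma T_set_interval: "T_set \<Gamma> ws \<subseteq> {1..length \<Gamma>}"
  and Tminus_set_interval: "Tminus_set \<Gamma> ws \<subseteq> {1..length \<Gamma>}"
  and S_set_interval: "S_set \<Gamma> ws \<subseteq> {1..length \<Gamma>}"
  by (auto simp: T_set_def Tminus_set_def S_set_def)

lemma QW_step:
  assumes "ws \<in> QW \<Gamma> w" "set \<Gamma> \<subseteq> roots" "t \<in> {1..length \<Gamma>}"
  shows "t \<notin> T_set \<Gamma> ws \<Longrightarrow> ws ! t = ws ! (t - 1)"
    and "t \<in> Tminus_set \<Gamma> ws \<Longrightarrow> t \<in> T_set \<Gamma> ws"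
    and "t \<in> S_set \<Gamma> ws \<Longrightarrow> t \<notin> Tminus_set \<Gamma> ws"
    and "t \<in> T_set \<Gamma> ws \<Longrightarrow> inv (ws ! t) (refl (gam \<Gamma> t) \<nu>) = inv (ws ! (t - 1)) \<nu>"
    and "t \<in> T_set \<Gamma> ws \<Longrightarrow> inv (ws ! t) \<nu> = inv (ws ! (t - 1)) (refl (gam \<Gamma> t) \<nu>)"
    and "t \<in> Tminus_set \<Gamma> ws \<Longrightarrow> rsgn (inv (ws ! t) (gam \<Gamma> t)) = rsgn (gam \<Gamma> t)"
proof -
  let ?x = "ws ! (t - 1)" and ?y = "ws ! t" and ?r = "refl (gam \<Gamma> t)"
  have r: "gam \<Gamma> t \<in> roots" using assms gam_in_roots by blast
  have W: "?x \<in> W" "?y \<in> W" using QW_D(3)[OF assms(1)] assms(3) by auto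
  have step: "?y = ?x \<or> ?y = ?r \<circ> ?x" using assms by (auto simp: QW_def)
  show stay: "t \<notin> T_set \<Gamma> ws \<Longrightarrow> ?y = ?x" using step assms(3) by (auto simp: T_set_def)
  show minus: "t \<in> Tminus_set \<Gamma> ws \<Longrightarrow> t \<in> T_set \<Gamma> ws"
    using stay bruhat_less_imp by (fastforce simp: Tminus_set_def)
  show "t \<in> S_set \<Gamma> ws \<Longrightarrow> t \<notin> Tminus_set \<Gamma> ws"
    using bruhat_less_imp by (fastforce simp: Tminus_set_def S_set_def)
  assume "t \<in> T_set \<Gamma> ws"
  then have y: "?y = ?r \<circ> ?x" by (simp add: T_set_def)
  then have "inv ?y = inv ?x \<circ> ?r" using W_inv_comp[OF refl_in_W[OF r] W(1)] r by (simp add: refl_inv)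
  then show "inv ?y \<nu> = inv ?x (?r \<nu>)" "inv ?y (?r \<nu>) = inv ?x \<nu>"
    using r by (simp_all add: refl_involutive)
next
  let ?x = "ws ! (t - 1)" and ?y = "ws ! t" and ?r = "refl (gam \<Gamma> t)"
  assume t: "t \<in> Tminus_set \<Gamma> ws"
  have r: "gam \<Gamma> t \<in> roots" using assms gam_in_roots by blast
  have less: "bruhat_less ?y ?x" using t by (simp add: Tminus_set_def)
  have "?y = ?x \<or> ?y = ?r \<circ> ?x" using assms by (auto simp: QW_def)
  then have "?y = ?r \<circ> ?x" using bruhat_less_imp[OF less] by auto
  then have "?r \<circ> ?y = ?x" using refl_comp_self[OF r] by (simp add: o_assoc)
  then show "rsgn (inv ?y (gam \<Gamma> t)) = rsgn (gam \<Gamma> t)"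
    using rsgn_eq_if_len_less[of ?y "gam \<Gamma> t"] bruhat_less_imp[OF less] r by simp
qed

lemma coroot_rabs: "\<alpha> \<in> roots \<Longrightarrow> coroot (rabs \<alpha>) = rsgn \<alpha> *s coroot \<alpha>"
  by (simp add: rabs_def rsgn_def coroot_minus)

lemma coqwt_at_0: "coqwt_at \<Gamma> ws b 0 = 0"
proof -
  have "{u \<in> Tminus_set \<Gamma> ws. u \<le> 0} = {}" "{u \<in> S_set \<Gamma> ws. u \<le> 0} = {}"
    by (auto simp: Tminus_set_def S_set_def)
  then show ?thesis by (simp only: coqwt_at_def sum.empty diff_zero)
qed

lemma coqwt_at_Suc:
  "coqwt_at \<Gamma> ws b (Suc t) = coqwt_at \<Gamma> ws b t
     + (if Suc t \<in> Tminus_set \<Gamma> ws then coroot (rabs (inv (ws ! Suc t) (gam \<Gamma> (Suc t)))) else 0)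
     - (if Suc t \<in> S_set \<Gamma> ws then b (Suc t) *s coact (inv (ws ! Suc t)) (coroot (gam \<Gamma> (Suc t))) else 0)"
  by (simp add: coqwt_at_def sum_upto_Suc)

lemma qwt_eq_root_of_coqwt:
  assumes "ws \<in> QW \<Gamma> w" "set \<Gamma> \<subseteq> roots"
  shows "qwt \<Gamma> ws b = root_of (coqwt \<Gamma> ws b)"
proof -
  have g: "gam \<Gamma> u \<in> roots \<and> inv (ws ! u) \<in> W" if "u \<in> {1..length \<Gamma>}" for u
    using that assms(2) gam_in_roots QW_D(3)[OF assms(1)] by auto
  have "(\<Sum>u\<in>{u \<in> Tminus_set \<Gamma> ws. u \<le> length \<Gamma>}. rabs (inv (ws ! u) (gam \<Gamma> u)))
      = root_of (\<Sum>u\<in>{u \<in> Tminus_set \<Gamma> ws. u \<le> length \<Gamma>}. coroot (rabs (inv (ws ! u) (gam \<Gamma> u))))"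
    unfolding root_of_sum
    using g Tminus_set_interval[of \<Gamma> ws] by (intro sum.cong refl) (auto simp: rabs_in_roots subset_eq)
  moreover have "(\<Sum>u\<in>{u \<in> S_set \<Gamma> ws. u \<le> length \<Gamma>}. b u *s inv (ws ! u) (gam \<Gamma> u))
      = root_of (\<Sum>u\<in>{u \<in> S_set \<Gamma> ws. u \<le> length \<Gamma>}. b u *s coact (inv (ws ! u)) (coroot (gam \<Gamma> u)))"
    unfolding root_of_sum
    using g S_set_interval[of \<Gamma> ws] by (intro sum.cong refl) (auto simp: root_of_linear root_of_coact subset_eq)
  ultimately show ?thesis unfolding qwt_def coqwt_def qwt_at_def coqwt_at_def root_of_linear by simp
qed

text \<open>This controls how the degree of a walk changes when the weight is shifted by \<open>\<mu>\<close>. By partial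
  summation the left-hand side is
  \<open>\<langle>w\<^sub>n\<^sup>-\<^sup>1\<mu>, qwt\<^sub>n\<^sup>\<or>\<rangle> - \<Sum> \<langle>w\<^bsub>t-1\<^esub>\<^sup>-\<^sup>1\<mu>, qwt\<^sub>t\<^sup>\<or> - qwt\<^bsub>t-1\<^esub>\<^sup>\<or>\<rangle>\<close>. The term subtracted at step \<open>t\<close> is
  \<open>-b(t)\<langle>\<mu>, \<gamma>\<^sub>t\<^sup>\<or>\<rangle>\<close> for a step in \<open>S\<close> and \<open>-sgn(w\<^sub>t\<^sup>-\<^sup>1\<gamma>\<^sub>t)\<langle>\<mu>, \<gamma>\<^sub>t\<^sup>\<or>\<rangle>\<close> for a descent, as
  \<open>w\<^bsub>t-1\<^esub>\<^sup>-\<^sup>1 = w\<^sub>t\<^sup>-\<^sup>1 s\<^bsub>\<gamma>\<^sub>t\<^esub>\<close>; since the length drops there, \<open>w\<^sub>t\<^sup>-\<^sup>1\<gamma>\<^sub>t\<close> and \<open>\<gamma>\<^sub>t\<close> have the same sign.\<close>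

lemma degree_shift_upto:
  assumes "ws \<in> QW \<Gamma> w" "set \<Gamma> \<subseteq> roots" "n \<le> length \<Gamma>"
  shows "(\<Sum>t\<in>{1..n}. pairing (inv (ws ! t) \<mu> - inv (ws ! (t - 1)) \<mu>) (coqwt_at \<Gamma> ws b t)) =
     pairing (inv (ws ! n) \<mu>) (coqwt_at \<Gamma> ws b n)
     + (\<Sum>t\<in>{t \<in> Tminus_set \<Gamma> ws. t \<le> n}. rsgn (gam \<Gamma> t) * pairing \<mu> (coroot (gam \<Gamma> t)))
     + (\<Sum>t\<in>{t \<in> S_set \<Gamma> ws. t \<le> n}. b t * pairing \<mu> (coroot (gam \<Gamma> t)))"
  using assms(3)
proof (induction n)
  case 0
  have "{u \<in> Tminus_set \<Gamma> ws. u \<le> 0} = {}" "{u \<in> S_set \<Gamma> ws. u \<le> 0} = {}"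
    by (auto simp: Tminus_set_def S_set_def)
  then show ?case by (simp only: coqwt_at_0 pairing_zero_right sum.empty) simp
next
  case (Suc n)
  let ?t = "Suc n"
  let ?\<gamma> = "gam \<Gamma> ?t" and ?x = "ws ! n" and ?y = "ws ! ?t"
  let ?T = "?t \<in> Tminus_set \<Gamma> ws" and ?S = "?t \<in> S_set \<Gamma> ws"
  have t: "?t \<in> {1..length \<Gamma>}" using Suc.prems by simp
  note step = QW_step[OF assms(1,2) t]
  have r: "?\<gamma> \<in> roots" using assms(2) t gam_in_roots by blast
  have W: "?y \<in> W" using QW_D(3)[OF assms(1)] t by auto
  have "- pairing (inv ?x \<mu>) (coqwt_at \<Gamma> ws b ?t - coqwt_at \<Gamma> ws b n) =
      (if ?T then rsgn ?\<gamma> * pairing \<mu> (coroot ?\<gamma>) else 0) + (if ?S then b ?t * pairing \<mu> (coroot ?\<gamma>) else 0)"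
  proof -
    consider "?T" "\<not> ?S" | "?S" "\<not> ?T" | "\<not> ?T" "\<not> ?S" using step(3) by blast
    then show ?thesis
    proof cases
      case 1
      have "inv ?x \<mu> = inv ?y (refl ?\<gamma> \<mu>)" using step(2,4) 1 by simp
      moreover have "coroot (rabs (inv ?y ?\<gamma>)) = rsgn ?\<gamma> *s coact (inv ?y) (coroot ?\<gamma>)"
        using 1 step(6) r W by (simp add: coroot_rabs coroot_W)
      ultimately have "pairing (inv ?x \<mu>) (coroot (rabs (inv ?y ?\<gamma>))) = rsgn ?\<gamma> * pairing (refl ?\<gamma> \<mu>) (coroot ?\<gamma>)"
        using W by (simp add: pairing_linear pairing_coact)
      also have "pairing (refl ?\<gamma> \<mu>) (coroot ?\<gamma>) = - pairing \<mu> (coroot ?\<gamma>)"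
        using r by (simp add: refl_def pairing_linear)
      finally show ?thesis using 1 by (simp add: coqwt_at_Suc)
    next
      case 2
      have "inv ?x \<mu> = inv ?y \<mu>" using 2 by (simp add: S_set_def)
      then show ?thesis using 2 W by (simp add: coqwt_at_Suc pairing_linear pairing_coact)
    qed (simp add: coqwt_at_Suc pairing_linear)
  qed
  then have "pairing (inv ?y \<mu> - inv ?x \<mu>) (coqwt_at \<Gamma> ws b ?t) =
      pairing (inv ?y \<mu>) (coqwt_at \<Gamma> ws b ?t) - pairing (inv ?x \<mu>) (coqwt_at \<Gamma> ws b n)
      + (if ?T then rsgn ?\<gamma> * pairing \<mu> (coroot ?\<gamma>) else 0) + (if ?S then b ?t * pairing \<mu> (coroot ?\<gamma>) else 0)"
    by (simp add: pairing_linear)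
  then show ?case using Suc by (simp add: sum_upto_Suc)
qed

lemma degree_shift:
  assumes "ws \<in> QW \<Gamma> w" "set \<Gamma> \<subseteq> roots"
  shows "(\<Sum>t\<in>{1..length \<Gamma>}. pairing (inv (ws ! t) \<mu> - inv (ws ! (t - 1)) \<mu>) (coqwt_at \<Gamma> ws b t)) =
     pairing (inv (walk_end \<Gamma> ws) \<mu>) (coqwt \<Gamma> ws b)
     + (\<Sum>t\<in>Tminus_set \<Gamma> ws. rsgn (gam \<Gamma> t) * pairing \<mu> (coroot (gam \<Gamma> t)))
     + (\<Sum>t\<in>S_set \<Gamma> ws. b t * pairing \<mu> (coroot (gam \<Gamma> t)))"
proof -
  have "{t \<in> Tminus_set \<Gamma> ws. t \<le> length \<Gamma>} = Tminus_set \<Gamma> ws" "{t \<in> S_set \<Gamma> ws. t \<le> length \<Gamma>} = S_set \<Gamma> ws"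
    using Tminus_set_interval[of \<Gamma> ws] S_set_interval[of \<Gamma> ws] by auto
  then show ?thesis
    using degree_shift_upto[OF assms order_refl, of \<mu> b] by (simp add: walk_end_def coqwt_def)
qed

text \<open>The linear part of \<open>r\<^sub>t\<close> is \<open>w\<^sub>t\<^sup>-\<^sup>1\<close>.\<close>

lemma rhat_affine:
  assumes "ws \<in> QW \<Gamma> w" "set \<Gamma> \<subseteq> roots" "t \<le> length \<Gamma>"
  shows "rhat \<Gamma> ws t (\<nu> + \<mu>) = rhat \<Gamma> ws t \<nu> + inv (ws ! t) \<mu>"
  using assms(3)
proof (induction t arbitrary: \<nu> \<mu>)
  case 0
  then show ?case using QW_D(3)[OF assms(1), of 0] W_linear(1)[OF W_inv] by simp
next
  case (Suc t)
  have t: "Suc t \<in> {1..length \<Gamma>}" using Suc.prems by simp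
  note step = QW_step[OF assms(1,2) t]
  have r: "gam \<Gamma> (Suc t) \<in> roots" using assms(2) t gam_in_roots by blast
  have "aff_refl (gam \<Gamma> (Suc t)) k (\<nu> + \<mu>) = aff_refl (gam \<Gamma> (Suc t)) k \<nu> + refl (gam \<Gamma> (Suc t)) \<mu>" for k
    using W_linear(1)[OF refl_in_W[OF r]] by (simp add: aff_refl_def)
  then show ?case using Suc step(1,5) by simp
qed

section \<open>Concatenation of walks\<close>

text \<open>The end of the first walk is the start of the second one and is listed only once.\<close>

definition walk_append :: "'i weyl list \<Rightarrow> 'i weyl list \<Rightarrow> 'i weyl list" where
  "walk_append ws vs = ws @ tl vs"

text \<open>Steps are numbered from \<open>1\<close> in both paths, so step \<open>t\<close> of the second one becomes step \<open>m + t\<close>.\<close>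

definition deco_append :: "nat \<Rightarrow> (nat \<Rightarrow> int) \<Rightarrow> (nat \<Rightarrow> int) \<Rightarrow> nat \<Rightarrow> int" where
  "deco_append m b c t = (if t \<le> m then b t else c (t - m))"

lemma gam_append:
  "t \<in> {1..length \<Gamma>} \<Longrightarrow> gam (\<Gamma> @ \<Xi>) t = gam \<Gamma> t"
  "t \<in> {1..length \<Xi>} \<Longrightarrow> gam (\<Gamma> @ \<Xi>) (length \<Gamma> + t) = gam \<Xi> t"
  by (auto simp: gam_def nth_append)

lemma nth_walk_append:
  assumes "length ws = Suc m" "length vs = Suc p" "vs ! 0 = ws ! m"
  shows "t \<le> m \<Longrightarrow> walk_append ws vs ! t = ws ! t"
    and "t \<le> p \<Longrightarrow> walk_append ws vs ! (m + t) = vs ! t"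
proof -
  show *: "walk_append ws vs ! t = ws ! t" if "t \<le> m" for t
    using that assms by (simp add: walk_append_def nth_append)
  show "walk_append ws vs ! (m + t) = vs ! t" if "t \<le> p"
    using that assms *[of m] by (cases t) (simp_all add: walk_append_def nth_append nth_tl)
qed

context
  fixes \<nu> \<mu> :: "'i weight" and \<Gamma> \<Xi> :: "'i weight list" and w :: "'i weyl"
    and ws vs :: "'i weyl list" and b c :: "nat \<Rightarrow> int"
  assumes paths: "alcove_path \<nu> \<Gamma>" "alcove_path \<mu> \<Xi>"
    and walks: "ws \<in> QW \<Gamma> w" "vs \<in> QW \<Xi> (walk_end \<Gamma> ws)"
begin

private abbreviation (input) "m \<equiv> length \<Gamma>"
private abbreviation (input) "p \<equiv> length \<Xi>"
private abbreviation (input) "us \<equiv> walk_append ws vs"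
private abbreviation (input) "d \<equiv> deco_append m b c"

lemma roots_of_paths: "set \<Gamma> \<subseteq> roots" "set \<Xi> \<subseteq> roots"
  using paths alcove_path_roots by blast+

lemma us_nth: "t \<le> m \<Longrightarrow> us ! t = ws ! t" "t \<le> p \<Longrightarrow> us ! (m + t) = vs ! t"
  using nth_walk_append QW_D[OF walks(1)] QW_D[OF walks(2)] by (auto simp: walk_end_def)

lemma us_nth_prev:
  "t \<in> {1..m} \<Longrightarrow> us ! (t - 1) = ws ! (t - 1)" "t \<in> {1..p} \<Longrightarrow> us ! (m + t - 1) = vs ! (t - 1)"
  using us_nth(1)[of "t - 1"] us_nth(2)[of "t - 1"] by auto

lemma interval_nth:
  "t \<in> {1..m} \<Longrightarrow> us ! t = ws ! t" "t \<in> {1..p} \<Longrightarrow> us ! (m + t) = vs ! t"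
  using us_nth by auto

lemma sets_append:
  "T_set (\<Gamma> @ \<Xi>) us = T_set \<Gamma> ws \<union> (+) m ` T_set \<Xi> vs"
  "Tminus_set (\<Gamma> @ \<Xi>) us = Tminus_set \<Gamma> ws \<union> (+) m ` Tminus_set \<Xi> vs"
  "S_set (\<Gamma> @ \<Xi>) us = S_set \<Gamma> ws \<union> (+) m ` S_set \<Xi> vs"
  unfolding T_set_def Tminus_set_def S_set_def length_append
  by (intro Collect_interval_append; simp only: interval_nth us_nth_prev gam_append)+

lemma T_set_append_iff:
  "t \<in> {1..m} \<Longrightarrow> t \<in> T_set (\<Gamma> @ \<Xi>) us \<longleftrightarrow> t \<in> T_set \<Gamma> ws"
  "t \<in> {1..p} \<Longrightarrow> m + t \<in> T_set (\<Gamma> @ \<Xi>) us \<longleftrightarrow> t \<in> T_set \<Xi> vs"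
  using T_set_interval[of \<Gamma> ws] T_set_interval[of \<Xi> vs] unfolding sets_append by auto

lemma pos_steps_append:
  "{t \<in> T_set (\<Gamma> @ \<Xi>) us. inv (us ! (t - 1)) (gam (\<Gamma> @ \<Xi>) t) \<in> pos_roots} =
     {t \<in> T_set \<Gamma> ws. inv (ws ! (t - 1)) (gam \<Gamma> t) \<in> pos_roots} \<union>
     (+) m ` {t \<in> T_set \<Xi> vs. inv (vs ! (t - 1)) (gam \<Xi> t) \<in> pos_roots}"
proof -
  have *: "{t \<in> T_set \<Gamma> ws. P t} = {t \<in> {1..length \<Gamma>}. t \<in> T_set \<Gamma> ws \<and> P t}" for \<Gamma> ws P
    using T_set_interval by blast
  show ?thesis
    unfolding * length_append
    by (intro Collect_interval_append; simp only: T_set_append_iff us_nth_prev gam_append)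
qed

lemma walk_append_in_QW: "us \<in> QW (\<Gamma> @ \<Xi>) w"
proof -
  have len: "length ws = Suc m" "length vs = Suc p" using QW_D(1) walks by auto
  have "set us \<subseteq> W"
    using walks len by (auto simp: QW_def walk_append_def dest: list.set_sel(2)[rotated])
  moreover have "us ! t = us ! (t - 1) \<or>
        (us ! t = refl (gam (\<Gamma> @ \<Xi>) t) \<circ> us ! (t - 1) \<and> (\<exists>\<alpha>. QBG_edge (us ! (t - 1)) \<alpha> (us ! t)))"
    if "t \<in> {1..m + p}" for t
  proof -
    from that consider "t \<in> {1..m}" | s where "t = m + s" "s \<in> {1..p}"
      unfolding interval_append by blast
    then show ?thesis
    proof cases
      case 1
      then show ?thesis
        using walks(1) unfolding interval_nth(1)[OF 1] us_nth_prev(1)[OF 1] gam_append(1)[OF 1] QW_def by blast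
    next
      case (2 s)
      show ?thesis
        using walks(2) 2 unfolding 2(1) interval_nth(2)[OF 2(2)] us_nth_prev(2)[OF 2(2)] gam_append(2)[OF 2(2)] QW_def
        by blast
    qed
  qed
  moreover have "us ! 0 = w" using us_nth(1)[of 0] QW_D(2)[OF walks(1)] by simp
  moreover have "length us = Suc (m + p)" using len by (simp add: walk_append_def)
  ultimately show ?thesis unfolding QW_def by simp
qed

lemma walk_end_append: "walk_end (\<Gamma> @ \<Xi>) us = walk_end \<Xi> vs"
  unfolding walk_end_def using us_nth(2)[of p] by simp

lemma deco_nth: "t \<in> {1..m} \<Longrightarrow> d t = b t" "t \<in> {1..p} \<Longrightarrow> d (m + t) = c t"
  by (auto simp: deco_append_def)

lemma S_set_deco: "t \<in> S_set \<Gamma> ws \<Longrightarrow> d t = b t" "t \<in> S_set \<Xi> vs \<Longrightarrow> d (m + t) = c t"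
  using deco_nth S_set_interval by blast+

lemma walk_sign_append: "walk_sign (\<Gamma> @ \<Xi>) us d = walk_sign \<Gamma> ws b * walk_sign \<Xi> vs c"
proof -
  have "(\<Prod>t\<in>S_set (\<Gamma> @ \<Xi>) us. (- 1) ^ nat (d t)) =
      (\<Prod>t\<in>S_set \<Gamma> ws. (- 1) ^ nat (b t)) * (\<Prod>t\<in>S_set \<Xi> vs. (- 1) ^ nat (c t) :: int)"
    unfolding sets_append comm_monoid_append(2)[OF S_set_interval S_set_interval] by (simp add: S_set_deco)
  moreover have "(\<Prod>t\<in>{t \<in> T_set (\<Gamma> @ \<Xi>) us. inv (us ! (t - 1)) (gam (\<Gamma> @ \<Xi>) t) \<in> pos_roots}. - 1) =
      (\<Prod>t\<in>{t \<in> T_set \<Gamma> ws. inv (ws ! (t - 1)) (gam \<Gamma> t) \<in> pos_roots}. - 1) *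
      (\<Prod>t\<in>{t \<in> T_set \<Xi> vs. inv (vs ! (t - 1)) (gam \<Xi> t) \<in> pos_roots}. - 1 :: int)"
    unfolding pos_steps_append
    by (intro comm_monoid_append(2)) (use T_set_interval in blast)+
  ultimately show ?thesis unfolding walk_sign_def by simp
qed

lemma sum_truncated_append:
  fixes f :: "nat \<Rightarrow> 'x :: comm_monoid_add"
  assumes X: "X \<subseteq> {1..m}" and Y: "Y \<subseteq> {1..p}"
  shows "t \<le> m \<Longrightarrow> sum f {u \<in> X \<union> (+) m ` Y. u \<le> t} = sum f {u \<in> X. u \<le> t}"
    and "sum f {u \<in> X \<union> (+) m ` Y. u \<le> m + t} = sum f {u \<in> X. u \<le> m} + (\<Sum>u\<in>{u \<in> Y. u \<le> t}. f (m + u))"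
proof -
  have "{u \<in> X \<union> (+) m ` Y. u \<le> t} = {u \<in> X. u \<le> t}" if "t \<le> m" using that Y by auto
  then show "t \<le> m \<Longrightarrow> sum f {u \<in> X \<union> (+) m ` Y. u \<le> t} = sum f {u \<in> X. u \<le> t}" by simp
  have "{u \<in> X \<union> (+) m ` Y. u \<le> m + t} = {u \<in> X. u \<le> m} \<union> (+) m ` {u \<in> Y. u \<le> t}" using X by auto
  then show "sum f {u \<in> X \<union> (+) m ` Y. u \<le> m + t} = sum f {u \<in> X. u \<le> m} + (\<Sum>u\<in>{u \<in> Y. u \<le> t}. f (m + u))"
    using comm_monoid_append(1)[of "{u \<in> X. u \<le> m}" m "{u \<in> Y. u \<le> t}" p f] X Y by auto
qed

lemma step_terms_append:
  "t \<in> {1..m} \<Longrightarrow> inv (us ! t) (gam (\<Gamma> @ \<Xi>) t) = inv (ws ! t) (gam \<Gamma> t)"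
  "t \<in> {1..p} \<Longrightarrow> inv (us ! (m + t)) (gam (\<Gamma> @ \<Xi>) (m + t)) = inv (vs ! t) (gam \<Xi> t)"
  by (simp_all only: interval_nth gam_append)

lemma coqwt_at_append:
  "t \<le> m \<Longrightarrow> coqwt_at (\<Gamma> @ \<Xi>) us d t = coqwt_at \<Gamma> ws b t"
  "t \<le> p \<Longrightarrow> coqwt_at (\<Gamma> @ \<Xi>) us d (m + t) = coqwt \<Gamma> ws b + coqwt_at \<Xi> vs c t"
proof -
  note trunc = sum_truncated_append[OF Tminus_set_interval Tminus_set_interval]
    sum_truncated_append[OF S_set_interval S_set_interval]
  have terms:
    "(\<Sum>u\<in>{u \<in> Tminus_set \<Gamma> ws. u \<le> t}. coroot (rabs (inv (us ! u) (gam (\<Gamma> @ \<Xi>) u)))) =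
      (\<Sum>u\<in>{u \<in> Tminus_set \<Gamma> ws. u \<le> t}. coroot (rabs (inv (ws ! u) (gam \<Gamma> u))))"
    "(\<Sum>u\<in>{u \<in> Tminus_set \<Xi> vs. u \<le> t}. coroot (rabs (inv (us ! (m + u)) (gam (\<Gamma> @ \<Xi>) (m + u))))) =
      (\<Sum>u\<in>{u \<in> Tminus_set \<Xi> vs. u \<le> t}. coroot (rabs (inv (vs ! u) (gam \<Xi> u))))"
    "(\<Sum>u\<in>{u \<in> S_set \<Gamma> ws. u \<le> t}. d u *s coact (inv (us ! u)) (coroot (gam (\<Gamma> @ \<Xi>) u))) =
      (\<Sum>u\<in>{u \<in> S_set \<Gamma> ws. u \<le> t}. b u *s coact (inv (ws ! u)) (coroot (gam \<Gamma> u)))"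
    "(\<Sum>u\<in>{u \<in> S_set \<Xi> vs. u \<le> t}. d (m + u) *s coact (inv (us ! (m + u))) (coroot (gam (\<Gamma> @ \<Xi>) (m + u)))) =
      (\<Sum>u\<in>{u \<in> S_set \<Xi> vs. u \<le> t}. c u *s coact (inv (vs ! u)) (coroot (gam \<Xi> u)))" for t
    using Tminus_set_interval[of \<Gamma> ws] Tminus_set_interval[of \<Xi> vs] S_set_interval[of \<Gamma> ws] S_set_interval[of \<Xi> vs]
    by (auto intro!: sum.cong simp del: atLeastAtMost_iff
        simp: subset_eq step_terms_append interval_nth gam_append deco_nth)
  show "coqwt_at (\<Gamma> @ \<Xi>) us d t = coqwt_at \<Gamma> ws b t" if "t \<le> m"
    unfolding coqwt_at_def sets_append trunc(1,3)[OF that] terms ..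
  show "coqwt_at (\<Gamma> @ \<Xi>) us d (m + t) = coqwt \<Gamma> ws b + coqwt_at \<Xi> vs c t" if "t \<le> p"
    unfolding coqwt_def coqwt_at_def sets_append trunc(2,4) terms by simp
qed

lemma coqwt_append: "coqwt (\<Gamma> @ \<Xi>) us d = coqwt \<Gamma> ws b + coqwt \<Xi> vs c"
  using coqwt_at_append(2)[of p] by (simp add: coqwt_def)

lemma qwt_append: "qwt (\<Gamma> @ \<Xi>) us d = qwt \<Gamma> ws b + qwt \<Xi> vs c"
  using qwt_eq_root_of_coqwt[OF walk_append_in_QW] qwt_eq_root_of_coqwt[OF walks(1)]
    qwt_eq_root_of_coqwt[OF walks(2)] roots_of_paths
  by (simp add: coqwt_append root_of_linear)

lemma rhat_append_left: "t \<le> m \<Longrightarrow> rhat (\<Gamma> @ \<Xi>) us t = rhat \<Gamma> ws t"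
proof (induction t)
  case 0
  then show ?case using us_nth(1)[of 0] by simp
next
  case (Suc t)
  then have t: "Suc t \<in> {1..m}" by simp
  show ?case
    using Suc by (simp only: rhat.simps T_set_append_iff(1)[OF t] gam_append(1)[OF t]
        alcove_path_append(2)[OF paths t])
qed

text \<open>The second path is shifted by \<open>\<nu>\<close>, so its reflections are conjugated by the translation by \<open>\<nu>\<close>.\<close>

lemma rhat_append_right: "t \<le> p \<Longrightarrow> rhat (\<Gamma> @ \<Xi>) us (m + t) (\<nu> + \<kappa>) = wt \<nu> \<Gamma> ws + rhat \<Xi> vs t \<kappa>"
proof (induction t arbitrary: \<kappa>)
  case 0
  have "rhat \<Gamma> ws m (\<nu> + \<kappa>) = wt \<nu> \<Gamma> ws + inv (ws ! m) \<kappa>"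
    using rhat_affine[OF walks(1) roots_of_paths(1) order_refl] by (simp add: wt_def)
  then show ?case using rhat_append_left[of m] QW_D(2)[OF walks(2)] by (simp add: walk_end_def)
next
  case (Suc t)
  then have t: "Suc t \<in> {1..p}" by simp
  let ?\<gamma> = "gam \<Xi> (Suc t)"
  have "refl ?\<gamma> \<in> W" using gam_in_roots[OF roots_of_paths(2) t] by simp
  then have "aff_refl ?\<gamma> (k + pairing \<nu> (coroot ?\<gamma>)) (\<nu> + \<kappa>) = \<nu> + aff_refl ?\<gamma> k \<kappa>" for k
    by (simp add: aff_refl_def W_linear(1)) (simp add: refl_def vec_eq_iff algebra_simps)
  then show ?case
    using Suc T_set_append_iff(2)[OF t] gam_append(2)[OF t, of \<Gamma>] alcove_path_append(3)[OF paths t] by simp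
qed

lemma wt_append: "wt (\<nu> + \<mu>) (\<Gamma> @ \<Xi>) us = wt \<nu> \<Gamma> ws + wt \<mu> \<Xi> vs"
  using rhat_append_right[of p \<mu>] by (simp add: wt_def)

lemma wt_at_append_left:
  assumes "t \<in> {1..m}"
  shows "wt_at (\<nu> + \<mu>) (\<Gamma> @ \<Xi>) us t = wt_at \<nu> \<Gamma> ws t + (inv (ws ! t) \<mu> - inv (ws ! (t - 1)) \<mu>)"
proof -
  have "t \<le> m" "t - 1 \<le> m" using assms by auto
  then show ?thesis
    by (simp add: wt_at_def rhat_append_left rhat_affine[OF walks(1) roots_of_paths(1)])
qed

lemma wt_at_append_right:
  assumes "t \<in> {1..p}"
  shows "wt_at (\<nu> + \<mu>) (\<Gamma> @ \<Xi>) us (m + t) = wt_at \<mu> \<Xi> vs t"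
proof -
  have "t \<le> p" "t - 1 \<le> p" "m + t - 1 = m + (t - 1)" using assms by auto
  then show ?thesis by (simp add: wt_at_def rhat_append_right del: diff_Suc_1 One_nat_def)
qed

lemma level'_append:
  "t \<in> {1..m} \<Longrightarrow> level' (\<nu> + \<mu>) (\<Gamma> @ \<Xi>) t = level' \<nu> \<Gamma> t + pairing \<mu> (coroot (gam \<Gamma> t))"
  "t \<in> {1..p} \<Longrightarrow> level' (\<nu> + \<mu>) (\<Gamma> @ \<Xi>) (m + t) = level' \<mu> \<Xi> t"
  by (simp_all only: level'_def gam_append alcove_path_append[OF paths] pairing_add_left)

text \<open>Let \<open>\<xi>\<close> be the coweight of the first walk. The degrees fail to add up in three places. The
  quadratic term gains \<open>\<langle>qwt, \<xi>\<rangle>\<close> with \<open>qwt\<close> of the second walk, since the form is symmetric. The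
  second walk gains \<open>\<Sum> \<langle>wt\<^sub>t, \<xi>\<rangle>\<close>, which telescopes to \<open>\<langle>wt - u\<^sup>-\<^sup>1\<mu>, \<xi>\<rangle>\<close> where \<open>u\<close> is the end of the
  first walk. In the first walk the weight is shifted by \<open>\<mu>\<close>, and by \<open>degree_shift\<close> this changes
  its terms by \<open>\<langle>u\<^sup>-\<^sup>1\<mu>, \<xi>\<rangle>\<close> in total.\<close>

lemma walk_deg_append:
  "walk_deg (\<nu> + \<mu>) (\<Gamma> @ \<Xi>) us d = walk_deg \<nu> \<Gamma> ws b + walk_deg \<mu> \<Xi> vs c
     + pairing (wt \<mu> \<Xi> vs + qwt \<Xi> vs c) (coqwt \<Gamma> ws b)"
proof -
  let ?x = "coqwt \<Gamma> ws b" and ?y = "coqwt \<Xi> vs c"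
  have qwt: "qwt \<Gamma> ws b = root_of ?x" "qwt \<Xi> vs c = root_of ?y"
    using qwt_eq_root_of_coqwt walks roots_of_paths by blast+
  have "pairing (root_of (?x + ?y)) (?x + ?y) =
      pairing (root_of ?x) ?x + pairing (root_of ?y) ?y + 2 * pairing (root_of ?y) ?x"
    using form_symmetric[of ?x ?y] by (simp add: root_of_linear pairing_linear)
  then have "pairing (root_of (?x + ?y)) (?x + ?y) div 2 =
      pairing (root_of ?x) ?x div 2 + pairing (root_of ?y) ?y div 2 + pairing (root_of ?y) ?x"
    using form_even[of ?x] form_even[of ?y] by (elim evenE) simp
  then have quadratic: "pairing (qwt (\<Gamma> @ \<Xi>) us d) (coqwt (\<Gamma> @ \<Xi>) us d) div 2 =
      pairing (qwt \<Gamma> ws b) ?x div 2 + pairing (qwt \<Xi> vs c) ?y div 2 + pairing (qwt \<Xi> vs c) ?x"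
    by (simp add: qwt_append coqwt_append qwt root_of_linear)

  have "(\<Sum>t\<in>{1..m}. pairing (wt_at (\<nu> + \<mu>) (\<Gamma> @ \<Xi>) us t) (coqwt_at (\<Gamma> @ \<Xi>) us d t)) =
      (\<Sum>t\<in>{1..m}. pairing (wt_at \<nu> \<Gamma> ws t) (coqwt_at \<Gamma> ws b t)) +
      (\<Sum>t\<in>{1..m}. pairing (inv (ws ! t) \<mu> - inv (ws ! (t - 1)) \<mu>) (coqwt_at \<Gamma> ws b t))"
    unfolding sum.distrib[symmetric]
    by (intro sum.cong refl) (simp only: wt_at_append_left coqwt_at_append(1) pairing_add_left atLeastAtMost_iff)
  moreover have "(\<Sum>t\<in>{1..p}. pairing (wt_at (\<nu> + \<mu>) (\<Gamma> @ \<Xi>) us (m + t)) (coqwt_at (\<Gamma> @ \<Xi>) us d (m + t))) =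
      (\<Sum>t\<in>{1..p}. pairing (wt_at \<mu> \<Xi> vs t) ?x) + (\<Sum>t\<in>{1..p}. pairing (wt_at \<mu> \<Xi> vs t) (coqwt_at \<Xi> vs c t))"
    unfolding sum.distrib[symmetric]
    by (intro sum.cong refl) (simp only: wt_at_append_right coqwt_at_append(2) pairing_add_right atLeastAtMost_iff)
  moreover have "(\<Sum>t\<in>{1..p}. pairing (wt_at \<mu> \<Xi> vs t) ?x) =
      pairing (wt \<mu> \<Xi> vs) ?x - pairing (inv (walk_end \<Gamma> ws) \<mu>) ?x"
    unfolding pairing_sum_left[symmetric] wt_at_def telescope[of "\<lambda>t. rhat \<Xi> vs t \<mu>"]
    using QW_D(2)[OF walks(2)] by (simp add: wt_def pairing_linear)
  ultimately have linear:
    "(\<Sum>t\<in>{1..length (\<Gamma> @ \<Xi>)}. pairing (wt_at (\<nu> + \<mu>) (\<Gamma> @ \<Xi>) us t) (coqwt_at (\<Gamma> @ \<Xi>) us d t)) =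
      (\<Sum>t\<in>{1..m}. pairing (wt_at \<nu> \<Gamma> ws t) (coqwt_at \<Gamma> ws b t)) +
      (\<Sum>t\<in>{1..p}. pairing (wt_at \<mu> \<Xi> vs t) (coqwt_at \<Xi> vs c t)) + pairing (wt \<mu> \<Xi> vs) ?x
     + (\<Sum>t\<in>Tminus_set \<Gamma> ws. rsgn (gam \<Gamma> t) * pairing \<mu> (coroot (gam \<Gamma> t)))
     + (\<Sum>t\<in>S_set \<Gamma> ws. b t * pairing \<mu> (coroot (gam \<Gamma> t)))"
    unfolding length_append interval_append comm_monoid_append(1)[OF order_refl order_refl]
    using degree_shift[OF walks(1) roots_of_paths(1), of \<mu> b] by linarith

  have "(\<Sum>t\<in>Tminus_set \<Gamma> ws. rsgn (gam (\<Gamma> @ \<Xi>) t) * level' (\<nu> + \<mu>) (\<Gamma> @ \<Xi>) t) =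
      (\<Sum>t\<in>Tminus_set \<Gamma> ws. rsgn (gam \<Gamma> t) * level' \<nu> \<Gamma> t) +
      (\<Sum>t\<in>Tminus_set \<Gamma> ws. rsgn (gam \<Gamma> t) * pairing \<mu> (coroot (gam \<Gamma> t)))"
    "(\<Sum>t\<in>Tminus_set \<Xi> vs. rsgn (gam (\<Gamma> @ \<Xi>) (m + t)) * level' (\<nu> + \<mu>) (\<Gamma> @ \<Xi>) (m + t)) =
      (\<Sum>t\<in>Tminus_set \<Xi> vs. rsgn (gam \<Xi> t) * level' \<mu> \<Xi> t)"
    "(\<Sum>t\<in>S_set \<Gamma> ws. d t * level' (\<nu> + \<mu>) (\<Gamma> @ \<Xi>) t) =
      (\<Sum>t\<in>S_set \<Gamma> ws. b t * level' \<nu> \<Gamma> t) + (\<Sum>t\<in>S_set \<Gamma> ws. b t * pairing \<mu> (coroot (gam \<Gamma> t)))"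
    "(\<Sum>t\<in>S_set \<Xi> vs. d (m + t) * level' (\<nu> + \<mu>) (\<Gamma> @ \<Xi>) (m + t)) = (\<Sum>t\<in>S_set \<Xi> vs. c t * level' \<mu> \<Xi> t)"
    using Tminus_set_interval[of \<Gamma> ws] Tminus_set_interval[of \<Xi> vs] S_set_interval[of \<Gamma> ws] S_set_interval[of \<Xi> vs]
    by (auto intro!: sum.cong simp del: atLeastAtMost_iff
        simp: subset_eq gam_append deco_nth level'_append distrib_left sum.distrib[symmetric])
  then have levels:
    "(\<Sum>t\<in>Tminus_set (\<Gamma> @ \<Xi>) us. rsgn (gam (\<Gamma> @ \<Xi>) t) * level' (\<nu> + \<mu>) (\<Gamma> @ \<Xi>) t) =
      (\<Sum>t\<in>Tminus_set \<Gamma> ws. rsgn (gam \<Gamma> t) * level' \<nu> \<Gamma> t) +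
      (\<Sum>t\<in>Tminus_set \<Gamma> ws. rsgn (gam \<Gamma> t) * pairing \<mu> (coroot (gam \<Gamma> t))) +
      (\<Sum>t\<in>Tminus_set \<Xi> vs. rsgn (gam \<Xi> t) * level' \<mu> \<Xi> t)"
    "(\<Sum>t\<in>S_set (\<Gamma> @ \<Xi>) us. d t * level' (\<nu> + \<mu>) (\<Gamma> @ \<Xi>) t) =
      (\<Sum>t\<in>S_set \<Gamma> ws. b t * level' \<nu> \<Gamma> t) + (\<Sum>t\<in>S_set \<Gamma> ws. b t * pairing \<mu> (coroot (gam \<Gamma> t))) +
      (\<Sum>t\<in>S_set \<Xi> vs. c t * level' \<mu> \<Xi> t)"
    unfolding sets_append comm_monoid_append(1)[OF Tminus_set_interval Tminus_set_interval]
      comm_monoid_append(1)[OF S_set_interval S_set_interval] by simp_all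
  show ?thesis
    unfolding walk_deg_def quadratic linear levels pairing_add_left by simp
qed

end

lemma QW_take_drop:
  assumes us: "us \<in> QW (\<Gamma> @ \<Xi>) w"
  shows "take (Suc (length \<Gamma>)) us \<in> QW \<Gamma> w"
    and "drop (length \<Gamma>) us \<in> QW \<Xi> (walk_end \<Gamma> (take (Suc (length \<Gamma>)) us))"
    and "walk_append (take (Suc (length \<Gamma>)) us) (drop (length \<Gamma>) us) = us"
proof -
  let ?m = "length \<Gamma>"
  have len: "length us = Suc (?m + length \<Xi>)" and sub: "set us \<subseteq> W" and z: "us ! 0 = w"
    using us by (auto simp: QW_def)
  have step: "us ! t = us ! (t - 1) \<or>
      (us ! t = refl (gam (\<Gamma> @ \<Xi>) t) \<circ> us ! (t - 1) \<and> (\<exists>\<alpha>. QBG_edge (us ! (t - 1)) \<alpha> (us ! t)))"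
    if "t \<in> {1..?m + length \<Xi>}" for t
    using us that unfolding QW_def by simp
  have "take (Suc ?m) us ! t = take (Suc ?m) us ! (t - 1) \<or>
      (take (Suc ?m) us ! t = refl (gam \<Gamma> t) \<circ> take (Suc ?m) us ! (t - 1) \<and>
       (\<exists>\<alpha>. QBG_edge (take (Suc ?m) us ! (t - 1)) \<alpha> (take (Suc ?m) us ! t)))" if "t \<in> {1..?m}" for t
    using step[of t] that gam_append(1)[OF that] by auto
  then show "take (Suc ?m) us \<in> QW \<Gamma> w"
    unfolding QW_def using len sub z set_take_subset[of "Suc ?m" us] by auto
  have "drop ?m us ! t = drop ?m us ! (t - 1) \<or>
      (drop ?m us ! t = refl (gam \<Xi> t) \<circ> drop ?m us ! (t - 1) \<and>
       (\<exists>\<alpha>. QBG_edge (drop ?m us ! (t - 1)) \<alpha> (drop ?m us ! t)))" if t: "t \<in> {1..length \<Xi>}" for t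
  proof -
    have "?m + t - 1 = ?m + (t - 1)" using t by auto
    then show ?thesis using step[of "?m + t"] t gam_append(2)[OF t] len by auto
  qed
  then show "drop ?m us \<in> QW \<Xi> (walk_end \<Gamma> (take (Suc ?m) us))"
    unfolding QW_def walk_end_def using len sub set_drop_subset[of ?m us] by auto
  show "walk_append (take (Suc ?m) us) (drop ?m us) = us"
    unfolding walk_append_def tl_drop[symmetric] by (metis append_take_drop_id drop_Suc tl_drop)
qed

text \<open>Cutting a decorated walk after the last step of the first path is inverse to concatenation.\<close>

lemma sum_decorated_QW_append:
  fixes g :: "'i weyl list \<Rightarrow> (nat \<Rightarrow> int) \<Rightarrow> 'x :: comm_monoid_add"
  assumes paths: "alcove_path \<nu> \<Gamma>" "alcove_path \<mu> \<Xi>"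
  shows "(\<Sum>(us, d)\<in>decorated_QW (\<Gamma> @ \<Xi>) w. g us d) =
    (\<Sum>(ws, b)\<in>decorated_QW \<Gamma> w. \<Sum>(vs, c)\<in>decorated_QW \<Xi> (walk_end \<Gamma> ws).
       g (walk_append ws vs) (deco_append (length \<Gamma>) b c))"
proof -
  let ?m = "length \<Gamma>"
  let ?D = "SIGMA x : decorated_QW \<Gamma> w. decorated_QW \<Xi> (walk_end \<Gamma> (fst x))"
  let ?app = "\<lambda>((ws, b), (vs, c)). (walk_append ws vs, deco_append ?m b c)"
  \<comment> \<open>A decoration is undefined outside its domain, so the second part has to be reset at \<open>0\<close>,
    where \<open>d\<close> still has the value of the last step of the first path.\<close>
  let ?split = "\<lambda>(us, d). ((take (Suc ?m) us, \<lambda>t. if t \<le> ?m then d t else undefined),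
      (drop ?m us, \<lambda>t. if t = 0 then undefined else d (?m + t)))"
  have S_off: "t \<notin> S_set \<Gamma> ws" if "t = 0 \<or> length \<Gamma> < t" for t \<Gamma> ws
    using that S_set_interval[of \<Gamma> ws] by auto
  have "(\<Sum>(us, d)\<in>decorated_QW (\<Gamma> @ \<Xi>) w. g us d) = (\<Sum>x\<in>?D. case ?app x of (us, d) \<Rightarrow> g us d)"
  proof (rule sum.reindex_bij_witness[of _ ?app ?split])
    fix y assume y: "y \<in> decorated_QW (\<Gamma> @ \<Xi>) w"
    obtain us d where yd: "y = (us, d)" by (cases y)
    let ?ws = "take (Suc ?m) us" and ?vs = "drop ?m us"
    have us: "us \<in> QW (\<Gamma> @ \<Xi>) w" and d: "d \<in> S_set (\<Gamma> @ \<Xi>) us \<rightarrow>\<^sub>E {0, 1}"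
      using y yd by (auto simp: decorated_QW_def)
    note td = QW_take_drop[OF us]
    have S: "S_set (\<Gamma> @ \<Xi>) us = S_set \<Gamma> ?ws \<union> (+) ?m ` S_set \<Xi> ?vs"
      using sets_append(3)[OF paths td(1,2)] td(3) by simp
    have "deco_append ?m (\<lambda>t. if t \<le> ?m then d t else undefined) (\<lambda>t. if t = 0 then undefined else d (?m + t)) = d"
      by (auto simp: deco_append_def fun_eq_iff)
    then show "?app (?split y) = y" using td(3) by (simp add: yd)
    have "(\<lambda>t. if t \<le> ?m then d t else undefined) \<in> S_set \<Gamma> ?ws \<rightarrow>\<^sub>E {0, 1}"
    proof (rule PiE_I)
      fix t assume "t \<in> S_set \<Gamma> ?ws"
      then show "(if t \<le> ?m then d t else undefined) \<in> {0, 1}"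
        using PiE_mem[OF d, of t] S S_set_interval[of \<Gamma> ?ws] by auto
    next
      fix t assume t: "t \<notin> S_set \<Gamma> ?ws"
      have "t \<notin> (+) ?m ` S_set \<Xi> ?vs" if "t \<le> ?m"
        using that S_off[of _ \<Xi> ?vs] by auto
      then show "(if t \<le> ?m then d t else undefined) = undefined"
        using t PiE_arb[OF d, of t] S by auto
    qed
    moreover have "(\<lambda>t. if t = 0 then undefined else d (?m + t)) \<in> S_set \<Xi> ?vs \<rightarrow>\<^sub>E {0, 1}"
    proof (rule PiE_I)
      fix t assume "t \<in> S_set \<Xi> ?vs"
      then show "(if t = 0 then undefined else d (?m + t)) \<in> {0, 1}"
        using PiE_mem[OF d, of "?m + t"] S S_set_interval[of \<Xi> ?vs] by auto
    next
      fix t assume t: "t \<notin> S_set \<Xi> ?vs"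
      have "?m + t \<notin> S_set \<Gamma> ?ws" if "t \<noteq> 0"
        using that S_off[of "?m + t" \<Gamma> ?ws] by simp
      moreover have "?m + t \<notin> (+) ?m ` S_set \<Xi> ?vs" using t by auto
      ultimately show "(if t = 0 then undefined else d (?m + t)) = undefined"
        using PiE_arb[OF d, of "?m + t"] S by auto
    qed
    ultimately show "?split y \<in> ?D" using td by (simp add: yd decorated_QW_def)
    show "(case ?app (?split y) of (us, d) \<Rightarrow> g us d) = (case y of (us, d) \<Rightarrow> g us d)"
      using \<open>?app (?split y) = y\<close> by simp
  next
    fix x assume "x \<in> ?D"
    then obtain ws b vs c where x: "x = ((ws, b), (vs, c))"
      and ws: "ws \<in> QW \<Gamma> w" and vs: "vs \<in> QW \<Xi> (walk_end \<Gamma> ws)"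
      and b: "b \<in> S_set \<Gamma> ws \<rightarrow>\<^sub>E {0, 1}" and c: "c \<in> S_set \<Xi> vs \<rightarrow>\<^sub>E {0, 1}"
      by (auto simp: decorated_QW_def)
    let ?us = "walk_append ws vs" and ?d = "deco_append ?m b c"
    have len: "length ws = Suc ?m" "length vs = Suc (length \<Xi>)" using QW_D(1) ws vs by auto
    have S: "S_set (\<Gamma> @ \<Xi>) ?us = S_set \<Gamma> ws \<union> (+) ?m ` S_set \<Xi> vs" by (rule sets_append(3)[OF paths ws vs])
    have "take (Suc ?m) ?us = ws" using len by (simp add: walk_append_def)
    moreover have "drop ?m ?us = vs"
    proof -
      have "drop ?m ws = [ws ! ?m]" using len by (simp add: Cons_nth_drop_Suc[symmetric])
      moreover have "vs ! 0 = ws ! ?m" using QW_D(2)[OF vs] by (simp add: walk_end_def)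
      ultimately show ?thesis using len by (cases vs) (auto simp: walk_append_def)
    qed
    moreover have "(\<lambda>t. if t \<le> ?m then ?d t else undefined) = b"
    proof
      fix t
      show "(if t \<le> ?m then ?d t else undefined) = b t"
        using PiE_arb[OF b, of t] S_off[of t \<Gamma> ws] by (auto simp: deco_append_def)
    qed
    moreover have "(\<lambda>t. if t = 0 then undefined else ?d (?m + t)) = c"
    proof
      fix t
      show "(if t = 0 then undefined else ?d (?m + t)) = c t"
        using PiE_arb[OF c, of t] S_off[of t \<Xi> vs] by (auto simp: deco_append_def)
    qed
    ultimately show "?split (?app x) = x" by (simp add: x)
    have "?d \<in> S_set (\<Gamma> @ \<Xi>) ?us \<rightarrow>\<^sub>E {0, 1}"
      unfolding S
    proof (rule PiE_I)
      fix t assume "t \<in> S_set \<Gamma> ws \<union> (+) ?m ` S_set \<Xi> vs"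
      then show "?d t \<in> {0, 1}"
        using S_set_deco[OF paths ws vs] PiE_mem[OF b] PiE_mem[OF c] by (elim UnE imageE) auto
    next
      fix t assume t: "t \<notin> S_set \<Gamma> ws \<union> (+) ?m ` S_set \<Xi> vs"
      show "?d t = undefined"
      proof (cases "t \<le> ?m")
        case True
        then show ?thesis using t PiE_arb[OF b, of t] by (simp add: deco_append_def)
      next
        case False
        then have "t = ?m + (t - ?m)" by simp
        then have "t - ?m \<notin> S_set \<Xi> vs" using t by blast
        then show ?thesis using False PiE_arb[OF c] by (simp add: deco_append_def)
      qed
    qed
    then show "?app x \<in> decorated_QW (\<Gamma> @ \<Xi>) w"
      using walk_append_in_QW[OF paths ws vs] by (simp add: x decorated_QW_def)
  qed
  also have "\<dots> = (\<Sum>x\<in>decorated_QW \<Gamma> w. \<Sum>y\<in>decorated_QW \<Xi> (walk_end \<Gamma> (fst x)). case ?app (x, y) of (us, d) \<Rightarrow> g us d)"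
    by (simp add: sum.Sigma finite_decorated_QW split_def)
  finally show ?thesis by (simp add: split_def)
qed

end


section \<open>Euler characteristics and the K-group\<close>

lemma coeff_scale_Schubert: "coeff_scale c (Schubert x \<kappa>) = Poly_Mapping.single (x, \<kappa>) c"
  by (simp add: coeff_scale_def Schubert_def)

lemma of_int_q_pow: "of_int n * q_pow k = Poly_Mapping.single (0, k) n"
  by (simp add: q_pow_def mult_single zero_prod_def flip: single_of_int)

lemma dominant_add: "x \<in> dominant \<Longrightarrow> y \<in> dominant \<Longrightarrow> x + y \<in> dominant"
  by (simp add: dominant_def)

lemma finite_dominant_shift:
  fixes M :: "(int^'i) set"
  assumes "finite M" shows "\<exists>\<delta>\<in>dominant. \<forall>\<mu>\<in>M. \<mu> + \<delta> \<in> dominant"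
proof
  let ?d = "\<chi> i. \<Sum>\<mu>\<in>M. \<bar>\<mu> $ i\<bar>"
  show "?d \<in> dominant" by (simp add: dominant_def sum_nonneg)
  show "\<forall>\<mu>\<in>M. \<mu> + ?d \<in> dominant"
  proof
    fix \<mu> assume \<mu>: "\<mu> \<in> M"
    have "0 \<le> \<mu> $ i + (\<Sum>\<mu>\<in>M. \<bar>\<mu> $ i\<bar>)" for i
    proof -
      have "\<bar>\<mu> $ i\<bar> \<le> (\<Sum>\<mu>\<in>M. \<bar>\<mu> $ i\<bar>)"
        using assms \<mu> by (intro member_le_sum) auto
      then show ?thesis by linarith
    qed
    then show "\<mu> + ?d \<in> dominant" by (simp add: dominant_def)
  qed
qed

context simply_laced
begin

lemma euler_char_single:
  "euler_char (Poly_Mapping.single (x, \<kappa>) (Poly_Mapping.single \<zeta> n)) \<nu> \<beta> = n * gch x (- longest (\<kappa> + \<nu>)) (\<beta> - \<zeta>)"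
proof (cases "n = 0")
  case False
  then have "Poly_Mapping.single \<zeta> n \<noteq> 0"
    by (metis lookup_single_eq lookup_zero)
  with False show ?thesis by (simp add: euler_char_def)
qed (simp add: euler_char_def)

lemma euler_char_add: "euler_char (f + g) \<nu> \<beta> = euler_char f \<nu> \<beta> + euler_char g \<nu> \<beta>"
proof -
  define E where "E = (\<lambda>s c. \<Sum>\<zeta>\<in>Poly_Mapping.keys c. Poly_Mapping.lookup c \<zeta> *
      gch (fst s) (- longest (snd s + \<nu>)) (\<beta> - \<zeta>))"
  have E: "euler_char f \<nu> \<beta> = (\<Sum>s\<in>Poly_Mapping.keys f. E s (Poly_Mapping.lookup f s))" for f
    by (simp add: euler_char_def E_def split_def)
  have "E s (c + d) = E s c + E s d" for s c d
    unfolding E_def by (rule setsum_keys_plus_distrib) (simp_all add: distrib_right)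
  moreover have "E s 0 = 0" for s by (simp add: E_def)
  ultimately show ?thesis unfolding E by (intro setsum_keys_plus_distrib)
qed

lemma euler_char_zero: "euler_char 0 \<nu> \<beta> = 0"
  by (simp add: euler_char_def)

lemma euler_char_diff: "euler_char (f - g) \<nu> \<beta> = euler_char f \<nu> \<beta> - euler_char g \<nu> \<beta>"
  using euler_char_add[of "f - g" g \<nu> \<beta>] by simp

lemma euler_char_sum: "euler_char (\<Sum>i\<in>S. f i) \<nu> \<beta> = (\<Sum>i\<in>S. euler_char (f i) \<nu> \<beta>)"
  by (induction S rule: infinite_finite_induct) (simp_all add: euler_char_zero euler_char_add)

text \<open>The bound \<open>\<nu>\<^sub>0\<close> may be enlarged, so the dominance condition in \<open>K_zero\<close> is harmless.\<close>

lemma K_zero_iff: "K_zero f \<longleftrightarrow> (\<exists>\<nu>\<^sub>0\<in>dominant. \<forall>\<nu>\<in>dominant. \<forall>\<beta>. euler_char f (\<nu>\<^sub>0 + \<nu>) \<beta> = 0)"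
proof
  assume "\<exists>\<nu>\<^sub>0\<in>dominant. \<forall>\<nu>\<in>dominant. \<forall>\<beta>. euler_char f (\<nu>\<^sub>0 + \<nu>) \<beta> = 0"
  then obtain \<nu>0 where \<nu>0: "\<nu>0 \<in> dominant" "\<And>\<nu> \<beta>. \<nu> \<in> dominant \<Longrightarrow> euler_char f (\<nu>0 + \<nu>) \<beta> = 0" by blast
  obtain \<delta> where \<delta>: "\<delta> \<in> dominant" "\<forall>\<mu>\<in>snd ` Poly_Mapping.keys f. \<mu> + \<delta> \<in> dominant"
    using finite_dominant_shift[of "snd ` Poly_Mapping.keys f"] by auto
  show "K_zero f"
    unfolding K_zero_def
  proof (intro bexI[of _ "\<nu>0 + \<delta>"] conjI ballI allI)
    fix s assume "s \<in> Poly_Mapping.keys f"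
    then have "snd s + \<delta> + \<nu>0 \<in> dominant" using dominant_add[OF _ \<nu>0(1)] \<delta>(2) by blast
    then show "case s of (x, \<mu>) \<Rightarrow> \<mu> + (\<nu>0 + \<delta>) \<in> dominant" by (simp add: split_def add_ac)
  next
    fix \<nu> \<beta> assume "\<nu> \<in> (dominant :: (int^'i) set)"
    then show "euler_char f (\<nu>0 + \<delta> + \<nu>) \<beta> = 0"
      using \<nu>0(2)[OF dominant_add[OF \<delta>(1)]] by (simp add: add.assoc)
  qed (intro dominant_add \<nu>0 \<delta>)
qed (auto simp: K_zero_def)

lemma K_zero_diff:
  "K_zero (f - g) \<longleftrightarrow>
    (\<exists>\<nu>\<^sub>0\<in>dominant. \<forall>\<nu>\<in>dominant. \<forall>\<beta>. euler_char f (\<nu>\<^sub>0 + \<nu>) \<beta> = euler_char g (\<nu>\<^sub>0 + \<nu>) \<beta>)"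
  by (simp add: K_zero_iff euler_char_diff)

lemma K_zero_diff_sym: "K_zero (f - g) \<Longrightarrow> K_zero (g - f)"
  unfolding K_zero_diff by metis

lemma K_zero_diff_trans: "K_zero (f - g) \<Longrightarrow> K_zero (g - h) \<Longrightarrow> K_zero (f - h)"
  unfolding K_zero_diff
proof (elim bexE)
  fix a b assume ab: "a \<in> dominant" "b \<in> dominant"
    and fg: "\<forall>\<nu>\<in>dominant. \<forall>\<beta>. euler_char f (a + \<nu>) \<beta> = euler_char g (a + \<nu>) \<beta>"
    and gh: "\<forall>\<nu>\<in>dominant. \<forall>\<beta>. euler_char g (b + \<nu>) \<beta> = euler_char h (b + \<nu>) \<beta>"
  show "\<exists>c\<in>dominant. \<forall>\<nu>\<in>dominant. \<forall>\<beta>. euler_char f (c + \<nu>) \<beta> = euler_char h (c + \<nu>) \<beta>"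
  proof (intro bexI[of _ "a + b"] ballI allI)
    fix \<nu> \<beta> assume "\<nu> \<in> (dominant :: (int^'i) set)"
    then have "b + \<nu> \<in> dominant" "a + \<nu> \<in> dominant" using ab dominant_add by auto
    then have "euler_char f (a + (b + \<nu>)) \<beta> = euler_char g (a + (b + \<nu>)) \<beta>"
      "euler_char g (b + (a + \<nu>)) \<beta> = euler_char h (b + (a + \<nu>)) \<beta>" using fg gh by blast+
    then show "euler_char f (a + b + \<nu>) \<beta> = euler_char h (a + b + \<nu>) \<beta>" by (simp add: add_ac)
  qed (intro dominant_add ab)
qed

text \<open>The coefficients lie in \<open>\<int>[q\<^sup>\<plusminus>\<^sup>1]\<close>, so that the class belongs to \<open>\<K>\<close>.\<close>

definition q_coefficients :: "'i formal \<Rightarrow> bool" where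
  "q_coefficients f \<longleftrightarrow>
     (\<forall>s\<in>Poly_Mapping.keys f. \<forall>(\<beta>, k)\<in>Poly_Mapping.keys (Poly_Mapping.lookup f s). \<beta> = 0)"

lemma q_coefficientsD:
  assumes "q_coefficients f" "(\<beta>, k) \<in> Poly_Mapping.keys (Poly_Mapping.lookup f s)"
  shows "\<beta> = 0"
proof -
  have "s \<in> Poly_Mapping.keys f" using assms(2) by (auto simp: in_keys_iff)
  then show ?thesis using assms by (auto simp: q_coefficients_def)
qed

lemma q_coefficients_add: "q_coefficients f \<Longrightarrow> q_coefficients g \<Longrightarrow> q_coefficients (f + g)"
proof -
  assume fg: "q_coefficients f" "q_coefficients g"
  have "\<beta> = 0" if "(\<beta>, k) \<in> Poly_Mapping.keys (Poly_Mapping.lookup (f + g) s)" for s \<beta> k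
  proof -
    have "(\<beta>, k) \<in> Poly_Mapping.keys (Poly_Mapping.lookup f s) \<union> Poly_Mapping.keys (Poly_Mapping.lookup g s)"
      using that unfolding lookup_add by (rule subsetD[OF keys_add])
    then show ?thesis using fg q_coefficientsD by blast
  qed
  then show "q_coefficients (f + g)" unfolding q_coefficients_def by auto
qed

lemma formal_sums_add: "f \<in> formal_sums \<Longrightarrow> g \<in> formal_sums \<Longrightarrow> f + g \<in> formal_sums"
  using keys_add[of f g] by (auto simp: formal_sums_def)

lemma holds_in_KK_iff:
  assumes "f \<in> formal_sums" "g \<in> formal_sums" "q_coefficients g"
  shows "holds_in_KK f g \<longleftrightarrow> K_zero (f - g)"
proof
  have "K_zero (g - g)" unfolding K_zero_diff by (intro bexI[of _ 0]) (simp_all add: dominant_def)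
  then have "g \<in> K_class g" using assms(2) by (simp add: K_class_def K_rel_def)
  moreover assume "holds_in_KK f g"
  ultimately have "g \<in> K_class f" by (simp add: holds_in_KK_def)
  then show "K_zero (f - g)" by (simp add: K_class_def K_rel_def)
next
  assume K: "K_zero (f - g)"
  have "K_zero (f - h) \<longleftrightarrow> K_zero (g - h)" for h
    using K K_zero_diff_sym[OF K] K_zero_diff_trans by blast
  then have "K_class f = K_class g" using assms by (simp add: K_class_def K_rel_def Image_singleton)
  moreover have "K_class g \<in> KK" using assms(2,3) by (auto simp: KK_def q_coefficients_def)
  ultimately show "holds_in_KK f g" by (simp add: holds_in_KK_def)
qed

lemma FF_eq:
  "FF \<nu> w \<Gamma> = (\<Sum>(ws, b)\<in>decorated_QW \<Gamma> w. Poly_Mapping.single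
     ((walk_end \<Gamma> ws, coqwt \<Gamma> ws b), - longest (wt \<nu> \<Gamma> ws) - longest (qwt \<Gamma> ws b))
     (Poly_Mapping.single (0, walk_deg \<nu> \<Gamma> ws b) (walk_sign \<Gamma> ws b)))"
  by (simp add: FF_def coeff_scale_Schubert of_int_q_pow)

lemma FF_regular: "FF \<nu> w \<Gamma> \<in> formal_sums \<and> q_coefficients (FF \<nu> w \<Gamma>)"
proof -
  let ?t = "\<lambda>ws b. Poly_Mapping.single
     ((walk_end \<Gamma> ws, coqwt \<Gamma> ws b), - longest (wt \<nu> \<Gamma> ws) - longest (qwt \<Gamma> ws b))
     (Poly_Mapping.single (0, walk_deg \<nu> \<Gamma> ws b) (walk_sign \<Gamma> ws b))"
  have t: "?t ws b \<in> formal_sums \<and> q_coefficients (?t ws b)" if "(ws, b) \<in> decorated_QW \<Gamma> w" for ws b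
  proof -
    have "walk_end \<Gamma> ws \<in> W" using that QW_D(3)[of ws \<Gamma> w] by (auto simp: decorated_QW_def walk_end_def)
    then show ?thesis
      by (auto simp: formal_sums_def q_coefficients_def W_aff_iff lookup_single split: if_splits)
  qed
  have "(\<Sum>(ws, b)\<in>S. ?t ws b) \<in> formal_sums \<and> q_coefficients (\<Sum>(ws, b)\<in>S. ?t ws b)"
    if "finite S" "S \<subseteq> decorated_QW \<Gamma> w" for S
    using that
  proof (induction S)
    case empty
    show ?case by (simp add: formal_sums_def q_coefficients_def)
  next
    case (insert a S)
    then show ?case using t[of "fst a" "snd a"]
      by (simp add: split_def formal_sums_add q_coefficients_add)
  qed
  from this[OF finite_decorated_QW order_refl] show ?thesis unfolding FF_eq .
qed

definition FF_character ::
  "'i weight \<Rightarrow> 'i weight list \<Rightarrow> 'i weyl \<Rightarrow> 'i weight \<Rightarrow> 'i aff_weight \<Rightarrow> int" where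
  "FF_character \<nu> \<Gamma> w \<sigma> \<beta> = (\<Sum>(ws, b)\<in>decorated_QW \<Gamma> w. walk_sign \<Gamma> ws b *
     gch (walk_end \<Gamma> ws, coqwt \<Gamma> ws b) (wt \<nu> \<Gamma> ws + qwt \<Gamma> ws b - longest \<sigma>) (\<beta> - (0, walk_deg \<nu> \<Gamma> ws b)))"

text \<open>The weight \<open>-w\<^sub>\<circ>(\<kappa> + \<sigma>)\<close> belonging to \<open>\<kappa> = -w\<^sub>\<circ> wt - w\<^sub>\<circ> qwt\<close> simplifies because \<open>w\<^sub>\<circ>\<close> is a linear
  involution.\<close>

lemma euler_char_FF: "euler_char (FF \<nu> w \<Gamma>) \<sigma> \<beta> = FF_character \<nu> \<Gamma> w \<sigma> \<beta>"
proof -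
  have "- longest (- longest x - longest y + \<sigma>) = x + y - longest \<sigma>" for x y
    by (simp add: W_linear W_diff W_minus longest_involutive)
  then show ?thesis unfolding FF_eq euler_char_sum FF_character_def
    by (intro sum.cong refl) (clarsimp simp: euler_char_single)
qed

text \<open>Classes are compared through their Euler characteristics at all sufficiently dominant \<open>\<sigma>\<close>; this
  makes the hypotheses and the conclusion of the theorem identities between weight multiplicities.\<close>

lemma holds_in_KK_FF_iff:
  assumes "w \<in> W"
  shows "holds_in_KK (coeff_scale (e_exp \<nu>) (Schubert (w, 0) 0)) (FF \<nu> w \<Gamma>) \<longleftrightarrow>
    (\<exists>\<nu>\<^sub>0\<in>dominant. \<forall>\<sigma>. \<sigma> - \<nu>\<^sub>0 \<in> dominant \<longrightarrow>
      (\<forall>\<beta>. gch (w, 0) (- longest \<sigma>) (\<beta> - (\<nu>, 0)) = FF_character \<nu> \<Gamma> w \<sigma> \<beta>))"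
proof -
  let ?f = "coeff_scale (e_exp \<nu>) (Schubert (w, 0) 0)"
  have f: "?f = Poly_Mapping.single ((w, 0), 0) (Poly_Mapping.single (\<nu>, 0) 1)"
    by (simp add: coeff_scale_Schubert e_exp_def)
  have "?f \<in> formal_sums" unfolding f using assms by (auto simp: formal_sums_def W_aff_iff)
  then have K: "holds_in_KK ?f (FF \<nu> w \<Gamma>) \<longleftrightarrow> K_zero (?f - FF \<nu> w \<Gamma>)"
    using FF_regular by (simp add: holds_in_KK_iff)
  have shift: "(\<forall>\<tau>\<in>dominant. \<forall>\<beta>. P (\<nu>\<^sub>0 + \<tau>) \<beta>) \<longleftrightarrow> (\<forall>\<sigma>. \<sigma> - \<nu>\<^sub>0 \<in> dominant \<longrightarrow> (\<forall>\<beta>. P \<sigma> \<beta>))"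
    for \<nu>\<^sub>0 :: "'i weight" and P :: "'i weight \<Rightarrow> 'i aff_weight \<Rightarrow> bool"
  proof (intro iffI allI impI ballI)
    fix \<sigma> :: "'i weight" and \<beta> assume "\<forall>\<tau>\<in>dominant. \<forall>\<beta>. P (\<nu>\<^sub>0 + \<tau>) \<beta>" "\<sigma> - \<nu>\<^sub>0 \<in> dominant"
    then have "P (\<nu>\<^sub>0 + (\<sigma> - \<nu>\<^sub>0)) \<beta>" by blast
    then show "P \<sigma> \<beta>" by simp
  next
    fix \<tau> :: "'i weight" and \<beta> assume "\<forall>\<sigma>. \<sigma> - \<nu>\<^sub>0 \<in> dominant \<longrightarrow> (\<forall>\<beta>. P \<sigma> \<beta>)" and \<tau>: "\<tau> \<in> dominant"
    moreover have "\<nu>\<^sub>0 + \<tau> - \<nu>\<^sub>0 \<in> dominant" using \<tau> by simp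
    ultimately show "P (\<nu>\<^sub>0 + \<tau>) \<beta>" by blast
  qed
  let ?P = "\<lambda>\<sigma> \<beta>. gch (w, 0) (- longest \<sigma>) (\<beta> - (\<nu>, 0)) = FF_character \<nu> \<Gamma> w \<sigma> \<beta>"
  have "K_zero (?f - FF \<nu> w \<Gamma>) \<longleftrightarrow> (\<exists>\<nu>\<^sub>0\<in>dominant. \<forall>\<tau>\<in>dominant. \<forall>\<beta>. ?P (\<nu>\<^sub>0 + \<tau>) \<beta>)"
    unfolding K_zero_diff euler_char_FF f euler_char_single by (simp only: mult_1 add_0)
  then show ?thesis unfolding shift[where P = ?P] K .
qed

text \<open>Expand \<open>e\<^sup>\<nu>\<close> along the first path, which gives characters of Demazure modules of
  \<open>u t\<^sub>\<xi>\<close> for the ends \<open>u\<close> and coweights \<open>\<xi>\<close> of the walks. By the translation symmetry the second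
  formula, known for \<open>u\<close>, can be applied to \<open>u t\<^sub>\<xi>\<close>. Translating back, the powers of \<open>q\<close> on the two
  sides differ by \<open>\<langle>wt + qwt, \<xi>\<rangle>\<close> with \<open>wt\<close> and \<open>qwt\<close> of the second walk, which is exactly the
  defect of additivity of the degree.\<close>

lemma holds_in_KK_append:
  assumes paths: "alcove_path \<nu> \<Gamma>" "alcove_path \<mu> \<Xi>"
    and first: "\<And>w. w \<in> W \<Longrightarrow> holds_in_KK (coeff_scale (e_exp \<nu>) (Schubert (w, 0) 0)) (FF \<nu> w \<Gamma>)"
    and second: "\<And>w. w \<in> W \<Longrightarrow> holds_in_KK (coeff_scale (e_exp \<mu>) (Schubert (w, 0) 0)) (FF \<mu> w \<Xi>)"
    and w: "w \<in> W"
  shows "holds_in_KK (coeff_scale (e_exp (\<nu> + \<mu>)) (Schubert (w, 0) 0)) (FF (\<nu> + \<mu>) w (\<Gamma> @ \<Xi>))"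
proof -
  obtain a where a: "\<And>\<sigma> \<beta>. \<sigma> - a \<in> dominant \<Longrightarrow>
      gch (w, 0) (- longest \<sigma>) (\<beta> - (\<nu>, 0)) = FF_character \<nu> \<Gamma> w \<sigma> \<beta>"
    using first[OF w] unfolding holds_in_KK_FF_iff[OF w] by blast
  have "\<exists>a. \<forall>\<sigma>. \<sigma> - a \<in> dominant \<longrightarrow>
      (\<forall>\<beta>. gch (u, 0) (- longest \<sigma>) (\<beta> - (\<mu>, 0)) = FF_character \<mu> \<Xi> u \<sigma> \<beta>)" if "u \<in> W" for u
    using second[OF that] unfolding holds_in_KK_FF_iff[OF that] by blast
  then obtain h where h: "\<And>u \<sigma> \<beta>. u \<in> W \<Longrightarrow> \<sigma> - h u \<in> dominant \<Longrightarrow>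
      gch (u, 0) (- longest \<sigma>) (\<beta> - (\<mu>, 0)) = FF_character \<mu> \<Xi> u \<sigma> \<beta>"
    by metis
  \<comment> \<open>The twist of the line bundle by the first walk, on top of which the second formula is applied.\<close>
  define \<kappa> where "\<kappa> = (\<lambda>(ws, b). - longest (wt \<nu> \<Gamma> ws) - longest (qwt \<Gamma> ws b))"
  let ?D = "decorated_QW \<Gamma> w"
  \<comment> \<open>There are finitely many walks, so one bound serves for the first formula and for all
    instances of the second one.\<close>
  obtain \<delta> where \<delta>: "\<delta> \<in> dominant"
    "\<forall>\<tau>\<in>insert (- a) ((\<lambda>x. \<kappa> x - h (walk_end \<Gamma> (fst x))) ` ?D). \<tau> + \<delta> \<in> dominant"
    using finite_dominant_shift[of "insert (- a) ((\<lambda>x. \<kappa> x - h (walk_end \<Gamma> (fst x))) ` ?D)"] finite_decorated_QW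
    by blast
  have "gch (w, 0) (- longest \<sigma>) (\<beta> - (\<nu> + \<mu>, 0)) = FF_character (\<nu> + \<mu>) (\<Gamma> @ \<Xi>) w \<sigma> \<beta>"
    if \<sigma>: "\<sigma> - \<delta> \<in> dominant" for \<sigma> \<beta>
  proof -
    have inner: "gch (walk_end \<Gamma> ws, coqwt \<Gamma> ws b) (wt \<nu> \<Gamma> ws + qwt \<Gamma> ws b - longest \<sigma>)
          (\<beta> - (\<mu>, 0) - (0, walk_deg \<nu> \<Gamma> ws b)) =
        (\<Sum>(vs, c)\<in>decorated_QW \<Xi> (walk_end \<Gamma> ws). walk_sign \<Xi> vs c *
          gch (walk_end \<Xi> vs, coqwt \<Gamma> ws b + coqwt \<Xi> vs c)
            (wt \<nu> \<Gamma> ws + wt \<mu> \<Xi> vs + (qwt \<Gamma> ws b + qwt \<Xi> vs c) - longest \<sigma>)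
            (\<beta> - (0, walk_deg \<nu> \<Gamma> ws b + walk_deg \<mu> \<Xi> vs c
              + pairing (wt \<mu> \<Xi> vs + qwt \<Xi> vs c) (coqwt \<Gamma> ws b))))"
      if x: "(ws, b) \<in> ?D" for ws b
    proof -
      let ?u = "walk_end \<Gamma> ws" and ?x = "coqwt \<Gamma> ws b"
      define \<tau> where "\<tau> = wt \<nu> \<Gamma> ws + qwt \<Gamma> ws b - longest \<sigma>"
      have u: "?u \<in> W" using x QW_D(3)[of ws \<Gamma> w] by (auto simp: decorated_QW_def walk_end_def)
      have \<tau>: "\<tau> = - longest (\<kappa> (ws, b) + \<sigma>)"
        by (simp add: \<tau>_def \<kappa>_def W_linear W_diff W_minus longest_involutive)
      have "\<kappa> (ws, b) - h ?u + \<delta> \<in> dominant" using \<delta>(2) x by force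
      then have dom: "\<kappa> (ws, b) + \<sigma> - h ?u \<in> dominant"
        using dominant_add[OF _ \<sigma>] by (fastforce simp: algebra_simps)
      \<comment> \<open>The weight \<open>\<beta> - deg\<close> of the first walk, moved by the translation from \<open>u t\<^sub>\<xi>\<close> to \<open>u\<close>.\<close>
      define \<beta>' where "\<beta>' = \<beta> - (0, walk_deg \<nu> \<Gamma> ws b) + (0, pairing \<tau> ?x)"
      have "gch (?u, ?x) \<tau> (\<beta> - (\<mu>, 0) - (0, walk_deg \<nu> \<Gamma> ws b)) = gch (?u, 0) \<tau> (\<beta>' - (\<mu>, 0))"
        using gch_translate[OF u, of 0 ?x] by (simp add: \<beta>'_def algebra_simps)
      also have "\<dots> = (\<Sum>(vs, c)\<in>decorated_QW \<Xi> ?u. walk_sign \<Xi> vs c *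
          gch (walk_end \<Xi> vs, coqwt \<Xi> vs c) (wt \<mu> \<Xi> vs + qwt \<Xi> vs c + \<tau>) (\<beta>' - (0, walk_deg \<mu> \<Xi> vs c)))"
        unfolding \<tau> h[OF u dom] FF_character_def by simp
      also have "\<dots> = (\<Sum>(vs, c)\<in>decorated_QW \<Xi> ?u. walk_sign \<Xi> vs c *
          gch (walk_end \<Xi> vs, coqwt \<Xi> vs c + ?x) (wt \<mu> \<Xi> vs + qwt \<Xi> vs c + \<tau>)
            (\<beta> - (0, walk_deg \<nu> \<Gamma> ws b + walk_deg \<mu> \<Xi> vs c + pairing (wt \<mu> \<Xi> vs + qwt \<Xi> vs c) ?x)))"
      proof (intro sum.cong refl, clarify)
        fix vs c assume "(vs, c) \<in> decorated_QW \<Xi> ?u"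
        then have v: "walk_end \<Xi> vs \<in> W"
          using QW_D(3)[of vs \<Xi> ?u] by (auto simp: decorated_QW_def walk_end_def)
        let ?y = "wt \<mu> \<Xi> vs + qwt \<Xi> vs c"
        have "\<beta> - (0, walk_deg \<nu> \<Gamma> ws b + walk_deg \<mu> \<Xi> vs c + pairing ?y ?x) + (0, pairing (?y + \<tau>) ?x) =
            \<beta>' - (0, walk_deg \<mu> \<Xi> vs c)"
          by (cases \<beta>) (simp add: \<beta>'_def pairing_add_left)
        then show "walk_sign \<Xi> vs c * gch (walk_end \<Xi> vs, coqwt \<Xi> vs c) (?y + \<tau>) (\<beta>' - (0, walk_deg \<mu> \<Xi> vs c)) =
            walk_sign \<Xi> vs c * gch (walk_end \<Xi> vs, coqwt \<Xi> vs c + ?x) (?y + \<tau>)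
              (\<beta> - (0, walk_deg \<nu> \<Gamma> ws b + walk_deg \<mu> \<Xi> vs c + pairing ?y ?x))"
          unfolding gch_translate[OF v] by simp
      qed
      finally show ?thesis unfolding \<tau>_def by (simp add: algebra_simps)
    qed
    have "- a + \<delta> \<in> dominant" using \<delta>(2) by blast
    then have "\<sigma> - a \<in> dominant" using dominant_add[OF _ \<sigma>] by (fastforce simp: algebra_simps)
    then have "gch (w, 0) (- longest \<sigma>) (\<beta> - (\<mu>, 0) - (\<nu>, 0)) = FF_character \<nu> \<Gamma> w \<sigma> (\<beta> - (\<mu>, 0))"
      by (rule a)
    also have "\<dots> = (\<Sum>(ws, b)\<in>?D. \<Sum>(vs, c)\<in>decorated_QW \<Xi> (walk_end \<Gamma> ws).
        walk_sign \<Gamma> ws b * walk_sign \<Xi> vs c *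
          gch (walk_end \<Xi> vs, coqwt \<Gamma> ws b + coqwt \<Xi> vs c)
            (wt \<nu> \<Gamma> ws + wt \<mu> \<Xi> vs + (qwt \<Gamma> ws b + qwt \<Xi> vs c) - longest \<sigma>)
            (\<beta> - (0, walk_deg \<nu> \<Gamma> ws b + walk_deg \<mu> \<Xi> vs c
              + pairing (wt \<mu> \<Xi> vs + qwt \<Xi> vs c) (coqwt \<Gamma> ws b))))"
      unfolding FF_character_def
      by (intro sum.cong refl, clarify, subst inner) (simp_all add: sum_distrib_left split_def mult.assoc)
    also have "\<dots> = FF_character (\<nu> + \<mu>) (\<Gamma> @ \<Xi>) w \<sigma> \<beta>"
      unfolding FF_character_def sum_decorated_QW_append[OF paths]
    proof (intro sum.cong refl, clarify, intro sum.cong refl, clarify)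
      fix ws b vs c
      assume "(ws, b) \<in> ?D" "(vs, c) \<in> decorated_QW \<Xi> (walk_end \<Gamma> ws)"
      then have "ws \<in> QW \<Gamma> w" "vs \<in> QW \<Xi> (walk_end \<Gamma> ws)" by (auto simp: decorated_QW_def)
      note walks = paths this
      show "walk_sign \<Gamma> ws b * walk_sign \<Xi> vs c *
          gch (walk_end \<Xi> vs, coqwt \<Gamma> ws b + coqwt \<Xi> vs c)
            (wt \<nu> \<Gamma> ws + wt \<mu> \<Xi> vs + (qwt \<Gamma> ws b + qwt \<Xi> vs c) - longest \<sigma>)
            (\<beta> - (0, walk_deg \<nu> \<Gamma> ws b + walk_deg \<mu> \<Xi> vs c
              + pairing (wt \<mu> \<Xi> vs + qwt \<Xi> vs c) (coqwt \<Gamma> ws b))) =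
         walk_sign (\<Gamma> @ \<Xi>) (walk_append ws vs) (deco_append (length \<Gamma>) b c) *
         gch (walk_end (\<Gamma> @ \<Xi>) (walk_append ws vs), coqwt (\<Gamma> @ \<Xi>) (walk_append ws vs) (deco_append (length \<Gamma>) b c))
           (wt (\<nu> + \<mu>) (\<Gamma> @ \<Xi>) (walk_append ws vs) + qwt (\<Gamma> @ \<Xi>) (walk_append ws vs) (deco_append (length \<Gamma>) b c) - longest \<sigma>)
           (\<beta> - (0, walk_deg (\<nu> + \<mu>) (\<Gamma> @ \<Xi>) (walk_append ws vs) (deco_append (length \<Gamma>) b c)))"
        unfolding walk_sign_append[OF walks] walk_end_append[OF walks] coqwt_append[OF walks]
          wt_append[OF walks] qwt_append[OF walks] walk_deg_append[OF walks] ..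
    qed
    finally show ?thesis by (simp add: algebra_simps)
  qed
  then show ?thesis unfolding holds_in_KK_FF_iff[OF w] using \<delta>(1) by blast
qed

end

theorem proposition3p7:
  fixes A :: "int^'i^'i" and lam mu :: "int^'i" and Gam Xi :: "(int^'i) list"
  assumes "simply_laced A"
    and "simply_laced.alcove_path A lam Gam"
    and "simply_laced.alcove_path A mu Xi"
    and "\<forall>w\<in>simply_laced.W A. simply_laced.holds_in_KK A
           (coeff_scale (e_exp lam) (Schubert (w, 0) 0)) (simply_laced.FF A lam w Gam)"
    and "\<forall>w\<in>simply_laced.W A. simply_laced.holds_in_KK A
           (coeff_scale (e_exp mu) (Schubert (w, 0) 0)) (simply_laced.FF A mu w Xi)"
  shows "simply_laced.alcove_path A (lam + mu) (Gam @ Xi) \<and>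
    (\<forall>w\<in>simply_laced.W A. simply_laced.holds_in_KK A
           (coeff_scale (e_exp (lam + mu)) (Schubert (w, 0) 0)) (simply_laced.FF A (lam + mu) w (Gam @ Xi)))"
proof -
  interpret simply_laced A by (rule assms(1))
  show ?thesis
    using alcove_path_append(1)[OF assms(2,3)] holds_in_KK_append[OF assms(2,3)] assms(4,5) by blast
qed

end
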